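(* Let $K_1,\dots,K_n\in C^2_+$ be convex bodies in $\mathbb{R}^n$ and let $\phi_1,\dots,\phi_n\in Conc(0,\infty)$ be homogeneous of degrees $r_1,\dots,r_n\in[0,1)$ respectively. Then $$as(\phi_1,K_1;\cdots;\phi_n,K_n)\,as(\phi_1,K_1^\circ;\cdots;\phi_n,K_n^\circ)\le n^2\prod_{i=1}^n\big[\phi_i(1)^2\,|K_i|\,|K_i^\circ|\big]^{\frac1n}.$$ Moreover, if all $K_i$ have centroid at the origin, then $$as(\phi_1,K_1;\cdots;\phi_n,K_n)\,as(\phi_1,K_1^\circ;\cdots;\phi_n,K_n^\circ)\le\big[as(\phi_1,B^n_2;\cdots;\phi_n,B^n_2)\big]^2,$$ with equality if all $K_i$ are origin-symmetric ellipsoids that are dilates of one another.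
   Context: Let $n\ge2$. $|\cdot|$ denotes volume in $\mathbb{R}^n$, $B^n_2$ the unit Euclidean ball, $S^{n-1}=\partial B^n_2$, and $\sigma$ the usual surface area measure on $S^{n-1}$. $K\in C^2_+$ means that $K$ is a convex body in $\mathbb{R}^n$ with the origin in its interior and with $C^2$ boundary having everywhere strictly positive Gaussian curvature. $h_K(u)=\max_{x\in K}\langle x,u\rangle$ is the support function, and the curvature function $f_K(u)$, $u\in S^{n-1}$, is the reciprocal of the Gauss curvature of $\partial K$ at the point with outer unit normal $u$. The polar body is $K^\circ=\{y\in\mathbb{R}^n:\langle x,y\rangle\le1\ \forall x\in K\}$. $Conc(0,\infty)$ is the set of functions $\phi:(0,\infty)\to(0,\infty)$ such that either $\phi$ is a nonzero constant function, or $\phi$ is concave with $\lim_{t\to0}\phi(t)=0$ and $\lim_{t\to\infty}\phi(t)/t=0$. $\phi$ is homogeneous of degree $r$ if $\phi(\lambda t)=\lambda^r\phi(t)$ for all $\lambda,t>0$. The general mixed $L_\phi$-affine surface area, for $\phi_i\in Conc(0,\infty)$ and $K_i\in C^2_+$, is $$as(\phi_1,K_1;\cdots;\phi_n,K_n)=\int_{S^{n-1}}\prod_{i=1}^n\left[\phi_i\!\left(\frac{1}{f_{K_i}(u)h_{K_i}^{n+1}(u)}\right)h_{K_i}(u)f_{K_i}(u)\right]^{\frac1n}d\sigma(u).$$ Two bodies are dilates of one another if one is a positive scalar multiple of the other. *)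

theory Defs
  imports "HOL-Analysis.Analysis"
begin

text \<open>The dimension is \<open>n = CARD('n)\<close>; a family of \<open>n\<close> bodies or functions is indexed by
  the same type \<open>'n\<close>.\<close>

subsection \<open>Convex bodies and their boundaries\<close>

definition convex_body :: "(real ^ 'n) set \<Rightarrow> bool" where
  "convex_body K \<longleftrightarrow> compact K \<and> convex K \<and> interior K \<noteq> {}"

text \<open>\<open>G\<close> is the gradient of \<open>g\<close> and \<open>H\<close> its Hessian matrix.\<close>

definition C2_function_on ::
    "(real ^ 'n) set \<Rightarrow> (real ^ 'n \<Rightarrow> real) \<Rightarrow> (real ^ 'n \<Rightarrow> real ^ 'n) \<Rightarrow> bool" where
  "C2_function_on U g G \<longleftrightarrow>
     (\<exists>H :: real ^ 'n \<Rightarrow> real ^ 'n ^ 'n.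
        continuous_on U H \<and>
        (\<forall>y\<in>U. (g has_derivative (\<lambda>v. G y \<bullet> v)) (at y) \<and>
               (G has_derivative (\<lambda>v. H y *v v)) (at y)))"

definition C2_hypersurface :: "(real ^ 'n) set \<Rightarrow> bool" where
  "C2_hypersurface S \<longleftrightarrow>
     (\<forall>x\<in>S. \<exists>U g G. open U \<and> x \<in> U \<and> C2_function_on U g G \<and>
        (\<forall>y\<in>U. G y \<noteq> 0) \<and> S \<inter> U = {y \<in> U. g y = 0})"

text \<open>The outer unit normal at a boundary point; it is unique for a convex body with \<open>C\<^sup>2\<close>
  boundary.\<close>

definition outer_normal :: "(real ^ 'n) set \<Rightarrow> real ^ 'n \<Rightarrow> real ^ 'n" where
  "outer_normal K x = (THE u. norm u = 1 \<and> (\<forall>y\<in>K. y \<bullet> u \<le> x \<bullet> u))"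

text \<open>The Gauss curvature is the determinant of the Weingarten map, that is, of the differential
  of the Gauss map \<open>outer_normal K\<close> on the tangent space at \<open>x\<close>. The derivative relative to
  \<open>frontier K\<close> determines a linear map \<open>D\<close> only on the tangent space, so \<open>D\<close> is precomposed with
  the orthogonal projection to that space; adding the identity on the normal line gives an
  endomorphism of the whole space with the same determinant. With the outer normal, a sphere of
  radius \<open>R\<close> has curvature \<open>1 / R ^ (n - 1)\<close>.\<close>

definition gauss_curvature :: "(real ^ 'n) set \<Rightarrow> real ^ 'n \<Rightarrow> real" where
  "gauss_curvature K x =
     (let \<nu> = outer_normal K x;
          D = frechet_derivative (outer_normal K) (at x within frontier K)
      in det (matrix (\<lambda>v. D (v - (v \<bullet> \<nu>) *\<^sub>R \<nu>) + (v \<bullet> \<nu>) *\<^sub>R \<nu>)))"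

definition C2_plus :: "(real ^ 'n) set \<Rightarrow> bool" where
  "C2_plus K \<longleftrightarrow> convex_body K \<and> 0 \<in> interior K \<and> C2_hypersurface (frontier K) \<and>
     (\<forall>x\<in>frontier K. gauss_curvature K x > 0)"

definition support_function :: "(real ^ 'n) set \<Rightarrow> real ^ 'n \<Rightarrow> real" where
  "support_function K u = (SUP x\<in>K. x \<bullet> u)"

definition curvature_function :: "(real ^ 'n) set \<Rightarrow> real ^ 'n \<Rightarrow> real" where
  "curvature_function K u =
     1 / gauss_curvature K (THE x. x \<in> frontier K \<and> outer_normal K x = u)"

definition polar_body :: "(real ^ 'n) set \<Rightarrow> (real ^ 'n) set" where
  "polar_body K = {y. \<forall>x\<in>K. x \<bullet> y \<le> 1}"

definition centroid :: "(real ^ 'n) set \<Rightarrow> real ^ 'n" where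
  "centroid K = (1 / measure lebesgue K) *\<^sub>R set_lebesgue_integral lebesgue K (\<lambda>x. x)"

definition ellipsoid :: "(real ^ 'n) set \<Rightarrow> bool" where
  "ellipsoid E \<longleftrightarrow>
     (\<exists>(A :: real ^ 'n ^ 'n) a. invertible A \<and> E = (\<lambda>x. a + A *v x) ` cball 0 1)"

definition origin_symmetric :: "(real ^ 'n) set \<Rightarrow> bool" where
  "origin_symmetric K \<longleftrightarrow> uminus ` K = K"

definition dilates :: "(real ^ 'n) set \<Rightarrow> (real ^ 'n) set \<Rightarrow> bool" where
  "dilates K L \<longleftrightarrow> (\<exists>c>0. K = (\<lambda>x. c *\<^sub>R x) ` L)"

subsection \<open>The surface area measure of the unit sphere\<close>

text \<open>The polar-coordinate construction: the surface area of a Borel subset \<open>A\<close> of the sphere is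
  \<open>n\<close> times the volume of the cone \<open>{t *\<^sub>R u | t u. 0 < t \<and> t \<le> 1 \<and> u \<in> A}\<close>.\<close>

definition sphere_measure :: "(real ^ 'n) measure" where
  "sphere_measure =
     scale_measure (of_nat CARD('n))
       (distr (restrict_space lborel (cball 0 1 - {0})) (restrict_space borel (sphere 0 1))
          (\<lambda>x. x /\<^sub>R norm x))"

subsection \<open>Mixed affine surface areas\<close>

text \<open>Functions on the open half-line are functions on \<open>real\<close> of which only the values at
  positive arguments matter.\<close>

definition Conc :: "(real \<Rightarrow> real) set" where
  "Conc = {\<phi>. (\<forall>t>0. \<phi> t > 0) \<and>
     ((\<exists>c. c \<noteq> 0 \<and> (\<forall>t>0. \<phi> t = c)) \<or>
      (concave_on {0<..} \<phi> \<and> (\<phi> \<longlongrightarrow> 0) (at_right 0) \<and> ((\<lambda>t. \<phi> t / t) \<longlongrightarrow> 0) at_top))}"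

definition homogeneous :: "real \<Rightarrow> (real \<Rightarrow> real) \<Rightarrow> bool" where
  "homogeneous r \<phi> \<longleftrightarrow> (\<forall>c>0. \<forall>t>0. \<phi> (c * t) = c powr r * \<phi> t)"

definition mixed_as :: "('n \<Rightarrow> real \<Rightarrow> real) \<Rightarrow> ('n \<Rightarrow> (real ^ 'n) set) \<Rightarrow> real" where
  "mixed_as \<phi> K =
     (\<integral>u. (\<Prod>i\<in>UNIV.
        (\<phi> i (1 / (curvature_function (K i) u * support_function (K i) u ^ (CARD('n) + 1)))
           * support_function (K i) u * curvature_function (K i) u) powr (1 / real CARD('n)))
      \<partial>sphere_measure)"

end

theory Submission
  imports Defs "HOL-Probability.Distribution_Functions" "HOL-Probability.Distributions"
begin

text \<open>By homogeneity, \<open>\<phi> t = \<phi> 1 * t powr r\<close>, so each factor of the integrand is, up to the constant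
  \<open>\<phi> 1\<close>, the product of \<open>h * f\<close> to the power \<open>1 - r\<close> and \<open>1 / h ^ n\<close> to the power \<open>r\<close>. Integrating
  in cones instead of over the sphere, the homogeneous extension of the Gauss map shows that \<open>h * f\<close>
  integrates to \<open>n\<close> times the volume of \<open>K\<close>, and a radial map shows that \<open>1 / h ^ n\<close> integrates to \<open>n\<close>
  times the volume of the polar body. Hoelder's inequality with \<open>2 * n\<close> functions bounds the mixed
  affine surface area of the \<open>K i\<close>; applying it to the polar bodies as well makes the exponents add up
  to \<open>1 / n\<close>.

  The second inequality is then the Blaschke--Santalo inequality. It is derived from its functional
  form for Gaussian functions of the gauges, which is proved by induction on the dimension following
  Lehec: a median hyperplane and a shear reduce it to the inequality on the half-line, a case of the
  Prekopa--Leindler inequality.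

  For a centered ellipsoid, \<open>f * h ^ (n + 1)\<close> is constant, which makes both surface areas explicit.\<close>

text \<open>Nothing here shows that the polar of a \<open>C2_plus\<close> body is again bounded by a
  C2 hypersurface. The proof works with a larger class of bodies instead: the Gauss map is
  single-valued, differentiable along the frontier, and has positive Jacobian. This class is closed
  under polarity and still supports the change of variables. Curvature is then only a pointwise
  quantity of unknown regularity, so the integrands on the ball inherit their integrability from the
  constant 1 on the body.

  The obstacle in the Santalo part is the choice of origin. The inductive statement provides some
  origin \<open>z\<close> determined by one function of the pair, but the hypothesis centers
  \<open>K\<close> at its own centroid. The two are reconciled by exchanging roles: the point is
  taken for the partner \<open>g\<close>, and the tilt by \<open>exp (ip I z y)\<close> that it puts
  on the centered \<open>f\<close> can only increase the integral, because
  \<open>exp t \<ge> 1 + t\<close> and the linear term integrates to zero.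

  No Gaussian constant is evaluated: the unit ball obeys the same layer formula as \<open>K\<close>,
  so the constants cancel.\<close>

section \<open>Change of variables\<close>

text \<open>The change of variables theorem of HOL-Analysis is restricted to well-ordered index types.\<close>

typedef (overloaded) ('n::finite) idx = "{..<CARD('n)}"
  by (auto intro!: exI[of _ 0])

setup_lifting type_definition_idx

instance idx :: (finite) finite
proof
  have "(UNIV :: 'a idx set) = Abs_idx ` {..<CARD('a)}"
    by (metis type_definition.Abs_image type_definition_idx)
  thus "finite (UNIV :: 'a idx set)" by (metis finite_imageI finite_lessThan)
qed

instantiation idx :: (finite) wellorder
begin
lift_definition less_eq_idx :: "'a idx \<Rightarrow> 'a idx \<Rightarrow> bool" is "(\<le>)" .
lift_definition less_idx :: "'a idx \<Rightarrow> 'a idx \<Rightarrow> bool" is "(<)" .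
instance
proof
  fix P :: "'a idx \<Rightarrow> bool" and a :: "'a idx"
  assume step: "\<And>x. (\<And>y. y < x \<Longrightarrow> P y) \<Longrightarrow> P x"
  show "P a"
  proof (induction "Rep_idx a" arbitrary: a rule: less_induct)
    case less
    show ?case by (rule step, rule less) (simp add: less_idx.rep_eq)
  qed
qed (transfer; auto)+
end

lemma ex_bij_idx: "\<exists>e :: 'n::finite idx \<Rightarrow> 'n. bij e"
proof -
  have "card (UNIV :: 'n idx set) = CARD('n)"
    by (metis card_lessThan type_definition.card type_definition_idx)
  then show ?thesis
    by (metis finite finite_same_card_bij)
qed

text \<open>Conjugation by \<open>e\<close> is a sign-preserving bijection between the permutations
  of the two index types, so the two Leibniz sums agree term by term.\<close>

lemma det_reindex:
  fixes e :: "'m::finite \<Rightarrow> 'n::finite" and A :: "real ^ 'n ^ 'n"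
  assumes e: "bij e"
  shows "det (\<chi> i j. A $ e i $ e j) = det A"
proof -
  let ?c = "\<lambda>p. e \<circ> p \<circ> inv e"
  have inj: "inj e" and e': "bij_betw e UNIV UNIV" and sj: "surj e" using e by (auto simp: bij_def)
  have c: "?c = map_permutation UNIV e"
    using sj by (simp add: map_permutation_def restrict_id_def fun_eq_iff)
  have bij: "bij_betw ?c {p. p permutes UNIV} {p. p permutes UNIV}"
  proof (rule bij_betw_byWitness[where f' = "\<lambda>q. inv e \<circ> q \<circ> e"])
    have "q permutes UNIV \<Longrightarrow> (inv e \<circ> q \<circ> e) permutes UNIV" for q
      by (metis bij_comp bij_imp_bij_inv e bij_imp_permutes iso_tuple_UNIV_I permutes_bij)
    then show "(\<lambda>q. inv e \<circ> q \<circ> e) ` {p. p permutes UNIV} \<subseteq> {p. p permutes UNIV}" by blast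
    have "p permutes UNIV \<Longrightarrow> (e \<circ> p \<circ> inv e) permutes UNIV" for p
      by (metis bij_comp bij_imp_bij_inv e bij_imp_permutes iso_tuple_UNIV_I permutes_bij)
    then show "?c ` {p. p permutes UNIV} \<subseteq> {p. p permutes UNIV}" by blast
  qed (simp_all add: fun_eq_iff inj sj surj_f_inv_f)
  have "det A = (\<Sum>p | p permutes (UNIV::'m set). of_int (sign (?c p)) * (\<Prod>i\<in>UNIV. A $ i $ ?c p i))"
    unfolding det_def by (rule sum.reindex_bij_betw[OF bij, symmetric])
  also have "\<dots> = (\<Sum>p | p permutes (UNIV::'m set). of_int (sign p) * (\<Prod>i\<in>UNIV. A $ e i $ e (p i)))"
  proof (rule sum.cong[OF refl])
    fix p :: "'m \<Rightarrow> 'm" assume "p \<in> {p. p permutes UNIV}"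
    then have p: "p permutes UNIV" by simp
    have s: "sign (?c p) = sign p"
      using sign_map_permutation[of e UNIV p] inj p fun_cong[OF c, of p] by simp
    have "(\<Prod>i\<in>UNIV. A $ i $ ?c p i) = (\<Prod>i\<in>UNIV. A $ e i $ ?c p (e i))"
      by (rule prod.reindex_bij_betw[OF e', symmetric])
    also have "\<dots> = (\<Prod>i\<in>UNIV. A $ e i $ e (p i))"
      using inj by simp
    finally show "of_int (sign (?c p)) * (\<Prod>i\<in>UNIV. A $ i $ ?c p i) = of_int (sign p) * (\<Prod>i\<in>UNIV. A $ e i $ e (p i))"
      using s by simp
  qed
  also have "\<dots> = det (\<chi> i j. A $ e i $ e j)" by (simp add: det_def)
  finally show ?thesis by simp
qed

definition reindex :: "('m \<Rightarrow> 'n) \<Rightarrow> real ^ 'n \<Rightarrow> real ^ 'm" where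
  "reindex e x = (\<chi> i. x $ e i)"

lemma linear_reindex: "linear (reindex e)"
  by (auto simp: linear_iff reindex_def vec_eq_iff)

lemma bounded_linear_reindex: "bounded_linear (reindex (e :: 'm::finite \<Rightarrow> 'n::finite))"
  by (simp add: linear_reindex linear_conv_bounded_linear[symmetric])

lemma reindex_inv:
  assumes "bij e"
  shows "reindex e (reindex (inv e) y) = y" "reindex (inv e) (reindex e x) = x"
  using assms by (auto simp: reindex_def vec_eq_iff bij_is_inj bij_is_surj surj_f_inv_f)

lemma lborel_reindex:
  fixes e :: "'m::finite \<Rightarrow> 'n::finite"
  assumes e: "bij e"
  shows "distr lborel borel (reindex e) = lborel"
proof (rule lborel_eqI[symmetric])
  fix l u :: "real ^ 'm"
  assume le: "\<And>b. b \<in> Basis \<Longrightarrow> l \<bullet> b \<le> u \<bullet> b"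
  have inj: "inj e" and e': "bij_betw e UNIV UNIV" and sj: "surj e" using e by (auto simp: bij_def)
  let ?T = "reindex (inv e)"
  have pre: "reindex e -` box l u = box (?T l) (?T u)"
  proof -
    have P: "(\<forall>i. P (e i) i) \<longleftrightarrow> (\<forall>j. P j (inv e j))" for P
      using inj sj by (metis inv_f_f surj_f_inv_f)
    show ?thesis
      using P[of "\<lambda>j i. l $ i < x $ j \<and> x $ j < u $ i" for x]
      by (simp add: set_eq_iff mem_box_cart reindex_def)
  qed
  have le': "\<And>i. l $ i \<le> u $ i"
    using le by (force simp: inner_axis Basis_vec_def)
  have [measurable]: "reindex e \<in> borel_measurable borel"
    by (intro borel_measurable_continuous_onI linear_continuous_on bounded_linear_reindex)
  have prd: "(\<Prod>b\<in>Basis. (x::real^'k::finite) \<bullet> b) = (\<Prod>i\<in>UNIV. x $ i)" for x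
    unfolding Basis_vec_def by (subst prod.UNION_disjoint) (auto simp: axis_eq_axis inner_axis)
  have "emeasure (distr lborel borel (reindex e)) (box l u) = emeasure lborel (box (?T l) (?T u))"
    by (simp add: emeasure_distr pre)
  also have "\<dots> = (\<Prod>b\<in>Basis. (?T u - ?T l) \<bullet> b)"
    by (rule emeasure_lborel_box) (auto simp: Basis_vec_def inner_axis reindex_def le')
  also have "(\<Prod>b\<in>Basis. (?T u - ?T l) \<bullet> b) = (\<Prod>j\<in>UNIV. (u - l) $ inv e j)"
    by (simp only: prd) (simp add: reindex_def)
  also have "\<dots> = (\<Prod>i\<in>UNIV. (u - l) $ i)"
    by (rule prod.reindex_bij_betw) (simp add: bij_imp_bij_inv e)
  finally show "emeasure (distr lborel borel (reindex e)) (box l u) = (\<Prod>b\<in>Basis. (u - l) \<bullet> b)"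
    by (simp only: prd)
qed simp

lemma lebesgue_reindex:
  fixes e :: "'m::finite \<Rightarrow> 'n::finite"
  assumes e: "bij e"
  shows "reindex e \<in> lebesgue \<rightarrow>\<^sub>M lebesgue" "distr lebesgue lebesgue (reindex e) = lebesgue"
proof -
  have [measurable]: "reindex e \<in> borel \<rightarrow>\<^sub>M borel"
    by (intro borel_measurable_continuous_onI linear_continuous_on bounded_linear_reindex)
  have d: "distr lebesgue lborel (reindex e) = lborel"
    using lborel_reindex[OF e] by (simp add: distr_completion cong: distr_cong)
  show "reindex e \<in> lebesgue \<rightarrow>\<^sub>M lebesgue"
    by (rule completion.measurable_completion2) (simp_all add: d measurable_completion)
  show "distr lebesgue lebesgue (reindex e) = lebesgue"
    by (subst completion.completion_distr_eq[symmetric]) (simp_all add: d measurable_completion)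
qed

lemma integral_reindex:
  fixes e :: "'m::finite \<Rightarrow> 'n::finite" and F :: "real ^ 'm \<Rightarrow> real"
  assumes e: "bij e"
  shows "integrable lebesgue (\<lambda>x. F (reindex e x)) \<longleftrightarrow> integrable lebesgue F"
    and "(\<integral>x. F (reindex e x) \<partial>lebesgue) = (\<integral>y. F y \<partial>lebesgue)"
proof -
  note e' = bij_imp_bij_inv[OF e]
  have 1: "integrable lebesgue (\<lambda>x. G (reindex h x))" if "bij h" "integrable lebesgue G"
    for h :: "'a::finite \<Rightarrow> 'b::finite" and G :: "real ^ 'a \<Rightarrow> real"
    by (rule integrable_distr[OF lebesgue_reindex(1)[OF that(1)]])
       (simp add: lebesgue_reindex(2) that)
  show iff: "integrable lebesgue (\<lambda>x. F (reindex e x)) \<longleftrightarrow> integrable lebesgue F"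
    using 1[OF e, of F] 1[OF e', of "\<lambda>x. F (reindex e x)"] by (auto simp: reindex_inv[OF e])
  show "(\<integral>x. F (reindex e x) \<partial>lebesgue) = (\<integral>y. F y \<partial>lebesgue)"
  proof (cases "integrable lebesgue F")
    case True
    then show ?thesis
      using integral_distr[OF lebesgue_reindex(1)[OF e], of F] lebesgue_reindex(2)[OF e] by simp
  next
    case False
    then show ?thesis using iff by (simp add: not_integrable_integral_eq)
  qed
qed

text \<open>Transports the library theorem along the coordinate relabelling \<open>?T\<close>; real
  values are wrapped into \<open>real ^ 1\<close>, its value type. The equivalence form matters: in
  the applications integrability is known only on the domain side, and even measurability of the
  integrand on the image comes out of the theorem.\<close>

theorem change_of_variables_real:
  fixes f :: "real ^ 'n \<Rightarrow> real" and g :: "real ^ 'n::finite \<Rightarrow> real ^ 'n"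
  assumes S: "S \<in> sets lebesgue"
    and der_g: "\<And>x. x \<in> S \<Longrightarrow> (g has_derivative g' x) (at x within S)"
    and inj: "inj_on g S"
  shows "(\<lambda>x. \<bar>det (matrix (g' x))\<bar> * f (g x)) absolutely_integrable_on S \<and>
           (LINT x:S|lebesgue. \<bar>det (matrix (g' x))\<bar> * f (g x)) = b
     \<longleftrightarrow> f absolutely_integrable_on (g ` S) \<and> (LINT x:g ` S|lebesgue. f x) = b"
proof -
  obtain e :: "'n idx \<Rightarrow> 'n" where e: "bij e" using ex_bij_idx by blast
  note e' = bij_imp_bij_inv[OF e]
  let ?T = "reindex e" and ?T' = "reindex (inv e)"
  note T = reindex_inv[OF e]
  define h where "h = ?T \<circ> g \<circ> ?T'"
  define h' where "h' y = ?T \<circ> g' (?T' y) \<circ> ?T'" for y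
  define F :: "real ^ 'n idx \<Rightarrow> real ^ 1" where "F y = vec (f (?T' y))" for y
  have blT: "bounded_linear ?T" and blT': "bounded_linear ?T'"
    by (rule bounded_linear_reindex)+
  have TS: "?T ` X = ?T' -` X" for X
    by (auto simp: T image_iff intro!: bexI[of _ "?T' _"])
  have S': "?T ` S \<in> sets lebesgue"
    using measurable_sets[OF lebesgue_reindex(1)[OF e'] S] by (simp add: TS)
  have hS: "h ` (?T ` S) = ?T ` (g ` S)"
    by (auto simp: h_def image_image T)
  have der: "(h has_derivative h' y) (at y within ?T ` S)" if "y \<in> ?T ` S" for y
  proof -
    have y: "?T' y \<in> S" using that by (auto simp: T)
    have "(g has_derivative g' (?T' y)) (at (?T' y) within ?T' ` (?T ` S))"
      using der_g[OF y] by (simp add: image_image T)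
    from diff_chain_within[OF bounded_linear_imp_has_derivative[OF blT'] this]
    have "(g \<circ> ?T' has_derivative g' (?T' y) \<circ> ?T') (at y within ?T ` S)" .
    from diff_chain_within[OF this bounded_linear_imp_has_derivative[OF blT]]
    show ?thesis
      unfolding h_def h'_def comp_assoc .
  qed
  have injh: "inj_on h (?T ` S)"
    using inj by (auto simp: inj_on_def h_def T) (metis T(2))
  have det: "det (matrix (h' y)) = det (matrix (g' (?T' y)))" if "y \<in> ?T ` S" for y
  proof -
    have "matrix (h' y) = (\<chi> i j. matrix (g' (?T' y)) $ e i $ e j)"
    proof -
      have "?T' (axis j 1) = axis (e j) 1" for j :: "'n idx"
        using e by (auto simp: reindex_def axis_def vec_eq_iff bij_is_inj bij_inv_eq_iff)
      then show ?thesis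
        by (simp add: vec_eq_iff matrix_def h'_def) (simp add: reindex_def)
    qed
    then show ?thesis using det_reindex[OF e] by simp
  qed
  have main: "(\<lambda>y. \<bar>det (matrix (h' y))\<bar> *\<^sub>R F (h y)) absolutely_integrable_on ?T ` S \<and>
      integral (?T ` S) (\<lambda>y. \<bar>det (matrix (h' y))\<bar> *\<^sub>R F (h y)) = vec b
     \<longleftrightarrow> F absolutely_integrable_on (h ` (?T ` S)) \<and> integral (h ` (?T ` S)) F = vec b"
    by (rule has_absolute_integral_change_of_variables[OF S' der injh])
  \<comment> \<open>Translates a statement on \<open>?T\<close>
    X\<open>about wrapped values back to\<close>X\<open>. It is used twice, with\<close>X =
    S\<open>for the pulled-back integrand and with\<close>X = g \<open>S\<close> for
    \<open>f\<close> itself.\<close>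
  have tr: "(G absolutely_integrable_on ?T ` X \<and> integral (?T ` X) G = vec b) \<longleftrightarrow>
      k absolutely_integrable_on X \<and> (LINT x:X|lebesgue. k x) = b"
    if G: "\<And>y. y \<in> ?T ` X \<Longrightarrow> G y = vec (k (?T' y))"
    for G :: "real ^ 'n idx \<Rightarrow> real ^ 1" and k and X :: "(real ^ 'n) set"
  proof -
    have "(G absolutely_integrable_on ?T ` X \<and> integral (?T ` X) G = vec b) \<longleftrightarrow>
      (\<lambda>y. G y $ 1) absolutely_integrable_on ?T ` X \<and> (LINT y:?T ` X|lebesgue. G y $ 1) = b"
    proof -
      have 1: "G absolutely_integrable_on ?T ` X \<longleftrightarrow> (\<lambda>y. G y $ 1) absolutely_integrable_on ?T ` X"
        by (rule absolutely_integrable_on_1_iff)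
      moreover have "integral (?T ` X) G = vec b \<longleftrightarrow> (LINT y:?T ` X|lebesgue. G y $ 1) = b"
        if "(\<lambda>y. G y $ 1) absolutely_integrable_on ?T ` X"
      proof -
        have "integral (?T ` X) G = vec (integral (?T ` X) (\<lambda>y. G y $ 1))"
          by (rule integral_on_1_eq)
        moreover have "(vec c :: real ^ 1) = vec b \<longleftrightarrow> c = b" for c
          by (metis vec_component)
        ultimately show ?thesis
          by (simp only: set_lebesgue_integral_eq_integral(2)[OF that])
      qed
      ultimately show ?thesis by blast
    qed
    also have "\<dots> \<longleftrightarrow> (\<lambda>y. k (?T' y)) absolutely_integrable_on ?T ` X \<and> (LINT y:?T ` X|lebesgue. k (?T' y)) = b"
    proof -
      have "(\<lambda>y. indicator (?T ` X) y *\<^sub>R (G y $ 1)) = (\<lambda>y. indicator (?T ` X) y *\<^sub>R k (?T' y))"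
        using G by (intro ext) (simp add: indicator_def)
      then show ?thesis by (simp only: set_integrable_def set_lebesgue_integral_def)
    qed
    also have "\<dots> \<longleftrightarrow> k absolutely_integrable_on X \<and> (LINT x:X|lebesgue. k x) = b"
    proof -
      let ?F = "\<lambda>x. indicator X x *\<^sub>R k x"
      have "(\<lambda>y. indicator (?T ` X) y *\<^sub>R k (?T' y)) = (\<lambda>y. ?F (?T' y))"
        by (auto simp: TS indicator_def)
      then show ?thesis
        unfolding set_integrable_def set_lebesgue_integral_def
        using integral_reindex[OF e', of ?F] by simp
    qed
    finally show ?thesis .
  qed
  have "(\<lambda>x. \<bar>det (matrix (g' x))\<bar> * f (g x)) absolutely_integrable_on S \<and>
           (LINT x:S|lebesgue. \<bar>det (matrix (g' x))\<bar> * f (g x)) = b \<longleftrightarrow>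
     (\<lambda>y. \<bar>det (matrix (h' y))\<bar> *\<^sub>R F (h y)) absolutely_integrable_on ?T ` S \<and>
      integral (?T ` S) (\<lambda>y. \<bar>det (matrix (h' y))\<bar> *\<^sub>R F (h y)) = vec b"
    by (rule tr[symmetric]) (simp add: det F_def h_def T vec_eq_iff)
  also note main
  also have "F absolutely_integrable_on (h ` (?T ` S)) \<and> integral (h ` (?T ` S)) F = vec b \<longleftrightarrow>
     f absolutely_integrable_on (g ` S) \<and> (LINT x:g ` S|lebesgue. f x) = b"
    unfolding hS by (rule tr) (simp add: F_def)
  finally show ?thesis .
qed

section \<open>Support functions and polar bodies\<close>

definition origin_body :: "(real ^ 'n) set \<Rightarrow> bool" where
  "origin_body K \<longleftrightarrow> compact K \<and> convex K \<and> 0 \<in> interior K"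

lemma origin_bodyD:
  assumes "origin_body K"
  shows "compact K" "convex K" "0 \<in> interior K" "0 \<in> K" "K \<noteq> {}" "closed K" "bounded K"
  using assms interior_subset unfolding origin_body_def by (auto intro: compact_imp_closed compact_imp_bounded)

context
  fixes K :: "(real ^ 'n::finite) set"
  assumes K: "origin_body K"
begin

lemma support_bdd: "bdd_above ((\<lambda>x. x \<bullet> u) ` K)"
proof -
  have "compact ((\<lambda>x. x \<bullet> u) ` K)"
    by (intro compact_continuous_image continuous_intros origin_bodyD(1)[OF K])
  then show ?thesis by (rule bounded_imp_bdd_above[OF compact_imp_bounded])
qed

lemma support_ge: "x \<in> K \<Longrightarrow> x \<bullet> u \<le> support_function K u"
  unfolding support_function_def by (intro cSUP_upper support_bdd)

lemma support_le: "(\<And>x. x \<in> K \<Longrightarrow> x \<bullet> u \<le> c) \<Longrightarrow> support_function K u \<le> c"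
  unfolding support_function_def by (intro cSUP_least origin_bodyD(5)[OF K])

lemma support_attained: "\<exists>x\<in>K. x \<bullet> u = support_function K u"
proof -
  have "\<exists>x\<in>K. \<forall>y\<in>K. y \<bullet> u \<le> x \<bullet> u"
    by (intro continuous_attains_sup continuous_intros origin_bodyD[OF K])
  then show ?thesis using support_ge support_le by (meson antisym)
qed

lemma support_max_iff: "x \<in> K \<Longrightarrow> (\<forall>y\<in>K. y \<bullet> u \<le> x \<bullet> u) \<longleftrightarrow> x \<bullet> u = support_function K u"
  using support_ge support_le by (metis antisym)

lemma support_scale: "0 \<le> c \<Longrightarrow> support_function K (c *\<^sub>R u) = c * support_function K u"
proof (rule antisym)
  assume c: "0 \<le> c"
  show "support_function K (c *\<^sub>R u) \<le> c * support_function K u"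
    by (rule support_le) (simp add: c mult_left_mono support_ge)
  obtain x where "x \<in> K" "x \<bullet> u = support_function K u" using support_attained by blast
  then show "c * support_function K u \<le> support_function K (c *\<^sub>R u)"
    using support_ge[of x "c *\<^sub>R u"] by simp
qed

lemma support_add: "support_function K (u + v) \<le> support_function K u + support_function K v"
  by (rule support_le) (simp add: inner_add_right add_mono support_ge)

lemma support_lower: "\<exists>r>0. \<forall>u. r * norm u \<le> support_function K u"
proof -
  obtain r where r: "r > 0" "cball 0 r \<subseteq> K"
    using origin_bodyD(3)[OF K] by (meson mem_interior_cball)
  have "r * norm u \<le> support_function K u" for u
  proof (cases "u = 0")
    case True
    then show ?thesis using support_ge[of 0 u] origin_bodyD(4)[OF K] by simp
  next
    case False
    then have "(r / norm u) *\<^sub>R u \<in> K" using r by auto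
    from support_ge[OF this, of u] False show ?thesis
      by (simp add: power2_norm_eq_inner[symmetric] power2_eq_square)
  qed
  then show ?thesis using r by blast
qed

lemma support_pos: "u \<noteq> 0 \<Longrightarrow> 0 < support_function K u"
  using support_lower by (metis mult_pos_pos not_less order_trans zero_less_norm_iff)

lemma support_zero [simp]: "support_function K 0 = 0"
  using support_scale[of 0 0] by simp

lemma support_nonneg: "0 \<le> support_function K u"
  by (cases "u = 0") (auto simp: support_pos less_imp_le)

lemma support_eq_0_iff: "support_function K u = 0 \<longleftrightarrow> u = 0"
  by (metis less_irrefl support_pos support_zero)

lemma convex_on_support: "convex_on UNIV (support_function K)"
proof (rule convex_onI)
  fix t :: real and x y assume t: "0 < t" "t < 1"
  show "support_function K ((1 - t) *\<^sub>R x + t *\<^sub>R y) \<le> (1 - t) * support_function K x + t * support_function K y"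
    using support_add[of "(1 - t) *\<^sub>R x" "t *\<^sub>R y"] support_scale[of "1 - t" x] support_scale[of t y] t by simp
qed simp

lemma continuous_support: "continuous_on A (support_function K)"
  by (rule continuous_on_subset[OF convex_on_continuous[OF open_UNIV convex_on_support]]) simp

lemma polar_eq: "polar_body K = {y. support_function K y \<le> 1}"
  unfolding polar_body_def using support_ge support_le by (auto intro: order_trans)

lemma origin_body_polar: "origin_body (polar_body K)"
  unfolding origin_body_def
proof (intro conjI)
  obtain r where r: "r > 0" "\<And>u. r * norm u \<le> support_function K u" using support_lower by blast
  have "bounded (polar_body K)"
    unfolding bounded_iff polar_eq
  proof (intro exI ballI)
    fix y assume "y \<in> {y. support_function K y \<le> 1}"
    then have "r * norm y \<le> 1" using r(2)[of y] by simp
    then show "norm y \<le> 1 / r" using r(1) by (simp add: field_simps)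
  qed
  moreover have "closed (polar_body K)"
    unfolding polar_eq by (intro closed_Collect_le continuous_intros continuous_support)
  ultimately show "compact (polar_body K)" by (simp add: compact_eq_bounded_closed)
  show "convex (polar_body K)"
    unfolding polar_eq convex_def
  proof clarsimp
    fix x y and u v :: real
    assume *: "support_function K x \<le> 1" "support_function K y \<le> 1" "0 \<le> u" "0 \<le> v" "u + v = 1"
    have "support_function K (u *\<^sub>R x + v *\<^sub>R y) \<le> u * support_function K x + v * support_function K y"
      using support_add[of "u *\<^sub>R x" "v *\<^sub>R y"] * by (simp add: support_scale)
    also have "\<dots> \<le> u * 1 + v * 1" by (intro add_mono mult_left_mono *)
    finally show "support_function K (u *\<^sub>R x + v *\<^sub>R y) \<le> 1" using * by simp
  qed
  have "open {y. support_function K y < 1}"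
    by (intro open_Collect_less continuous_intros continuous_support)
  then show "0 \<in> interior (polar_body K)"
    by (rule interiorI) (auto simp: polar_eq)
qed

lemma bipolar: "polar_body (polar_body K) = K"
proof (intro equalityI subsetI)
  fix x assume "x \<in> K"
  then show "x \<in> polar_body (polar_body K)" by (simp add: polar_body_def inner_commute)
next
  fix z assume z: "z \<in> polar_body (polar_body K)"
  show "z \<in> K"
  proof (rule ccontr)
    assume "z \<notin> K"
    then obtain a b where ab: "a \<bullet> z < b" "\<forall>x\<in>K. a \<bullet> x > b"
      using separating_hyperplane_closed_point[OF origin_bodyD(2,6)[OF K]] by blast
    have b: "b < 0" using ab(2) origin_bodyD(4)[OF K] by force
    \<comment> \<open>As \<open>b\<close> is negative, dividing by it reverses the separating
      inequalities: they become \<open>x \<bullet> y \<le> 1\<close> on \<open>K\<close> and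
      \<open>y \<bullet> z > 1\<close>.\<close>
    define y where "y = (1 / b) *\<^sub>R a"
    have "y \<in> polar_body K"
      unfolding polar_body_def y_def using ab(2) b
      by (auto simp: inner_commute divide_le_eq less_imp_le)
    then have "y \<bullet> z \<le> 1" using z by (simp add: polar_body_def)
    then show False using ab(1) b by (simp add: y_def divide_le_eq)
  qed
qed

end

text \<open>The support function of the polar body is the gauge of the body.\<close>

lemma body_eq:
  fixes K :: "(real ^ 'n::finite) set"
  assumes "origin_body K" shows "K = {x. support_function (polar_body K) x \<le> 1}"
  using polar_eq[OF origin_body_polar[OF assms]] bipolar[OF assms] by simp

text \<open>The Cauchy--Schwarz inequality for the gauge and its dual: \<open>y\<close> scaled by
  \<open>1 / h\<close> lies in the polar body. It locates boundary points by their normals and later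
  makes the two Gaussian functions a polar pair.\<close>

lemma gauge_inner_le:
  fixes K :: "(real ^ 'n::finite) set"
  assumes K: "origin_body K"
  shows "x \<bullet> y \<le> support_function (polar_body K) x * support_function K y"
proof (cases "y = 0")
  case False
  let ?h = "support_function K y"
  have h: "?h > 0" using support_pos[OF K False] .
  have "y /\<^sub>R ?h \<in> polar_body K"
    unfolding polar_eq[OF K] using h by (simp add: support_scale[OF K])
  from support_ge[OF origin_body_polar[OF K] this, of x] show ?thesis
    using h by (simp add: inner_commute field_simps)
qed (simp add: K)

lemma frontier_eq:
  fixes K :: "(real ^ 'n::finite) set"
  assumes K: "origin_body K"
  shows "frontier K = {x. support_function (polar_body K) x = 1}"
proof -
  let ?p = "support_function (polar_body K)"
  note K' = origin_body_polar[OF K]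
  have "interior K = {x. ?p x < 1}"
  proof
    have "open {x. ?p x < 1}"
      by (intro open_Collect_less continuous_intros continuous_support K')
    then show "{x. ?p x < 1} \<subseteq> interior K"
      by (rule interior_maximal[rotated]) (subst (2) body_eq[OF K], auto)
    show "interior K \<subseteq> {x. ?p x < 1}"
    proof
      fix x assume x: "x \<in> interior K"
      then obtain e where e: "e > 0" "cball x e \<subseteq> K" by (meson mem_interior_cball)
      show "x \<in> {x. ?p x < 1}"
      proof (cases "x = 0")
        case False
        \<comment> \<open>The factor \<open>c\<close> moves \<open>x\<close> outwards by exactly
          \<open>e\<close>, so the stretched point is still in \<open>K\<close> and the gauge of
          \<open>x\<close> is at most \<open>1 / c\<close>.\<close>
        define c where "c = 1 + e / norm x"
        have c: "c > 1" using False e by (simp add: c_def)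
        have "c *\<^sub>R x \<in> cball x e"
          using e False by (simp add: c_def dist_norm algebra_simps)
        then have "?p (c *\<^sub>R x) \<le> 1" using e(2) body_eq[OF K] by blast
        then have "c * ?p x \<le> 1" using c by (simp add: support_scale[OF K'])
        moreover have "?p x < c * ?p x" using c support_pos[OF K' False] by simp
        ultimately show ?thesis by simp
      qed (simp add: K')
    qed
  qed
  then show ?thesis
    unfolding frontier_def closure_closed[OF origin_bodyD(6)[OF K]]
    using body_eq[OF K] by force
qed

lemma scale_to_frontier:
  fixes K :: "(real ^ 'n::finite) set"
  assumes K: "origin_body K" and "x \<noteq> 0"
  shows "x /\<^sub>R support_function (polar_body K) x \<in> frontier K"
  using support_pos[OF origin_body_polar[OF K] assms(2)]
  by (simp add: frontier_eq[OF K] support_scale[OF origin_body_polar[OF K]])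

section \<open>The homogeneous Gauss map\<close>

lemma det_matrix_compose:
  fixes f g :: "real ^ 'n::finite \<Rightarrow> real ^ 'n"
  assumes "linear f" "linear g"
  shows "det (matrix (\<lambda>x. g (f x))) = det (matrix g) * det (matrix f)"
  using matrix_compose[OF assms] by (simp add: o_def det_mul)

lemma det_matrix_scale: "det (matrix (\<lambda>w :: real ^ 'n::finite. a *\<^sub>R w)) = a ^ CARD('n)"
proof -
  have "matrix (\<lambda>w :: real ^ 'n. a *\<^sub>R w) = (\<chi> i j. if i = j then a else 0)"
    by (auto simp: matrix_def vec_eq_iff axis_def)
  then show ?thesis
    by (simp add: det_diagonal)
qed

text \<open>After an orthogonal change of coordinates taking \<open>c\<close> to a multiple of a
  coordinate axis, the map differs from the identity in one column only, so Cramer's rule gives its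
  determinant.\<close>

lemma det_rank_one_update:
  fixes a c :: "real ^ 'n::finite"
  shows "det (matrix (\<lambda>w. w + (w \<bullet> c) *\<^sub>R a)) = 1 + c \<bullet> a"
proof -
  define k :: 'n where "k = undefined"
  have "norm c = norm (axis k (norm c))" by (simp add: norm_eq_sqrt_inner inner_axis_axis)
  then obtain Q :: "real ^ 'n \<Rightarrow> real ^ 'n" where Q: "orthogonal_transformation Q" "Q c = axis k (norm c)"
    using orthogonal_transformation_exists by blast
  define f where "f = (\<lambda>w. w + (w \<bullet> c) *\<^sub>R a)"
  define g where "g = (\<lambda>w. w + (w \<bullet> Q c) *\<^sub>R Q a)"
  have lQ: "linear Q" using Q(1) by (rule orthogonal_transformation_linear)
  have lf: "linear f" by (auto simp: linear_iff f_def algebra_simps inner_add_left)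
  have lg: "linear g" by (auto simp: linear_iff g_def algebra_simps inner_add_left)
  have "g (Q w) = Q (f w)" for w
    using Q(1) unfolding f_def g_def orthogonal_transformation_def
    by (simp add: linear_add linear_scale)
  then have "det (matrix g) * det (matrix Q) = det (matrix Q) * det (matrix f)"
    unfolding det_matrix_compose[OF lQ lg, symmetric] det_matrix_compose[OF lf lQ, symmetric] by simp
  moreover have "det (matrix Q) \<noteq> 0"
    using Q(1) orthogonal_transformation_det by fastforce
  ultimately have "det (matrix f) = det (matrix g)" by simp
  also have "matrix g = (\<chi> i j. if j = k then (mat 1 *v (axis k 1 + norm c *\<^sub>R Q a)) $ i else (mat 1 :: real ^ 'n ^ 'n) $ i $ j)"
    unfolding matrix_vector_mul_lid
    by (auto simp: matrix_def g_def Q(2) vec_eq_iff mat_def axis_def inner_axis inner_vec_def if_distrib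
        cong: if_cong)
  also have "det \<dots> = 1 + norm c * (Q a $ k)"
    by (subst cramer_lemma) simp
  also have "norm c * (Q a $ k) = Q c \<bullet> Q a"
    by (simp add: Q(2) inner_axis')
  also have "\<dots> = c \<bullet> a"
    using Q(1) by (simp add: orthogonal_transformation_def)
  finally show ?thesis by (simp add: f_def)
qed

text \<open>A positively \<open>0\<close>-homogeneous factor has radial derivative zero, so only its value enters the
  Jacobian.\<close>

lemma radial_map_derivative:
  fixes m :: "real ^ 'n::finite \<Rightarrow> real"
  assumes m: "(m has_derivative m') (at x)" and hom: "\<And>t. t > 0 \<Longrightarrow> m (t *\<^sub>R x) = m x"
    and "m x \<noteq> 0"
  shows "((\<lambda>y. m y *\<^sub>R y) has_derivative (\<lambda>w. m x *\<^sub>R w + m' w *\<^sub>R x)) (at x)"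
    and "det (matrix (\<lambda>w. m x *\<^sub>R w + m' w *\<^sub>R x)) = m x ^ CARD('n)"
proof -
  show "((\<lambda>y. m y *\<^sub>R y) has_derivative (\<lambda>w. m x *\<^sub>R w + m' w *\<^sub>R x)) (at x)"
    using has_derivative_scaleR[OF m has_derivative_ident] by simp
  have bl: "bounded_linear m'" using m by (rule has_derivative_bounded_linear)
  have "((\<lambda>t. m (t *\<^sub>R x)) has_derivative (\<lambda>t. m' (t *\<^sub>R x))) (at (1::real))"
    using has_derivative_compose[OF bounded_linear_imp_has_derivative[OF bounded_linear_scaleR_left[of x]], of m m' 1] m
    by simp
  moreover have "((\<lambda>t. m (t *\<^sub>R x)) has_derivative (\<lambda>t. 0)) (at (1::real))"
    by (rule has_derivative_transform_within_open[of "\<lambda>t. m x" _ _ _ "{0<..}"]) (auto simp: hom)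
  ultimately have "(\<lambda>t. m' (t *\<^sub>R x)) = (\<lambda>t::real. 0)" by (rule has_derivative_unique)
  then have z: "m' x = 0" by (metis scaleR_one)
  define e where "e = adjoint m' 1"
  have e: "m' w = w \<bullet> e" for w
    unfolding e_def using adjoint_works[of m' w 1] bl by (simp add: bounded_linear.linear)
  let ?s = "\<lambda>w :: real ^ 'n. m x *\<^sub>R w" and ?r = "\<lambda>w. w + (w \<bullet> e) *\<^sub>R (x /\<^sub>R m x)"
  have eq: "(\<lambda>w. m x *\<^sub>R w + m' w *\<^sub>R x) = (\<lambda>w. ?s (?r w))"
    using assms(3) by (simp add: e algebra_simps mult.assoc[symmetric])
  have "det (matrix (\<lambda>w. ?s (?r w))) = det (matrix ?s) * det (matrix ?r)"
    by (rule det_matrix_compose[of ?r ?s]) (auto simp: linear_iff algebra_simps inner_add_left)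
  also have "\<dots> = m x ^ CARD('n)"
    unfolding det_matrix_scale det_rank_one_update using z e[of x] by (simp add: inner_commute)
  finally show "det (matrix (\<lambda>w. m x *\<^sub>R w + m' w *\<^sub>R x)) = m x ^ CARD('n)"
    unfolding eq .
qed

section \<open>Bodies with a differentiable Gauss map and the derivative of its homogeneous
  extension\<close>

definition smooth_body :: "(real ^ 'n) set \<Rightarrow> bool" where
  "smooth_body K \<longleftrightarrow> origin_body K \<and>
     (\<forall>x\<in>frontier K. (\<exists>!u. norm u = 1 \<and> (\<forall>y\<in>K. y \<bullet> u \<le> x \<bullet> u)) \<and>
        outer_normal K differentiable (at x within frontier K))"

text \<open>The gradient of the gauge at \<open>x\<close> must be normal to the frontier at the
  point \<open>y\<close> on the ray of \<open>x\<close>. The scaling is dictated by Euler's relation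
  for a 1-homogeneous function, which requires its product with \<open>y\<close> to be 1.\<close>

definition gauge_gradient :: "(real ^ 'n) set \<Rightarrow> real ^ 'n \<Rightarrow> real ^ 'n" where
  "gauge_gradient K x = (let y = x /\<^sub>R support_function (polar_body K) x in
     outer_normal K y /\<^sub>R (y \<bullet> outer_normal K y))"

text \<open>The \<open>1\<close>-homogeneous extension of the Gauss map; it maps \<open>K\<close> bijectively to the unit ball.\<close>

definition hom_gauss :: "(real ^ 'n) set \<Rightarrow> real ^ 'n \<Rightarrow> real ^ 'n" where
  "hom_gauss K x = (let p = support_function (polar_body K) x in p *\<^sub>R outer_normal K (x /\<^sub>R p))"

text \<open>The vector \<open>w\<close> is split into \<open>a *\<^sub>R y\<close> along the ray,
  which is sent to a multiple of the normal, and a remainder tangent to the frontier, where the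
  derivative of the Gauss map is meaningful. The split is along \<open>y\<close> and not along the
  normal; the Jacobian records the difference.\<close>

definition hom_gauss' :: "(real ^ 'n) set \<Rightarrow> real ^ 'n \<Rightarrow> real ^ 'n \<Rightarrow> real ^ 'n" where
  "hom_gauss' K x w = (let y = x /\<^sub>R support_function (polar_body K) x; a = w \<bullet> gauge_gradient K x in
     a *\<^sub>R outer_normal K y + frechet_derivative (outer_normal K) (at y within frontier K) (w - a *\<^sub>R y))"

context
  fixes K :: "(real ^ 'n::finite) set"
  assumes sK: "smooth_body K"
begin

lemma smooth_body_origin: "origin_body K"
  using sK by (simp add: smooth_body_def)

lemma smooth_body_origin_polar: "origin_body (polar_body K)"
  by (rule origin_body_polar[OF smooth_body_origin])

private abbreviation (input) p where "p \<equiv> support_function (polar_body K)"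
private abbreviation (input) h where "h \<equiv> support_function K"
private abbreviation (input) \<nu> where "\<nu> \<equiv> outer_normal K"

lemma frontier_mem: "x \<in> frontier K \<Longrightarrow> x \<in> K"
  using frontier_subset_closed[OF origin_bodyD(6)[OF smooth_body_origin]] by blast

lemma outer_normal_props:
  assumes "x \<in> frontier K"
  shows "norm (\<nu> x) = 1" "x \<bullet> \<nu> x = h (\<nu> x)"
proof -
  have "norm (\<nu> x) = 1 \<and> (\<forall>y\<in>K. y \<bullet> \<nu> x \<le> x \<bullet> \<nu> x)"
    unfolding outer_normal_def by (rule theI') (use sK assms smooth_body_def in blast)
  then show "norm (\<nu> x) = 1" "x \<bullet> \<nu> x = h (\<nu> x)"
    using support_max_iff[OF smooth_body_origin frontier_mem[OF assms]] by auto
qed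

lemma outer_normal_eqI:
  assumes "x \<in> frontier K" "norm u = 1" "x \<bullet> u = h u"
  shows "\<nu> x = u"
  unfolding outer_normal_def
  by (rule the1_equality)
     (use sK assms support_max_iff[OF smooth_body_origin frontier_mem[OF assms(1)]] smooth_body_def in blast)+

lemma outer_normal_inner_pos: "x \<in> frontier K \<Longrightarrow> x \<bullet> \<nu> x > 0"
  using outer_normal_props[of x] support_pos[OF smooth_body_origin, of "\<nu> x"] by force

lemma frontier_normal_exists:
  assumes "norm u = 1"
  shows "\<exists>x\<in>frontier K. \<nu> x = u"
proof -
  obtain x where x: "x \<in> K" "x \<bullet> u = h u" using support_attained[OF smooth_body_origin] by blast
  have "h u > 0" using assms support_pos[OF smooth_body_origin, of u] by force
  moreover have "h u \<le> p x * h u" using gauge_inner_le[OF smooth_body_origin, of x u] x by simp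
  ultimately have "p x \<ge> 1" by simp
  moreover have "p x \<le> 1" using x(1) body_eq[OF smooth_body_origin] by blast
  ultimately have "x \<in> frontier K" by (simp add: frontier_eq[OF smooth_body_origin])
  then show ?thesis using outer_normal_eqI x assms by blast
qed

lemma continuous_outer_normal: "continuous_on (frontier K) \<nu>"
  using sK unfolding smooth_body_def continuous_on_eq_continuous_within
  by (auto intro: differentiable_imp_continuous_within)

lemma gauge_pos: "x \<noteq> 0 \<Longrightarrow> p x > 0"
  by (rule support_pos[OF smooth_body_origin_polar])

lemma continuous_gauge_gradient: "continuous_on (- {0}) (gauge_gradient K)"
proof -
  have 1: "continuous_on (- {0}) (\<lambda>x. x /\<^sub>R p x)"
    by (intro continuous_intros continuous_support smooth_body_origin_polar) (auto simp: support_eq_0_iff[OF smooth_body_origin_polar])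
  have 2: "continuous_on (- {0}) (\<lambda>x. \<nu> (x /\<^sub>R p x))"
    by (rule continuous_on_compose2[OF continuous_outer_normal 1]) (use scale_to_frontier[OF smooth_body_origin] in blast)
  show ?thesis
    unfolding gauge_gradient_def Let_def
    by (intro continuous_intros 1 2)
       (metis ComplD insertI1 less_irrefl outer_normal_inner_pos scale_to_frontier[OF smooth_body_origin])
qed

lemma gauge_gradient_inner: "x \<noteq> 0 \<Longrightarrow> x \<bullet> gauge_gradient K x = p x"
  using outer_normal_inner_pos[OF scale_to_frontier[OF smooth_body_origin, of x]] gauge_pos[of x]
  by (simp add: gauge_gradient_def Let_def field_simps)

lemma gauge_gradient_le:
  assumes "x \<noteq> 0"
  shows "y \<bullet> gauge_gradient K x \<le> p y"
proof -
  let ?x = "x /\<^sub>R p x"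
  have f: "?x \<in> frontier K" by (rule scale_to_frontier[OF smooth_body_origin assms])
  have "y \<bullet> \<nu> ?x \<le> p y * (?x \<bullet> \<nu> ?x)"
    using gauge_inner_le[OF smooth_body_origin, of y "\<nu> ?x"] outer_normal_props(2)[OF f] by simp
  then have "y \<bullet> \<nu> ?x / (?x \<bullet> \<nu> ?x) \<le> p y"
    using outer_normal_inner_pos[OF f] by (simp only: pos_divide_le_eq)
  then show ?thesis
    by (simp only: gauge_gradient_def Let_def inner_scaleR_right) (simp add: divide_inverse mult.commute)
qed

text \<open>By convexity, the subgradient inequalities at \<open>x\<close> and at \<open>y\<close>
  enclose the remainder between 0 and \<open>(y - x) \<bullet> (?c y - ?c x)\<close>, so continuity
  of the gradient field gives differentiability.\<close>

lemma gauge_has_derivative: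
  assumes x: "x \<noteq> 0"
  shows "(p has_derivative (\<lambda>w. w \<bullet> gauge_gradient K x)) (at x)"
proof (rule has_derivativeI_sandwich[where e = "norm x" and H = "\<lambda>y. norm (gauge_gradient K y - gauge_gradient K x)"])
  let ?c = "gauge_gradient K"
  show "norm x > 0" using x by simp
  show "bounded_linear (\<lambda>w. w \<bullet> ?c x)" by (rule bounded_linear_inner_left)
  have "isCont ?c x"
    using continuous_gauge_gradient x continuous_on_eq_continuous_at[of "- {0}"] by auto
  then have "((\<lambda>y. ?c y - ?c x) \<longlongrightarrow> ?c x - ?c x) (at x)"
    unfolding isCont_def by (intro tendsto_intros)
  then show "((\<lambda>y. norm (?c y - ?c x)) \<longlongrightarrow> 0) (at x)" by (intro tendsto_norm_zero) simp
  fix y assume y: "y \<noteq> x" "dist y x < norm x"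
  then have y0: "y \<noteq> 0" by auto
  have 1: "0 \<le> p y - p x - (y - x) \<bullet> ?c x"
    using gauge_gradient_le[OF x, of y] gauge_gradient_inner[OF x] by (simp add: inner_diff_left)
  have "p y - p x - (y - x) \<bullet> ?c x \<le> (y - x) \<bullet> (?c y - ?c x)"
    using gauge_gradient_le[OF y0, of x] gauge_gradient_inner[OF y0]
    by (simp add: inner_diff_left inner_diff_right)
  also have "\<dots> \<le> norm (y - x) * norm (?c y - ?c x)" by (rule norm_cauchy_schwarz)
  finally show "norm (p y - p x - (y - x) \<bullet> ?c x) / norm (y - x) \<le> norm (?c y - ?c x)"
    using 1 y by (simp add: divide_le_eq mult.commute)
qed

lemma gauge_scale: "0 \<le> c \<Longrightarrow> p (c *\<^sub>R x) = c * p x"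
  by (rule support_scale[OF smooth_body_origin_polar])

lemma outer_normal_has_derivative:
  assumes "x \<in> frontier K"
  shows "(\<nu> has_derivative frechet_derivative \<nu> (at x within frontier K)) (at x within frontier K)"
  using sK assms by (simp add: smooth_body_def frechet_derivative_works)

lemma hom_gauss_has_derivative:
  assumes x: "x \<noteq> 0"
  shows "(hom_gauss K has_derivative hom_gauss' K x) (at x)"
proof -
  let ?y = "\<lambda>x. x /\<^sub>R p x" and ?c = "gauge_gradient K x"
  define D where "D = frechet_derivative \<nu> (at (?y x) within frontier K)"
  have f: "?y x \<in> frontier K" by (rule scale_to_frontier[OF smooth_body_origin x])
  have px: "p x > 0" by (rule gauge_pos[OF x])
  have D: "(\<nu> has_derivative D) (at (?y x) within frontier K)"
    unfolding D_def by (rule outer_normal_has_derivative[OF f])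
  then have lD: "linear D" by (simp add: has_derivative_bounded_linear bounded_linear.linear)
  have dy: "(?y has_derivative (\<lambda>w. (w - (w \<bullet> ?c) *\<^sub>R ?y x) /\<^sub>R p x)) (at x within - {0})"
  proof (rule has_derivative_at_withinI)
    have "((\<lambda>x. inverse (p x)) has_derivative (\<lambda>w. - (inverse (p x) * (w \<bullet> ?c) * inverse (p x)))) (at x)"
      by (rule Deriv.has_derivative_inverse[OF _ gauge_has_derivative[OF x]]) (use px in simp)
    from has_derivative_scaleR[OF this has_derivative_ident]
    show "(?y has_derivative (\<lambda>w. (w - (w \<bullet> ?c) *\<^sub>R ?y x) /\<^sub>R p x)) (at x)"
      by (rule has_derivative_eq_rhs) (auto simp: fun_eq_iff algebra_simps)
  qed
  \<comment> \<open>The derivative \<open>D\<close> exists only relative to the frontier, so the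
    chain rule needs an inner map with values there. Hence the derivative within
    \<open>- {0}\<close>, which is the full derivative because that set is open.\<close>
  have "?y ` (- {0}) \<subseteq> frontier K" using scale_to_frontier[OF smooth_body_origin] by auto
  from has_derivative_in_compose[OF dy has_derivative_subset[OF D this]]
  have "((\<lambda>x. \<nu> (?y x)) has_derivative (\<lambda>w. D ((w - (w \<bullet> ?c) *\<^sub>R ?y x) /\<^sub>R p x))) (at x within - {0})" .
  then have "((\<lambda>x. \<nu> (?y x)) has_derivative (\<lambda>w. D ((w - (w \<bullet> ?c) *\<^sub>R ?y x) /\<^sub>R p x))) (at x)"
    using at_within_open[of x "- {0}"] x by (simp only: open_Compl closed_singleton Compl_iff singleton_iff simp_thms)
  from has_derivative_scaleR[OF gauge_has_derivative[OF x] this]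
  show ?thesis
    using px by (simp add: hom_gauss_def[abs_def] hom_gauss'_def[abs_def] Let_def D_def[symmetric]
      linear_scale[OF lD] add.commute)
qed

text \<open>The derivative factors as \<open>W\<close> after \<open>B\<close>. Here \<open>W\<close>
  is the endomorphism whose determinant defines the Gauss curvature, and \<open>B\<close> fixes
  tangent vectors and sends \<open>y\<close> to the normal. Thus \<open>B\<close> is a rank-one
  update of the identity, with determinant the reciprocal of \<open>y \<bullet> ?n\<close>.\<close>

lemma det_hom_gauss':
  assumes x: "x \<noteq> 0"
  shows "det (matrix (hom_gauss' K x)) =
    gauss_curvature K (x /\<^sub>R p x) / ((x /\<^sub>R p x) \<bullet> \<nu> (x /\<^sub>R p x))"
proof -
  define y where "y = x /\<^sub>R p x"
  have f: "y \<in> frontier K" unfolding y_def by (rule scale_to_frontier[OF smooth_body_origin x])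
  define D where "D = frechet_derivative \<nu> (at y within frontier K)"
  have lD: "linear D"
    using outer_normal_has_derivative[OF f] unfolding D_def
    by (simp add: has_derivative_bounded_linear bounded_linear.linear)
  let ?n = "\<nu> y" and ?c = "gauge_gradient K x"
  have c: "?c = ?n /\<^sub>R (y \<bullet> ?n)" by (simp add: gauge_gradient_def Let_def y_def)
  have pos: "y \<bullet> ?n > 0" by (rule outer_normal_inner_pos[OF f])
  have nn: "?n \<bullet> ?n = 1" using outer_normal_props(1)[OF f] by (simp add: norm_eq_1)
  define W where "W = (\<lambda>v. D (v - (v \<bullet> ?n) *\<^sub>R ?n) + (v \<bullet> ?n) *\<^sub>R ?n)"
  define B where "B = (\<lambda>w. w + (w \<bullet> ?c) *\<^sub>R (?n - y))"
  have lW: "linear W"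
    unfolding W_def using lD
    by (auto simp: linear_iff algebra_simps inner_add_left linear_diff[OF lD])
  have lB: "linear B" unfolding B_def by (auto simp: linear_iff algebra_simps inner_add_left)
  have "hom_gauss' K x w = W (B w)" for w
  proof -
    have n: "B w \<bullet> ?n = w \<bullet> ?c"
      unfolding B_def using pos nn by (simp add: c inner_add_left inner_diff_left field_simps)
    have "B w - (w \<bullet> ?c) *\<^sub>R ?n = w - (w \<bullet> ?c) *\<^sub>R y" by (simp add: B_def algebra_simps)
    then show ?thesis
      by (simp add: W_def n hom_gauss'_def Let_def y_def[symmetric] D_def[symmetric])
  qed
  then have "hom_gauss' K x = (\<lambda>w. W (B w))" by blast
  then have "det (matrix (hom_gauss' K x)) = det (matrix W) * det (matrix B)"
    using det_matrix_compose[OF lB lW] by simp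
  also have "det (matrix W) = gauss_curvature K y"
    by (simp add: gauss_curvature_def Let_def W_def D_def)
  also have "det (matrix B) = 1 / (y \<bullet> ?n)"
    unfolding B_def det_rank_one_update using pos nn
    by (simp add: c inner_diff_right inner_commute field_simps)
  finally show ?thesis by (simp add: y_def)
qed

text \<open>The first map carries \<open>K\<close> radially onto the unit ball and the second
  carries the ball back; both are a 0-homogeneous factor times the identity.\<close>

lemma radial_gauge_derivative:
  assumes x: "x \<noteq> 0"
  shows "\<exists>\<psi>'. ((\<lambda>x. (p x / norm x) *\<^sub>R x) has_derivative \<psi>') (at x) \<and> det (matrix \<psi>') = (p x / norm x) ^ CARD('n)"
    and "\<exists>\<psi>'. ((\<lambda>x. (norm x / p x) *\<^sub>R x) has_derivative \<psi>') (at x) \<and> det (matrix \<psi>') = (norm x / p x) ^ CARD('n)"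
proof -
  have n: "norm differentiable (at x)" using x by (simp add: differentiable_norm_at)
  have p: "p differentiable (at x)" using gauge_has_derivative[OF x] by (auto simp: differentiable_def)
  have "(\<lambda>x. p x / norm x) differentiable (at x)" "(\<lambda>x. norm x / p x) differentiable (at x)"
    by (intro differentiable_divide n p, use x gauge_pos[OF x] in simp)+
  then obtain a b where a: "((\<lambda>x. p x / norm x) has_derivative a) (at x)"
    and b: "((\<lambda>x. norm x / p x) has_derivative b) (at x)"
    by (auto simp: differentiable_def)
  show "\<exists>\<psi>'. ((\<lambda>x. (p x / norm x) *\<^sub>R x) has_derivative \<psi>') (at x) \<and> det (matrix \<psi>') = (p x / norm x) ^ CARD('n)"
    using radial_map_derivative[OF a] x gauge_pos[OF x] by (fastforce simp: gauge_scale)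
  show "\<exists>\<psi>'. ((\<lambda>x. (norm x / p x) *\<^sub>R x) has_derivative \<psi>') (at x) \<and> det (matrix \<psi>') = (norm x / p x) ^ CARD('n)"
    using radial_map_derivative[OF b] x gauge_pos[OF x] by (fastforce simp: gauge_scale)
qed

end

text \<open>Two frontier points with the same normal span a segment inside the supporting
  hyperplane, hence inside the frontier, on which the Gauss map is constant. Its derivative then
  kills the tangent direction \<open>d\<close>, and the curvature vanishes.\<close>

lemma outer_normal_inj:
  fixes K :: "(real ^ 'n::finite) set"
  assumes sK: "smooth_body K" and nz: "\<And>x. x \<in> frontier K \<Longrightarrow> gauss_curvature K x \<noteq> 0"
  shows "inj_on (outer_normal K) (frontier K)"
proof (rule inj_onI, rule ccontr)
  let ?h = "support_function K" and ?p = "support_function (polar_body K)"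
  note K = smooth_body_origin[OF sK]
  fix x1 x2 assume x: "x1 \<in> frontier K" "x2 \<in> frontier K"
    and eq: "outer_normal K x1 = outer_normal K x2" and ne: "x1 \<noteq> x2"
  define u where "u = outer_normal K x1"
  define d where "d = x2 - x1"
  have u: "norm u = 1" "x1 \<bullet> u = ?h u" "x2 \<bullet> u = ?h u"
    using outer_normal_props[OF sK x(1)] outer_normal_props[OF sK x(2)] eq by (auto simp: u_def)
  have hu: "?h u > 0" using support_pos[OF K, of u] u(1) by force
  have seg: "x1 + t *\<^sub>R d \<in> frontier K" "outer_normal K (x1 + t *\<^sub>R d) = u" if t: "t \<in> {0..1}" for t
  proof -
    have eqt: "x1 + t *\<^sub>R d = (1 - t) *\<^sub>R x1 + t *\<^sub>R x2" by (simp add: d_def algebra_simps)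
    have "x1 + t *\<^sub>R d \<in> K"
      unfolding eqt using t frontier_mem[OF sK] x by (intro convexD[OF origin_bodyD(2)[OF K]]) auto
    then have le: "?p (x1 + t *\<^sub>R d) \<le> 1" using body_eq[OF K] by blast
    have hu': "(x1 + t *\<^sub>R d) \<bullet> u = ?h u" using u by (simp add: d_def inner_add_left inner_diff_left)
    then have "?h u \<le> ?p (x1 + t *\<^sub>R d) * ?h u" using gauge_inner_le[OF K, of "x1 + t *\<^sub>R d" u] by simp
    then show f: "x1 + t *\<^sub>R d \<in> frontier K" using le hu by (simp add: frontier_eq[OF K])
    show "outer_normal K (x1 + t *\<^sub>R d) = u" by (rule outer_normal_eqI[OF sK f u(1) hu'])
  qed
  define D where "D = frechet_derivative (outer_normal K) (at x1 within frontier K)"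
  have D: "(outer_normal K has_derivative D) (at x1 within frontier K)"
    unfolding D_def by (rule outer_normal_has_derivative[OF sK x(1)])
  then have lD: "linear D" by (simp add: has_derivative_bounded_linear bounded_linear.linear)
  \<comment> \<open>The point \<open>x1\<close> is an end of the segment, so only a one-sided
    derivative at 0 is available.\<close>
  have "((\<lambda>t. x1 + t *\<^sub>R d) has_derivative (\<lambda>t. t *\<^sub>R d)) (at 0 within cbox 0 (1::real))"
    by (auto intro!: derivative_eq_intros)
  moreover have "(outer_normal K has_derivative D) (at (x1 + 0 *\<^sub>R d) within (\<lambda>t. x1 + t *\<^sub>R d) ` cbox 0 (1::real))"
    by (rule has_derivative_subset[of _ _ _ "frontier K"]) (use D seg(1) in auto)
  ultimately have "((\<lambda>t. outer_normal K (x1 + t *\<^sub>R d)) has_derivative (\<lambda>t. D (t *\<^sub>R d))) (at 0 within cbox 0 (1::real))"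
    by (rule has_derivative_in_compose)
  moreover have "((\<lambda>t. outer_normal K (x1 + t *\<^sub>R d)) has_derivative (\<lambda>t. 0)) (at 0 within cbox 0 (1::real))"
    by (rule has_derivative_transform[of _ _ _ "\<lambda>t. u"]) (auto simp: seg)
  ultimately have "(\<lambda>t. D (t *\<^sub>R d)) = (\<lambda>t::real. 0)"
    by (rule frechet_derivative_unique_within_closed_interval[rotated 2]) auto
  then have Dd: "D d = 0" by (metis scaleR_one)
  have du: "d \<bullet> u = 0" using u by (simp add: d_def inner_diff_left)
  define W where "W = (\<lambda>v. D (v - (v \<bullet> u) *\<^sub>R u) + (v \<bullet> u) *\<^sub>R u)"
  have lW: "linear W"
    unfolding W_def using lD by (auto simp: linear_iff algebra_simps inner_add_left linear_diff[OF lD])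
  have "W d = 0" using Dd du by (simp add: W_def)
  then have "\<not> inj W" using ne linear_injective_0[OF lW] by (auto simp: d_def)
  then have "det (matrix W) = 0" using det_nz_iff_inj[OF lW] by blast
  then have "gauss_curvature K x1 = 0"
    by (simp add: gauss_curvature_def Let_def W_def D_def u_def)
  then show False using nz[OF x(1)] by simp
qed

text \<open>Stands in for \<open>C2_plus\<close> from here on. It carries what the change of
  variables uses and passes to the polar body (\<open>regular_body_polar\<close>) without a C2
  equation for the polar boundary.\<close>

definition regular_body :: "(real ^ 'n) set \<Rightarrow> bool" where
  "regular_body K \<longleftrightarrow> smooth_body K \<and> (\<forall>x\<in>frontier K. gauss_curvature K x > 0)"

definition sphere_proj :: "real ^ 'n \<Rightarrow> real ^ 'n" where
  "sphere_proj y = y /\<^sub>R norm y"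

context
  fixes K :: "(real ^ 'n::finite) set"
  assumes rK: "regular_body K"
begin

lemma regular_body_smooth: "smooth_body K"
  using rK by (simp add: regular_body_def)

lemmas regular_body_origin = smooth_body_origin[OF regular_body_smooth]
lemmas regular_body_origin_polar = smooth_body_origin_polar[OF regular_body_smooth]

lemma normal_inj: "inj_on (outer_normal K) (frontier K)"
  using rK by (intro outer_normal_inj) (force simp: regular_body_def)+

text \<open>Injectivity of the Gauss map gives the definite description in
  \<open>curvature_function\<close> its intended value.\<close>

lemma curvature_function_normal:
  assumes "x \<in> frontier K"
  shows "curvature_function K (outer_normal K x) = 1 / gauss_curvature K x"
proof -
  have "(THE z. z \<in> frontier K \<and> outer_normal K z = outer_normal K x) = x"
    using assms normal_inj by (intro the_equality) (auto dest: inj_onD)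
  then show ?thesis by (simp add: curvature_function_def)
qed

lemma hom_gauss_proj:
  assumes "x \<noteq> 0"
  shows "norm (hom_gauss K x) = support_function (polar_body K) x"
    "sphere_proj (hom_gauss K x) = outer_normal K (x /\<^sub>R support_function (polar_body K) x)"
    "hom_gauss K x \<noteq> 0"
proof -
  have p: "support_function (polar_body K) x > 0" by (rule gauge_pos[OF regular_body_smooth assms])
  have n: "norm (outer_normal K (x /\<^sub>R support_function (polar_body K) x)) = 1"
    by (rule outer_normal_props(1)[OF regular_body_smooth scale_to_frontier[OF regular_body_origin assms]])
  show 1: "norm (hom_gauss K x) = support_function (polar_body K) x"
    using p n by (simp add: hom_gauss_def Let_def)
  show "sphere_proj (hom_gauss K x) = outer_normal K (x /\<^sub>R support_function (polar_body K) x)"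
    unfolding sphere_proj_def 1 using p by (simp add: hom_gauss_def Let_def)
  show "hom_gauss K x \<noteq> 0" using 1 p by force
qed

lemma hom_gauss_inj: "inj_on (hom_gauss K) (- {0})"
proof (rule inj_onI)
  let ?p = "support_function (polar_body K)"
  fix x y assume xy: "x \<in> - {0}" "y \<in> - {0}" and eq: "hom_gauss K x = hom_gauss K y"
  have p: "?p x = ?p y" using hom_gauss_proj(1)[of x] hom_gauss_proj(1)[of y] xy eq by simp
  have "outer_normal K (x /\<^sub>R ?p x) = outer_normal K (y /\<^sub>R ?p y)"
    using hom_gauss_proj(2)[of x] hom_gauss_proj(2)[of y] xy eq by simp
  then have "x /\<^sub>R ?p x = y /\<^sub>R ?p y"
    using inj_onD[OF normal_inj _ scale_to_frontier[OF regular_body_origin] scale_to_frontier[OF regular_body_origin]] xy by blast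
  then show "x = y" using p gauge_pos[OF regular_body_smooth, of y] xy by simp
qed

lemma hom_gauss_surj:
  assumes "y \<noteq> 0"
  shows "\<exists>x. x \<noteq> 0 \<and> hom_gauss K x = y"
proof -
  have "norm (y /\<^sub>R norm y) = 1" using assms by simp
  then obtain z where z: "z \<in> frontier K" "outer_normal K z = y /\<^sub>R norm y"
    using frontier_normal_exists[OF regular_body_smooth] by blast
  have pz: "support_function (polar_body K) z = 1" using z frontier_eq[OF regular_body_origin] by blast
  have p: "support_function (polar_body K) (norm y *\<^sub>R z) = norm y"
    by (simp add: gauge_scale[OF regular_body_smooth] pz)
  have "z \<noteq> 0" using pz support_zero[OF regular_body_origin_polar] by auto
  then show ?thesis
    using assms z by (intro exI[of _ "norm y *\<^sub>R z"]) (simp add: hom_gauss_def p)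
qed

lemma hom_gauss_image: "hom_gauss K ` (K - {0}) = cball 0 1 - {0}"
proof -
  have mem: "x \<in> K \<longleftrightarrow> norm (hom_gauss K x) \<le> 1" if "x \<noteq> 0" for x
    unfolding hom_gauss_proj(1)[OF that] by (subst body_eq[OF regular_body_origin]) simp
  show ?thesis
  proof (intro equalityI subsetI)
    fix y assume "y \<in> hom_gauss K ` (K - {0})"
    then obtain x where "x \<in> K" "x \<noteq> 0" "y = hom_gauss K x" by blast
    then show "y \<in> cball 0 1 - {0}" using mem[of x] hom_gauss_proj(3)[of x] by simp
  next
    fix y :: "real ^ 'n" assume y: "y \<in> cball 0 1 - {0}"
    then obtain x where x: "x \<noteq> 0" "hom_gauss K x = y" using hom_gauss_surj[of y] by blast
    then have "x \<in> K" using mem[of x] y by simp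
    then show "y \<in> hom_gauss K ` (K - {0})" using x by blast
  qed
qed

section \<open>Volumes as integrals over the punctured unit ball\<close>

lemma measurable_body_minus: "K - {0} \<in> sets lebesgue" "K - {0} \<in> lmeasurable"
    "measure lebesgue (K - {0}) = measure lebesgue K"
proof -
  have m: "K \<in> lmeasurable" using origin_bodyD(1)[OF regular_body_origin] by (rule lmeasurable_compact)
  show 2: "K - {0} \<in> lmeasurable" using m by (rule fmeasurable_Diff) simp
  then show "K - {0} \<in> sets lebesgue" by (rule fmeasurableD)
  show "measure lebesgue (K - {0}) = measure lebesgue K"
    by (rule measure_Diff_null_set[OF fmeasurableD[OF m]]) simp
qed

lemma integral_const_body:
  "(\<lambda>x. 1 :: real) absolutely_integrable_on (K - {0}) \<and> (LINT x:K - {0}|lebesgue. 1) = measure lebesgue K"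
  using measurable_body_minus
  using integrable_real_indicator[of "K - {0}" lebesgue]
  by (auto simp: set_integrable_def set_lebesgue_integral_def fmeasurable_def less_top[symmetric])

text \<open>At \<open>hom_gauss K x\<close> the integrand is
  \<open>(z \<bullet> outer_normal K z) / gauss_curvature K z\<close> with \<open>z\<close> the
  frontier point on the ray of \<open>x\<close>. This is the reciprocal of the Jacobian there, so
  the pulled-back integrand on \<open>K\<close> is 1. It is the cone form of the formula that
  integrates \<open>h * f\<close> over the sphere to \<open>n\<close> times the volume.\<close>

lemma integral_support_curvature:
  fixes u :: "real ^ 'n \<Rightarrow> real ^ 'n"
  defines "u \<equiv> sphere_proj"
  shows "(\<lambda>y. support_function K (u y) * curvature_function K (u y)) absolutely_integrable_on (cball 0 1 - {0})"
    "(LINT y:cball 0 1 - {0}|lebesgue. support_function K (u y) * curvature_function K (u y)) = measure lebesgue K"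
proof -
  let ?F = "\<lambda>y. support_function K (u y) * curvature_function K (u y)"
  have one: "\<bar>det (matrix (hom_gauss' K x))\<bar> * ?F (hom_gauss K x) = 1" if x: "x \<in> K - {0}" for x
  proof -
    let ?z = "x /\<^sub>R support_function (polar_body K) x"
    have z: "?z \<in> frontier K" using x by (intro scale_to_frontier[OF regular_body_origin]) simp
    have k: "gauss_curvature K ?z > 0" using z rK by (simp add: regular_body_def)
    have i: "?z \<bullet> outer_normal K ?z > 0" by (rule outer_normal_inner_pos[OF regular_body_smooth z])
    have "?F (hom_gauss K x) = (?z \<bullet> outer_normal K ?z) * (1 / gauss_curvature K ?z)"
      using x by (simp only: u_def hom_gauss_proj(2) curvature_function_normal[OF z] outer_normal_props(2)[OF regular_body_smooth z] Diff_iff singleton_iff simp_thms)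
    moreover have "det (matrix (hom_gauss' K x)) = gauss_curvature K ?z / (?z \<bullet> outer_normal K ?z)"
      using x by (intro det_hom_gauss'[OF regular_body_smooth]) simp
    moreover have "\<bar>a / b\<bar> * (b * (1 / a)) = 1" if "a > 0" "b > 0" for a b :: real
      using that by simp
    ultimately show ?thesis using k i by (simp only:)
  qed
  have "(\<lambda>x. \<bar>det (matrix (hom_gauss' K x))\<bar> * ?F (hom_gauss K x)) absolutely_integrable_on (K - {0}) \<and>
     (LINT x:K - {0}|lebesgue. \<bar>det (matrix (hom_gauss' K x))\<bar> * ?F (hom_gauss K x)) = measure lebesgue K"
  proof -
    have "(\<lambda>x. indicator (K - {0}) x *\<^sub>R (\<bar>det (matrix (hom_gauss' K x))\<bar> * ?F (hom_gauss K x))) = (\<lambda>x. indicator (K - {0}) x *\<^sub>R 1)"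
      using one by (intro ext) (auto simp: indicator_def)
    then show ?thesis
      using integral_const_body by (simp only: set_integrable_def set_lebesgue_integral_def)
  qed
  then have "?F absolutely_integrable_on (hom_gauss K ` (K - {0})) \<and>
     (LINT x:hom_gauss K ` (K - {0})|lebesgue. ?F x) = measure lebesgue K"
    by (rule change_of_variables_real[OF measurable_body_minus(1), THEN iffD1, rotated 2])
       (auto intro!: has_derivative_at_withinI hom_gauss_has_derivative[OF regular_body_smooth] inj_on_subset[OF hom_gauss_inj])
  then show "?F absolutely_integrable_on (cball 0 1 - {0})" "(LINT y:cball 0 1 - {0}|lebesgue. ?F y) = measure lebesgue K"
    by (simp_all only: hom_gauss_image)
qed

text \<open>The same argument for the radial map \<open>\<psi>\<close>, whose Jacobian is the
  \<open>n\<close>-th power of the gauge at the direction of \<open>x\<close>. Applied to the polar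
  body, whose gauge is the support function of \<open>K\<close>, it gives the volume of the polar
  body.\<close>

lemma integral_gauge_power:
  fixes u :: "real ^ 'n \<Rightarrow> real ^ 'n"
  defines "u \<equiv> sphere_proj"
  shows "(\<lambda>y. 1 / support_function (polar_body K) (u y) ^ CARD('n)) absolutely_integrable_on (cball 0 1 - {0})"
    "(LINT y:cball 0 1 - {0}|lebesgue. 1 / support_function (polar_body K) (u y) ^ CARD('n)) = measure lebesgue K"
proof -
  let ?p = "support_function (polar_body K)"
  let ?F = "\<lambda>y. 1 / ?p (u y) ^ CARD('n)"
  define m where "m x = ?p x / norm x" for x
  define \<psi> where "\<psi> x = m x *\<^sub>R x" for x
  have mpos: "m x > 0" if "x \<noteq> 0" for x using gauge_pos[OF regular_body_smooth that] that by (simp add: m_def)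
  have hom: "m (t *\<^sub>R x) = m x" if "t > 0" for t x
    using that by (simp add: m_def gauge_scale[OF regular_body_smooth])
  have pu: "?p (u x) = m x" if "x \<noteq> 0" for x
    using that by (simp add: u_def sphere_proj_def m_def gauge_scale[OF regular_body_smooth] divide_inverse mult.commute)
  have np: "norm (\<psi> x) = ?p x" for x
    using mpos[of x] by (cases "x = 0") (simp_all add: \<psi>_def m_def support_zero[OF regular_body_origin_polar] gauge_pos[OF regular_body_smooth] less_imp_le)
  have "\<forall>x. \<exists>A. x \<noteq> 0 \<longrightarrow> (\<psi> has_derivative A) (at x) \<and> det (matrix A) = m x ^ CARD('n)"
    using radial_gauge_derivative(1)[OF regular_body_smooth] unfolding \<psi>_def[abs_def] m_def by blast
  then obtain \<psi>' where "\<forall>x. x \<noteq> 0 \<longrightarrow> (\<psi> has_derivative \<psi>' x) (at x) \<and> det (matrix (\<psi>' x)) = m x ^ CARD('n)"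
    by (rule choice[THEN exE])
  then have \<psi>': "\<And>x. x \<noteq> 0 \<Longrightarrow> (\<psi> has_derivative \<psi>' x) (at x)"
      "\<And>x. x \<noteq> 0 \<Longrightarrow> det (matrix (\<psi>' x)) = m x ^ CARD('n)"
    by auto
  have inj: "inj_on \<psi> (K - {0})"
  proof (rule inj_onI)
    fix x y assume xy: "x \<in> K - {0}" "y \<in> K - {0}" and eq: "\<psi> x = \<psi> y"
    have "m (\<psi> x) = m (\<psi> y)" using eq by simp
    then have "m x = m y" using xy mpos by (simp add: \<psi>_def hom)
    then show "x = y" using eq mpos[of y] xy by (simp add: \<psi>_def)
  qed
  have img: "\<psi> ` (K - {0}) = cball 0 1 - {0}"
  proof (intro equalityI subsetI)
    fix y assume "y \<in> \<psi> ` (K - {0})"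
    then obtain x where x: "x \<in> K" "x \<noteq> 0" "y = \<psi> x" by blast
    have "?p x \<le> 1" using x(1) body_eq[OF regular_body_origin] by blast
    then show "y \<in> cball 0 1 - {0}" using x np[of x] gauge_pos[OF regular_body_smooth x(2)] by auto
  next
    fix y :: "real ^ 'n" assume y: "y \<in> cball 0 1 - {0}"
    let ?x = "y /\<^sub>R m y"
    have m: "m y > 0" using y mpos by simp
    have e: "\<psi> ?x = y" using m by (simp add: \<psi>_def hom)
    have "?p ?x \<le> 1" using np[of ?x] y by (simp add: e)
    then have "?x \<in> K" using body_eq[OF regular_body_origin] by blast
    then show "y \<in> \<psi> ` (K - {0})" using e y m by (intro image_eqI[of _ _ ?x]) auto
  qed
  have one: "\<bar>det (matrix (\<psi>' x))\<bar> * ?F (\<psi> x) = 1" if x: "x \<in> K - {0}" for x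
  proof -
    have "?p (u (\<psi> x)) = m x"
      using x mpos[of x] by (subst pu) (auto simp: \<psi>_def hom)
    then show ?thesis using x mpos[of x] by (simp add: \<psi>')
  qed
  have "(\<lambda>x. \<bar>det (matrix (\<psi>' x))\<bar> * ?F (\<psi> x)) absolutely_integrable_on (K - {0}) \<and>
     (LINT x:K - {0}|lebesgue. \<bar>det (matrix (\<psi>' x))\<bar> * ?F (\<psi> x)) = measure lebesgue K"
  proof -
    have "(\<lambda>x. indicator (K - {0}) x *\<^sub>R (\<bar>det (matrix (\<psi>' x))\<bar> * ?F (\<psi> x))) = (\<lambda>x. indicator (K - {0}) x *\<^sub>R 1)"
    proof
      fix x
      show "indicator (K - {0}) x *\<^sub>R (\<bar>det (matrix (\<psi>' x))\<bar> * ?F (\<psi> x)) = indicator (K - {0}) x *\<^sub>R 1"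
        using one[of x] by (cases "x \<in> K - {0}") (simp_all only: indicator_simps scaleR_zero_left simp_thms)
    qed
    then show ?thesis
      using integral_const_body by (simp only: set_integrable_def set_lebesgue_integral_def)
  qed
  then have "?F absolutely_integrable_on (\<psi> ` (K - {0})) \<and>
     (LINT x:\<psi> ` (K - {0})|lebesgue. ?F x) = measure lebesgue K"
    by (rule change_of_variables_real[OF measurable_body_minus(1), THEN iffD1, rotated 2])
       (auto intro!: has_derivative_at_withinI \<psi>' inj)
  then show "?F absolutely_integrable_on (cball 0 1 - {0})" "(LINT y:cball 0 1 - {0}|lebesgue. ?F y) = measure lebesgue K"
    by (simp_all only: img)
qed

end

section \<open>Polars of smooth bodies with positive curvature\<close>

definition hom_gauss_inv :: "(real ^ 'n) set \<Rightarrow> real ^ 'n \<Rightarrow> real ^ 'n" where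
  "hom_gauss_inv K = the_inv_into (- {0}) (hom_gauss K)"

context
  fixes K :: "(real ^ 'n::finite) set"
  assumes rK: "regular_body K"
begin

lemma hom_gauss_inv:
  shows "x \<noteq> 0 \<Longrightarrow> hom_gauss_inv K (hom_gauss K x) = x"
    and "y \<noteq> 0 \<Longrightarrow> hom_gauss_inv K y \<noteq> 0"
    and "y \<noteq> 0 \<Longrightarrow> hom_gauss K (hom_gauss_inv K y) = y"
proof -
  show 1: "hom_gauss_inv K (hom_gauss K x) = x" if "x \<noteq> 0" for x
    unfolding hom_gauss_inv_def using that by (intro the_inv_into_f_f hom_gauss_inj[OF rK]) simp
  assume "y \<noteq> 0"
  then obtain x where "x \<noteq> 0" "hom_gauss K x = y" using hom_gauss_surj[OF rK] by blast
  then show "hom_gauss_inv K y \<noteq> 0" "hom_gauss K (hom_gauss_inv K y) = y"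
    using 1[of x] by auto
qed

lemma det_hom_gauss'_pos:
  assumes "x \<noteq> 0" shows "det (matrix (hom_gauss' K x)) > 0"
proof -
  note f = scale_to_frontier[OF regular_body_origin[OF rK] assms]
  have "gauss_curvature K (x /\<^sub>R support_function (polar_body K) x) > 0"
    using rK f unfolding regular_body_def by blast
  then show ?thesis
    unfolding det_hom_gauss'[OF regular_body_smooth[OF rK] assms]
    using outer_normal_inner_pos[OF regular_body_smooth[OF rK] f] by (rule divide_pos_pos)
qed

text \<open>The differential is invertible at each point because its determinant is positive, but it
  is not known to be continuous. The inverse function theorem is therefore used in the form for a
  continuous map with a derivative at a single point.\<close>

lemma hom_gauss_inv_differentiable:
  assumes y: "y \<noteq> 0"
  shows "hom_gauss_inv K differentiable (at y)"
proof -
  define x where "x = hom_gauss_inv K y"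
  have x: "x \<noteq> 0" "hom_gauss K x = y" using hom_gauss_inv[of y] hom_gauss_inv(3)[of y] y by (auto simp: x_def)
  note d = hom_gauss_has_derivative[OF regular_body_smooth[OF rK]]
  have lin: "linear (hom_gauss' K x)"
    using d[OF x(1)] by (simp add: has_derivative_bounded_linear bounded_linear.linear)
  have "inj (hom_gauss' K x)" using det_nz_iff_inj[OF lin] det_hom_gauss'_pos[OF x(1)] by simp
  then have "surj (hom_gauss' K x)" using lin linear_injective_imp_surjective by blast
  then obtain g where g: "hom_gauss' K x \<circ> g = id"
    using linear_surjective_right_inverse[OF lin] by blast
  have cont: "continuous_on (- {0}) (hom_gauss K)"
    using d by (intro continuous_at_imp_continuous_on ballI has_derivative_continuous) auto
  have "(hom_gauss_inv K has_derivative g) (at (hom_gauss K x))"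
    by (rule has_derivative_inverse_strong[OF _ _ cont _ d[OF x(1)] g]) (use x hom_gauss_inv in auto)
  then show ?thesis using x by (auto simp: differentiable_def)
qed

lemma polar_frontier_eq: "frontier (polar_body K) = {y. support_function K y = 1}"
  using frontier_eq[OF regular_body_origin_polar[OF rK]] bipolar[OF regular_body_origin[OF rK]] by simp

text \<open>Geometrically, \<open>x\<close> is the inverse Gauss image of the direction of
  \<open>y\<close>, that is, the gradient of the support function at \<open>y\<close>.\<close>

lemma hom_gauss_inv_normal:
  assumes y: "y \<noteq> 0"
  defines "x \<equiv> hom_gauss_inv K y /\<^sub>R norm y"
  shows "x \<in> frontier K" "outer_normal K x = y /\<^sub>R norm y" "x \<bullet> y = support_function K y"
proof -
  let ?z = "hom_gauss_inv K y"
  have z: "?z \<noteq> 0" "hom_gauss K ?z = y" using hom_gauss_inv(2,3) y by auto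
  have p: "support_function (polar_body K) ?z = norm y" using hom_gauss_proj(1)[OF rK z(1)] z(2) by simp
  show f: "x \<in> frontier K" using scale_to_frontier[OF regular_body_origin[OF rK] z(1)] by (simp add: x_def p)
  show n: "outer_normal K x = y /\<^sub>R norm y"
    using hom_gauss_proj(2)[OF rK z(1)] by (simp add: z(2) p sphere_proj_def x_def)
  have "x \<bullet> (y /\<^sub>R norm y) = support_function K (y /\<^sub>R norm y)"
    using outer_normal_props(2)[OF regular_body_smooth[OF rK] f] n by simp
  then show "x \<bullet> y = support_function K y"
    using y by (simp add: support_scale[OF regular_body_origin[OF rK]])
qed

text \<open>Duality of boundary points: the normal of the polar body at \<open>y\<close> points
  towards the point \<open>x\<close> of \<open>K\<close> whose normal points towards
  \<open>y\<close>, and \<open>x \<bullet> y = 1\<close>. Conversely, any normal \<open>u\<close>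
  rescaled to the frontier of \<open>K\<close> is a point with normal direction \<open>y\<close>, so
  it equals \<open>x\<close> by injectivity of the Gauss map.\<close>

lemma polar_unit_normal:
  assumes y: "y \<in> frontier (polar_body K)"
  shows "norm u = 1 \<and> (\<forall>z\<in>polar_body K. z \<bullet> u \<le> y \<bullet> u) \<longleftrightarrow> u = sphere_proj (hom_gauss_inv K y)"
proof -
  let ?p = "support_function (polar_body K)" and ?h = "support_function K"
  note K = regular_body_origin[OF rK] and K' = regular_body_origin_polar[OF rK]
  have hy: "?h y = 1" using y by (simp add: polar_frontier_eq)
  then have y0: "y \<noteq> 0" by (auto simp: support_zero[OF K])
  have yL: "y \<in> polar_body K" using hy by (simp add: polar_eq[OF K])
  define x where "x = hom_gauss_inv K y /\<^sub>R norm y"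
  note x = hom_gauss_inv_normal[OF y0, folded x_def]
  have px: "?p x = 1" using x(1) by (simp add: frontier_eq[OF K])
  have x0: "x \<noteq> 0" using px support_zero[OF K'] by auto
  have sp: "sphere_proj (hom_gauss_inv K y) = x /\<^sub>R norm x"
    using y0 by (simp add: sphere_proj_def x_def)
  show ?thesis
  proof
    assume u: "norm u = 1 \<and> (\<forall>z\<in>polar_body K. z \<bullet> u \<le> y \<bullet> u)"
    have yu: "y \<bullet> u = ?p u" using support_max_iff[OF K' yL, of u] u by blast
    have u0: "u \<noteq> 0" using u by force
    have pu: "?p u > 0" by (rule support_pos[OF K' u0])
    let ?v = "u /\<^sub>R ?p u"
    have v: "?v \<in> frontier K" by (rule scale_to_frontier[OF K u0])
    have "?v \<bullet> y = 1" using yu pu by (simp add: inner_commute)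
    then have "?v \<bullet> (y /\<^sub>R norm y) = ?h (y /\<^sub>R norm y)" using hy by (simp add: support_scale[OF K])
    then have "outer_normal K ?v = y /\<^sub>R norm y"
      using y0 by (intro outer_normal_eqI[OF regular_body_smooth[OF rK] v]) auto
    then have "?v = x" using inj_onD[OF normal_inj[OF rK] _ v x(1)] x(2) by simp
    then have eq: "u = ?p u *\<^sub>R x" using pu by auto
    have "norm u = ?p u * norm x" using arg_cong[OF eq, of norm] pu by (simp only: norm_scaleR abs_of_pos)
    then have "?p u * norm x = 1" using u by simp
    then have "?p u = 1 / norm x" using x0 by (simp add: field_simps)
    then show "u = sphere_proj (hom_gauss_inv K y)" using eq by (simp add: sp divide_inverse)
  next
    assume u: "u = sphere_proj (hom_gauss_inv K y)"
    have "z \<bullet> u \<le> y \<bullet> u" if z: "z \<in> polar_body K" for z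
    proof -
      have "z \<bullet> x \<le> 1" using support_ge[OF K' z, of x] px by simp
      then have "z \<bullet> x \<le> y \<bullet> x" using x(3) hy by (simp add: inner_commute)
      then show ?thesis unfolding u sp by (simp add: divide_right_mono mult_left_mono)
    qed
    then show "norm u = 1 \<and> (\<forall>z\<in>polar_body K. z \<bullet> u \<le> y \<bullet> u)"
      using x0 by (simp add: u sp)
  qed
qed

lemma polar_outer_normal:
  "y \<in> frontier (polar_body K) \<Longrightarrow> outer_normal (polar_body K) y = sphere_proj (hom_gauss_inv K y)"
  unfolding outer_normal_def by (simp add: polar_unit_normal)

lemma smooth_body_polar: "smooth_body (polar_body K)"
  unfolding smooth_body_def
proof (intro conjI ballI)
  show "origin_body (polar_body K)" by (rule regular_body_origin_polar[OF rK])
  fix y assume y: "y \<in> frontier (polar_body K)"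
  show "\<exists>!u. norm u = 1 \<and> (\<forall>z\<in>polar_body K. z \<bullet> u \<le> y \<bullet> u)"
    by (simp add: polar_unit_normal[OF y])
  have y0: "y \<noteq> 0" using y by (auto simp: polar_frontier_eq support_zero[OF regular_body_origin[OF rK]])
  obtain D where D: "(hom_gauss_inv K has_derivative D) (at y)"
    using hom_gauss_inv_differentiable[OF y0] by (auto simp: differentiable_def)
  have z0: "hom_gauss_inv K y \<noteq> 0" by (rule hom_gauss_inv(2)[OF y0])
  have "(\<lambda>z :: real ^ 'n. z /\<^sub>R norm z) differentiable (at (hom_gauss_inv K y))"
    using z0 by (intro differentiable_scaleR differentiable_inverse differentiable_norm_at differentiable_ident) auto
  then obtain E where "((\<lambda>z :: real ^ 'n. z /\<^sub>R norm z) has_derivative E) (at (hom_gauss_inv K y))"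
    by (auto simp: differentiable_def)
  from has_derivative_compose[OF D this]
  have "((\<lambda>y. sphere_proj (hom_gauss_inv K y)) has_derivative (\<lambda>v. E (D v))) (at y within frontier (polar_body K))"
    unfolding sphere_proj_def by (rule has_derivative_at_withinI)
  from has_derivative_transform[OF y polar_outer_normal this]
  show "outer_normal (polar_body K) differentiable (at y within frontier (polar_body K))"
    by (auto simp: differentiable_def)
qed

text \<open>The Gauss maps of \<open>K\<close> and of its polar are inverse to each other up to
  radial rescaling: \<open>hom_gauss K\<close> after \<open>\<psi>\<close> after
  \<open>hom_gauss ?L\<close> is the radial map with factor \<open>?h z / norm z\<close>. By the
  chain rule four Jacobians are related, three of them are known to be positive, and the remaining
  one contains the curvature of the polar body.\<close>

lemma regular_body_polar: "regular_body (polar_body K)"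
  unfolding regular_body_def
proof (intro conjI ballI smooth_body_polar)
  let ?L = "polar_body K" let ?p = "support_function (polar_body K)" and ?h = "support_function K"
  note K = regular_body_origin[OF rK] and K' = regular_body_origin_polar[OF rK]
  fix y assume y: "y \<in> frontier ?L"
  have hy: "?h y = 1" using y by (simp add: polar_frontier_eq)
  then have y0: "y \<noteq> 0" by (auto simp: support_zero[OF K])
  have gL: "support_function (polar_body ?L) = ?h" by (simp add: bipolar[OF K])
  define \<psi> where "\<psi> w = (norm w / ?p w) *\<^sub>R w" for w :: "real ^ 'n"
  have key: "hom_gauss K (\<psi> (hom_gauss ?L z)) = (?h z / norm z) *\<^sub>R z" and nz: "\<psi> (hom_gauss ?L z) \<noteq> 0" and nz': "hom_gauss ?L z \<noteq> 0"
    if z: "z \<noteq> 0" for z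
  proof -
    have hz: "?h z > 0" by (rule support_pos[OF K z])
    define v where "v = z /\<^sub>R ?h z"
    have v: "v \<in> frontier ?L" using scale_to_frontier[OF K' z] by (simp add: v_def gL)
    have v0: "v \<noteq> 0" using z hz by (simp add: v_def)
    define x where "x = hom_gauss_inv K v /\<^sub>R norm v"
    note x = hom_gauss_inv_normal[OF v0, folded x_def]
    have px: "?p x = 1" using x(1) by (simp add: frontier_eq[OF K])
    have x0: "x \<noteq> 0" using px support_zero[OF K'] by auto
    have g: "hom_gauss ?L z = (?h z / norm x) *\<^sub>R x"
      using v0 by (simp add: hom_gauss_def Let_def gL v_def[symmetric] polar_outer_normal[OF v] sphere_proj_def x_def divide_inverse)
    show "hom_gauss ?L z \<noteq> 0" using g hz x0 by simp
    have ps: "?p ((?h z / norm x) *\<^sub>R x) = ?h z / norm x"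
      using hz by (subst support_scale[OF K']) (simp_all add: px)
    have \<psi>: "\<psi> (hom_gauss ?L z) = ?h z *\<^sub>R x"
      unfolding g \<psi>_def ps using hz x0 by simp
    show "\<psi> (hom_gauss ?L z) \<noteq> 0" using \<psi> hz x0 by simp
    have p2: "?p (?h z *\<^sub>R x) = ?h z" using hz by (simp add: support_scale[OF K'] px)
    show "hom_gauss K (\<psi> (hom_gauss ?L z)) = (?h z / norm z) *\<^sub>R z"
    proof -
      have "hom_gauss K (?h z *\<^sub>R x) = ?h z *\<^sub>R (v /\<^sub>R norm v)"
        using hz by (simp add: hom_gauss_def Let_def p2 x(2))
      also have "\<dots> = (?h z / norm z) *\<^sub>R z"
        using hz by (simp add: v_def divide_inverse)
      finally show ?thesis by (simp only: \<psi>)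
    qed
  qed
  define w where "w = hom_gauss ?L y"
  have w0: "w \<noteq> 0" and pw0: "\<psi> w \<noteq> 0" using nz nz' y0 by (auto simp: w_def)
  have dL: "(hom_gauss ?L has_derivative hom_gauss' ?L y) (at y)"
    by (rule hom_gauss_has_derivative[OF smooth_body_polar y0])
  obtain A where A: "(\<psi> has_derivative A) (at w)" "det (matrix A) = (norm w / ?p w) ^ CARD('n)"
    using radial_gauge_derivative(2)[OF regular_body_smooth[OF rK] w0] unfolding \<psi>_def[abs_def] by blast
  have dK: "(hom_gauss K has_derivative hom_gauss' K (\<psi> w)) (at (\<psi> w))"
    by (rule hom_gauss_has_derivative[OF regular_body_smooth[OF rK] pw0])
  have comp: "((\<lambda>z. hom_gauss K (\<psi> (hom_gauss ?L z))) has_derivative (\<lambda>v. hom_gauss' K (\<psi> w) (A (hom_gauss' ?L y v)))) (at y)"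
    by (rule has_derivative_compose[OF has_derivative_compose[OF dL A(1)[unfolded w_def]] dK[unfolded w_def], folded w_def])
  obtain B where B: "((\<lambda>z. (?h z / norm z) *\<^sub>R z) has_derivative B) (at y)" "det (matrix B) = (?h y / norm y) ^ CARD('n)"
    using radial_gauge_derivative(1)[OF smooth_body_polar y0] unfolding gL by blast
  have "((\<lambda>z. hom_gauss K (\<psi> (hom_gauss ?L z))) has_derivative B) (at y)"
    by (rule has_derivative_transform_within_open[OF B(1), of "- {0}"]) (use y0 key in auto)
  from has_derivative_unique[OF this comp]
  have B': "B = (\<lambda>v. hom_gauss' K (\<psi> w) (A (hom_gauss' ?L y v)))" .
  have l: "linear (hom_gauss' ?L y)" "linear A" "linear (hom_gauss' K (\<psi> w))"
    using dL A(1) dK by (simp_all add: has_derivative_bounded_linear bounded_linear.linear)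
  have "det (matrix B) = det (matrix (hom_gauss' K (\<psi> w))) * (det (matrix A) * det (matrix (hom_gauss' ?L y)))"
    unfolding B' by (subst det_matrix_compose[OF linear_compose[OF l(1,2), unfolded o_def] l(3)])
      (simp add: det_matrix_compose[OF l(1,2)])
  moreover have "det (matrix B) > 0" using y0 hy by (simp add: B(2))
  moreover have "det (matrix A) > 0" using w0 support_pos[OF K' w0] by (simp add: A(2))
  moreover have "det (matrix (hom_gauss' K (\<psi> w))) > 0" by (rule det_hom_gauss'_pos[OF pw0])
  ultimately have pos: "det (matrix (hom_gauss' ?L y)) > 0" by (simp add: zero_less_mult_iff)
  have "det (matrix (hom_gauss' ?L y)) = gauss_curvature ?L y / (y \<bullet> outer_normal ?L y)"
    using det_hom_gauss'[OF smooth_body_polar y0] by (simp add: gL hy)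
  then show "gauss_curvature ?L y > 0"
    using pos outer_normal_inner_pos[OF smooth_body_polar y] by (simp add: zero_less_divide_iff)
qed

end

section \<open>Boundaries of class C2\<close>

text \<open>If a normal vector \<open>u\<close> were not parallel to \<open>G x\<close>, then \<open>g\<close> would change sign, hence vanish,
  on a segment beyond the supporting hyperplane.\<close>

lemma level_set_normal_orthogonal:
  fixes K :: "(real ^ 'n::finite) set"
  assumes "closed K" and U: "open U" "x \<in> U"
    and g: "\<And>y. y \<in> U \<Longrightarrow> (g has_derivative (\<lambda>v. G y \<bullet> v)) (at y)"
    and G: "G x \<noteq> 0" and S: "frontier K \<inter> U = {y \<in> U. g y = 0}" and x: "x \<in> frontier K"
    and u: "\<And>y. y \<in> K \<Longrightarrow> y \<bullet> u \<le> x \<bullet> u" and v: "v \<bullet> G x = 0"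
  shows "v \<bullet> u \<le> 0"
proof (rule ccontr)
  assume "\<not> v \<bullet> u \<le> 0"
  then have vu: "v \<bullet> u > 0" by simp
  \<comment> \<open>Small enough that tilting \<open>v\<close> by \<open>e *\<^sub>R G x\<close> in
    either direction keeps it pointing strictly beyond the supporting hyperplane, while
    \<open>g\<close> increases along \<open>a\<close> and decreases along \<open>b\<close>.\<close>
  define e where "e = (v \<bullet> u) / (2 * (\<bar>G x \<bullet> u\<bar> + 1))"
  have e: "e > 0" using vu by (simp add: e_def)
  have "e * \<bar>G x \<bullet> u\<bar> \<le> e * (\<bar>G x \<bullet> u\<bar> + 1)" using e by simp
  also have "\<dots> = (v \<bullet> u) / 2" by (simp add: e_def field_simps)
  finally have eG: "\<bar>e * (G x \<bullet> u)\<bar> < v \<bullet> u" using vu e by (simp add: abs_mult)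
  define a where "a = v + e *\<^sub>R G x"
  define b where "b = v - e *\<^sub>R G x"
  have au: "a \<bullet> u > 0" and bu: "b \<bullet> u > 0"
    using eG by (auto simp: a_def b_def inner_add_left inner_diff_left)
  have gx: "g x = 0" using S x U by blast
  have ray: "((\<lambda>t. g (x + t *\<^sub>R w)) has_real_derivative (G x \<bullet> w)) (at 0)" for w
  proof -
    have "((\<lambda>t. x + t *\<^sub>R w) has_derivative (\<lambda>t. t *\<^sub>R w)) (at 0)"
      by (auto intro!: derivative_eq_intros)
    from has_derivative_compose[OF this, of g "\<lambda>v. G x \<bullet> v"] g[OF U(2)]
    show ?thesis by (simp add: has_field_derivative_def mult_commute_abs)
  qed
  have GG: "G x \<bullet> G x > 0" using G by simp
  have "G x \<bullet> a = e * (G x \<bullet> G x)" "G x \<bullet> b = - (e * (G x \<bullet> G x))"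
    using v by (simp_all add: a_def b_def inner_add_right inner_diff_right inner_commute)
  then have "G x \<bullet> a > 0" "G x \<bullet> b < 0" using e GG by simp_all
  then obtain d1 d2 where d: "d1 > 0" "\<And>t. 0 < t \<Longrightarrow> t < d1 \<Longrightarrow> g (x + t *\<^sub>R a) > 0"
      "d2 > 0" "\<And>t. 0 < t \<Longrightarrow> t < d2 \<Longrightarrow> g (x + t *\<^sub>R b) < 0"
    using DERIV_pos_inc_right[OF ray[of a]] DERIV_neg_dec_right[OF ray[of b]] gx by auto
  obtain r where r: "r > 0" "ball x r \<subseteq> U" using U open_contains_ball by blast
  define M where "M = norm a + norm b + 1"
  have M: "M > 0" by (simp add: M_def add_nonneg_pos)
  define t where "t = Min {d1 / 2, d2 / 2, r / (2 * M)}"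
  have t: "0 < t" "t < d1" "t < d2" "t * M < r"
  proof -
    show "0 < t" using d(1,3) r M by (simp add: t_def)
    have "t \<le> d1 / 2" "t \<le> d2 / 2" "t \<le> r / (2 * M)" by (auto simp: t_def)
    then show "t < d1" "t < d2" "t * M < r" using d(1,3) r M by (auto simp: field_simps)
  qed
  have inU: "x + t *\<^sub>R w \<in> U" if "norm w < M" for w
  proof -
    have "t * norm w < r" using that t by (meson mult_strict_left_mono less_trans)
    then show ?thesis using r(2) t by (auto simp: dist_norm)
  qed
  let ?c = "\<lambda>s. b + s *\<^sub>R (a - b)"
  have c: "norm (?c s) < M" "?c s \<bullet> u > 0" if "s \<in> {0..1}" for s
  proof -
    have eq: "?c s = (1 - s) *\<^sub>R b + s *\<^sub>R a" by (simp add: algebra_simps)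
    have "norm (?c s) \<le> (1 - s) * norm b + s * norm a"
      unfolding eq using norm_triangle_ineq[of "(1 - s) *\<^sub>R b" "s *\<^sub>R a"] that by simp
    also have "\<dots> \<le> norm b + norm a"
      using that by (intro add_mono mult_left_le_one_le) auto
    finally show "norm (?c s) < M" by (simp add: M_def)
    have "?c s \<bullet> u = (1 - s) * (b \<bullet> u) + s * (a \<bullet> u)" unfolding eq by (simp add: inner_add_left)
    moreover have "\<dots> > 0"
    proof (cases "s = 0")
      case False
      then show ?thesis using that au bu by (intro add_nonneg_pos mult_pos_pos mult_nonneg_nonneg) auto
    qed (use bu in simp)
    ultimately show "?c s \<bullet> u > 0" by simp
  qed
  have contg: "continuous_on U g"
    using g by (intro continuous_at_imp_continuous_on ballI) (auto intro: has_derivative_continuous)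
  have "\<exists>s. 0 \<le> s \<and> s \<le> 1 \<and> g (x + t *\<^sub>R ?c s) = 0"
  proof (rule IVT')
    show "g (x + t *\<^sub>R ?c 0) \<le> 0" using d(4)[OF t(1,3)] by simp
    show "0 \<le> g (x + t *\<^sub>R ?c 1)" using d(2)[OF t(1,2)] by simp
    show "continuous_on {0..1} (\<lambda>s. g (x + t *\<^sub>R ?c s))"
      by (rule continuous_on_compose2[OF contg]) (auto intro!: continuous_intros inU c)
  qed simp
  then obtain s where s: "s \<in> {0..1}" "g (x + t *\<^sub>R ?c s) = 0" by auto
  then have "x + t *\<^sub>R ?c s \<in> frontier K" using S inU c(1) by blast
  then have "x + t *\<^sub>R ?c s \<in> K" using frontier_subset_closed[OF assms(1)] by blast
  from u[OF this] have "t * (?c s \<bullet> u) \<le> 0" by (simp add: inner_add_left)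
  then show False using c(2)[OF s(1)] t(1) by (simp add: mult_le_0_iff)
qed

text \<open>The component \<open>v\<close> of \<open>u\<close> orthogonal to \<open>G x\<close>
  satisfies \<open>v \<bullet> u \<le> 0\<close>, yet \<open>v \<bullet> u = v \<bullet> v\<close>;
  so \<open>u\<close> is a multiple of \<open>G x\<close>. The origin being interior makes
  \<open>x \<bullet> u\<close> positive, which fixes the sign.\<close>

lemma level_set_unit_normal:
  fixes K :: "(real ^ 'n::finite) set"
  assumes K: "origin_body K" and U: "open U" "x \<in> U"
    and g: "\<And>y. y \<in> U \<Longrightarrow> (g has_derivative (\<lambda>v. G y \<bullet> v)) (at y)"
    and G: "G x \<noteq> 0" and S: "frontier K \<inter> U = {y \<in> U. g y = 0}" and x: "x \<in> frontier K"
    and u: "norm u = 1" "\<And>y. y \<in> K \<Longrightarrow> y \<bullet> u \<le> x \<bullet> u"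
  shows "x \<bullet> G x \<noteq> 0" "u = (sgn (x \<bullet> G x) / norm (G x)) *\<^sub>R G x"
proof -
  define l where "l = (u \<bullet> G x) / (G x \<bullet> G x)"
  define v where "v = u - l *\<^sub>R G x"
  have vG: "v \<bullet> G x = 0" using G by (simp add: v_def l_def inner_diff_left)
  have "v \<bullet> u \<le> 0" using level_set_normal_orthogonal[OF origin_bodyD(6)[OF K] U g G S x u(2) vG] by blast
  moreover have "v \<bullet> u = v \<bullet> v" using vG by (simp add: v_def inner_diff_right)
  ultimately have "v = 0" by (metis inner_gt_zero_iff not_less)
  then have ul: "u = l *\<^sub>R G x" by (simp add: v_def)
  have xK: "x \<in> K" using x frontier_subset_closed[OF origin_bodyD(6)[OF K]] by blast
  have "x \<bullet> u = support_function K u" using u support_max_iff[OF K xK] by blast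
  moreover have "u \<noteq> 0" using u(1) by force
  ultimately have pos: "l * (x \<bullet> G x) > 0" using support_pos[OF K] ul by (metis inner_scaleR_right)
  then show "x \<bullet> G x \<noteq> 0" by auto
  have "\<bar>l\<bar> * norm (G x) = 1" using u(1) ul by (metis norm_scaleR)
  then have "\<bar>l\<bar> = 1 / norm (G x)" using G by (simp add: field_simps)
  moreover have "sgn l = sgn (x \<bullet> G x)" using pos by (auto simp: sgn_if zero_less_mult_iff)
  ultimately have "l = sgn (x \<bullet> G x) / norm (G x)" by (metis mult_sgn_abs times_divide_eq_right mult.right_neutral)
  then show "u = (sgn (x \<bullet> G x) / norm (G x)) *\<^sub>R G x" using ul by simp
qed

text \<open>A point of the polar body at which the gauge of \<open>x\<close> is attained is a normal
  vector at \<open>x\<close>.\<close>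

lemma unit_normal_exists:
  fixes K :: "(real ^ 'n::finite) set"
  assumes K: "origin_body K" and x: "x \<in> frontier K"
  shows "\<exists>u. norm u = 1 \<and> (\<forall>y\<in>K. y \<bullet> u \<le> x \<bullet> u)"
proof -
  have "support_function (polar_body K) x = 1" using x frontier_eq[OF K] by blast
  then obtain z where z: "z \<in> polar_body K" "z \<bullet> x = 1"
    using support_attained[OF origin_body_polar[OF K], of x] by auto
  then have "z \<noteq> 0" by auto
  moreover have "y \<bullet> z \<le> x \<bullet> z" if "y \<in> K" for y
    using z that by (simp add: polar_body_def inner_commute)
  ultimately show ?thesis
    by (intro exI[of _ "z /\<^sub>R norm z"]) (auto intro!: mult_left_mono)
qed

text \<open>On the frontier the only possible unit normal is \<open>G\<close> normalized, with the
  sign of \<open>y \<bullet> G y\<close>. That sign is locally constant and \<open>G\<close> is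
  differentiable, so the Gauss map is differentiable too.\<close>

lemma regular_body_C2_plus:
  fixes K :: "(real ^ 'n::finite) set"
  assumes "C2_plus K"
  shows "regular_body K"
proof -
  have K: "origin_body K" using assms by (simp add: C2_plus_def convex_body_def origin_body_def)
  have "(\<exists>!u. norm u = 1 \<and> (\<forall>y\<in>K. y \<bullet> u \<le> x \<bullet> u)) \<and>
        outer_normal K differentiable (at x within frontier K)" if x: "x \<in> frontier K" for x
  proof -
    from assms x obtain U g G where U: "open U" "x \<in> U" and C2: "C2_function_on U g G"
      and G0: "\<And>y. y \<in> U \<Longrightarrow> G y \<noteq> 0" and S: "frontier K \<inter> U = {y \<in> U. g y = 0}"
      unfolding C2_plus_def C2_hypersurface_def by meson
    obtain H where g: "\<And>y. y \<in> U \<Longrightarrow> (g has_derivative (\<lambda>v. G y \<bullet> v)) (at y)"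
      and H: "\<And>y. y \<in> U \<Longrightarrow> (G has_derivative (\<lambda>v. H y *v v)) (at y)"
      using C2 unfolding C2_function_on_def by blast
    define N where "N y = (sgn (y \<bullet> G y) / norm (G y)) *\<^sub>R G y" for y
    have uniq: "u = N y" "y \<bullet> G y \<noteq> 0"
      if "y \<in> frontier K" "y \<in> U" "norm u = 1 \<and> (\<forall>z\<in>K. z \<bullet> u \<le> y \<bullet> u)" for y u
      using level_set_unit_normal[OF K U(1) that(2) g G0[OF that(2)] S that(1), of u] that(3)
      unfolding N_def by blast+
    have ex1: "\<exists>!u. norm u = 1 \<and> (\<forall>z\<in>K. z \<bullet> u \<le> y \<bullet> u)" if "y \<in> frontier K" "y \<in> U" for y
      using unit_normal_exists[OF K that(1)] uniq(1)[OF that] by metis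
    have on: "outer_normal K y = N y" if "y \<in> frontier K" "y \<in> U" for y
      unfolding outer_normal_def using theI'[OF ex1[OF that]] uniq(1)[OF that] by blast
    have xG: "x \<bullet> G x \<noteq> 0" using unit_normal_exists[OF K x] uniq(2)[OF x U(2)] by blast
    have "isCont G x" using H[OF U(2)] by (rule has_derivative_continuous)
    then have "((\<lambda>y. y \<bullet> G y) \<longlongrightarrow> x \<bullet> G x) (at x)"
      unfolding isCont_def by (intro tendsto_intros)
    then have "\<forall>\<^sub>F y in at x. sgn (y \<bullet> G y) = sgn (x \<bullet> G x)"
    proof (cases "x \<bullet> G x > 0")
      case True
      with \<open>((\<lambda>y. y \<bullet> G y) \<longlongrightarrow> x \<bullet> G x) (at x)\<close> have "\<forall>\<^sub>F y in at x. y \<bullet> G y > 0"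
        by (rule order_tendstoD(1))
      then show ?thesis using True by (auto elim: eventually_mono)
    next
      case False
      then have "x \<bullet> G x < 0" using xG by simp
      with \<open>((\<lambda>y. y \<bullet> G y) \<longlongrightarrow> x \<bullet> G x) (at x)\<close> have "\<forall>\<^sub>F y in at x. y \<bullet> G y < 0"
        by (rule order_tendstoD(2))
      then show ?thesis using \<open>x \<bullet> G x < 0\<close> by (auto elim: eventually_mono)
    qed
    moreover have "\<forall>\<^sub>F y in at x. y \<in> U" using U by (rule eventually_at_in_open')
    ultimately have "\<forall>\<^sub>F y in at x. y \<in> U \<and> sgn (y \<bullet> G y) = sgn (x \<bullet> G x)"
      by (simp add: eventually_conj)
    then obtain d where d: "d > 0" "\<And>y. y \<noteq> x \<Longrightarrow> dist y x < d \<Longrightarrow> y \<in> U \<and> sgn (y \<bullet> G y) = sgn (x \<bullet> G x)"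
      unfolding eventually_at by auto
    \<comment> \<open>The sign is frozen at its value at \<open>x\<close>, which removes the
      discontinuous \<open>sgn\<close> from the formula without changing it within distance
      \<open>d\<close>.\<close>
    let ?N = "\<lambda>y. (sgn (x \<bullet> G x) / norm (G y)) *\<^sub>R G y"
    have dG: "G differentiable (at x)" using H[OF U(2)] by (auto simp: differentiable_def)
    moreover have "(\<lambda>y. norm (G y)) differentiable (at x)"
      by (rule differentiable_compose[OF _ dG]) (rule differentiable_norm_at[OF G0[OF U(2)]])
    ultimately have "?N differentiable (at x)"
      using G0[OF U(2)] by (intro differentiable_scaleR differentiable_divide) auto
    then obtain N' where "(?N has_derivative N') (at x)" by (auto simp: differentiable_def)
    then have "(?N has_derivative N') (at x within frontier K)" by (rule has_derivative_at_withinI)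
    then have "(outer_normal K has_derivative N') (at x within frontier K)"
    proof (rule has_derivative_transform_within[OF _ d(1) x])
      fix y assume "y \<in> frontier K" "dist y x < d"
      then show "?N y = outer_normal K y"
        using d(2)[of y] on[of y] U(2) by (cases "y = x") (auto simp: N_def)
    qed
    then show ?thesis using ex1[OF x U(2)] by (auto simp: differentiable_def)
  qed
  then show ?thesis
    using K assms by (auto simp: regular_body_def smooth_body_def C2_plus_def)
qed

section \<open>Ellipsoids\<close>

declare transpose_matrix_vector [simp del]

definition centered_ellipsoid :: "real ^ 'n ^ 'n \<Rightarrow> (real ^ 'n) set" where
  "centered_ellipsoid A = (*v) A ` cball 0 1"

lemma inner_matrix_vector:
  fixes A :: "real ^ 'n::finite ^ 'n"
  shows "(A *v x) \<bullet> y = x \<bullet> (transpose A *v y)"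
  by (metis dot_lmul_matrix inner_commute transpose_matrix_vector)

context
  fixes A B :: "real ^ 'n::finite ^ 'n"
  assumes AB: "A ** B = mat 1" "B ** A = mat 1"
begin

lemma mv_inverse [simp]: "A *v (B *v x) = x" "B *v (A *v x) = x"
  "transpose A *v (transpose B *v x) = x" "transpose B *v (transpose A *v x) = x"
  by (simp_all add: matrix_vector_mul_assoc AB matrix_transpose_mul[symmetric] transpose_mat)

lemma mv_eq_0_iff [simp]: "A *v x = 0 \<longleftrightarrow> x = 0" "B *v x = 0 \<longleftrightarrow> x = 0"
  "transpose A *v x = 0 \<longleftrightarrow> x = 0" "transpose B *v x = 0 \<longleftrightarrow> x = 0"
  by (metis mv_inverse matrix_vector_mult_0_right)+

lemma centered_ellipsoid_eq: "centered_ellipsoid A = {x. norm (B *v x) \<le> 1}"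
proof (intro equalityI subsetI)
  fix x assume "x \<in> {x. norm (B *v x) \<le> 1}"
  then show "x \<in> centered_ellipsoid A"
    unfolding centered_ellipsoid_def by (intro image_eqI[of _ _ "B *v x"]) auto
qed (auto simp: centered_ellipsoid_def)

lemma origin_body_ellipsoid: "origin_body (centered_ellipsoid A)"
  unfolding origin_body_def
proof (intro conjI)
  have lin: "linear ((*v) A)" by simp
  show "compact (centered_ellipsoid A)"
    unfolding centered_ellipsoid_def
    by (intro compact_continuous_image matrix_vector_mult_linear_continuous_on compact_cball)
  show "convex (centered_ellipsoid A)"
    unfolding centered_ellipsoid_def by (intro convex_linear_image lin) simp
  have "open {x. norm (B *v x) < 1}"
    by (intro open_Collect_less continuous_on_norm[OF matrix_vector_mult_linear_continuous_on] continuous_on_const)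
  then show "0 \<in> interior (centered_ellipsoid A)"
    by (rule interiorI) (auto simp: centered_ellipsoid_eq)
qed

lemma support_ellipsoid: "support_function (centered_ellipsoid A) u = norm (transpose A *v u)"
proof (rule antisym)
  show "support_function (centered_ellipsoid A) u \<le> norm (transpose A *v u)"
  proof (rule support_le[OF origin_body_ellipsoid])
    fix x assume "x \<in> centered_ellipsoid A"
    then obtain z where z: "norm z \<le> 1" "x = A *v z" by (auto simp: centered_ellipsoid_def)
    have "x \<bullet> u = z \<bullet> (transpose A *v u)" by (simp only: z inner_matrix_vector)
    also have "\<dots> \<le> norm z * norm (transpose A *v u)" by (rule norm_cauchy_schwarz)
    also have "\<dots> \<le> norm (transpose A *v u)" using z by (simp add: mult_left_le_one_le)
    finally show "x \<bullet> u \<le> norm (transpose A *v u)" .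
  qed
  let ?w = "transpose A *v u"
  show "norm ?w \<le> support_function (centered_ellipsoid A) u"
  proof (cases "?w = 0")
    case False
    then have "A *v (?w /\<^sub>R norm ?w) \<in> centered_ellipsoid A" by (simp add: centered_ellipsoid_def)
    from support_ge[OF origin_body_ellipsoid this, of u]
    have "(?w /\<^sub>R norm ?w) \<bullet> ?w \<le> support_function (centered_ellipsoid A) u" by (simp only: inner_matrix_vector)
    moreover have "(?w /\<^sub>R norm ?w) \<bullet> ?w = norm ?w"
      using False by (simp add: dot_square_norm power2_eq_square)
    ultimately show ?thesis by simp
  qed (simp add: support_nonneg[OF origin_body_ellipsoid])
qed

end

lemma transpose_inverse:
  fixes A B :: "real ^ 'n::finite ^ 'n"
  assumes "A ** B = mat 1" "B ** A = mat 1"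
  shows "transpose B ** transpose A = mat 1" "transpose A ** transpose B = mat 1"
  using assms by (simp_all add: matrix_transpose_mul[symmetric] transpose_mat)

context
  fixes A B :: "real ^ 'n::finite ^ 'n"
  assumes AB: "A ** B = mat 1" "B ** A = mat 1"
begin

lemma polar_ellipsoid: "polar_body (centered_ellipsoid A) = centered_ellipsoid (transpose B)"
  unfolding polar_eq[OF origin_body_ellipsoid[OF AB]] support_ellipsoid[OF AB]
    centered_ellipsoid_eq[OF transpose_inverse[OF AB]] by simp

lemma gauge_ellipsoid: "support_function (polar_body (centered_ellipsoid A)) x = norm (B *v x)"
  by (simp add: polar_ellipsoid support_ellipsoid[OF transpose_inverse[OF AB]])

lemma frontier_ellipsoid: "frontier (centered_ellipsoid A) = {x. norm (B *v x) = 1}"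
  by (simp add: frontier_eq[OF origin_body_ellipsoid[OF AB]] gauge_ellipsoid)

text \<open>Pulled back to the ball, maximality at \<open>x\<close> is equality in the
  Cauchy--Schwarz inequality for \<open>?z\<close> and \<open>transpose A *v u\<close>, which makes
  the latter a nonnegative multiple of the former.\<close>

lemma ellipsoid_unit_normal:
  assumes x: "x \<in> frontier (centered_ellipsoid A)"
  shows "norm u = 1 \<and> (\<forall>y\<in>centered_ellipsoid A. y \<bullet> u \<le> x \<bullet> u) \<longleftrightarrow> u = sphere_proj (transpose B *v (B *v x))"
proof -
  let ?z = "B *v x"
  note K = origin_body_ellipsoid[OF AB]
  have z: "norm ?z = 1" using x by (simp add: frontier_ellipsoid)
  have xK: "x \<in> centered_ellipsoid A" using x z by (simp add: centered_ellipsoid_eq[OF AB])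
  have xu: "x \<bullet> u = ?z \<bullet> (transpose A *v u)"
    using inner_matrix_vector[of A ?z u] by (simp add: mv_inverse[OF AB])
  have "(\<forall>y\<in>centered_ellipsoid A. y \<bullet> u \<le> x \<bullet> u) \<longleftrightarrow> ?z \<bullet> (transpose A *v u) = norm ?z * norm (transpose A *v u)"
    using support_max_iff[OF K xK, of u] xu by (simp only: support_ellipsoid[OF AB] z mult_1)
  also have "\<dots> \<longleftrightarrow> transpose A *v u = norm (transpose A *v u) *\<^sub>R ?z"
    using norm_cauchy_schwarz_eq[of ?z "transpose A *v u"] by (simp only: z scaleR_one)
  finally have iff: "(\<forall>y\<in>centered_ellipsoid A. y \<bullet> u \<le> x \<bullet> u) \<longleftrightarrow> transpose A *v u = norm (transpose A *v u) *\<^sub>R ?z" .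
  let ?s = "transpose B *v ?z"
  have s0: "?s \<noteq> 0" using z by (auto simp: mv_eq_0_iff[OF AB])
  show ?thesis
    unfolding iff
  proof
    assume u: "norm u = 1 \<and> transpose A *v u = norm (transpose A *v u) *\<^sub>R ?z"
    define c where "c = norm (transpose A *v u)"
    have c: "c \<ge> 0" by (simp add: c_def)
    have "transpose B *v (transpose A *v u) = transpose B *v (c *\<^sub>R ?z)" using u by (simp add: c_def)
    then have uc: "u = c *\<^sub>R ?s" by (simp add: mv_inverse[OF AB] matrix_vector_mult_scaleR)
    then have "c * norm ?s = 1" using u c by simp
    then have "c = inverse (norm ?s)" using s0 by (simp add: field_simps)
    then show "u = sphere_proj ?s" using uc by (simp add: sphere_proj_def)
  next
    assume u: "u = sphere_proj ?s"
    have "transpose A *v u = (1 / norm ?s) *\<^sub>R ?z"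
      by (simp add: u sphere_proj_def matrix_vector_mult_scaleR mv_inverse[OF AB] divide_inverse)
    then have "transpose A *v u = norm (transpose A *v u) *\<^sub>R ?z" using z by simp
    moreover have "norm u = 1" using s0 by (simp add: u sphere_proj_def)
    ultimately show "norm u = 1 \<and> transpose A *v u = norm (transpose A *v u) *\<^sub>R ?z" by blast
  qed
qed

lemma ellipsoid_outer_normal:
  "x \<in> frontier (centered_ellipsoid A) \<Longrightarrow> outer_normal (centered_ellipsoid A) x = sphere_proj (transpose B *v (B *v x))"
  unfolding outer_normal_def by (simp add: ellipsoid_unit_normal)

lemma smooth_body_ellipsoid: "smooth_body (centered_ellipsoid A)"
  unfolding smooth_body_def
proof (intro conjI ballI)
  show "origin_body (centered_ellipsoid A)" by (rule origin_body_ellipsoid[OF AB])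
  fix x assume x: "x \<in> frontier (centered_ellipsoid A)"
  show "\<exists>!u. norm u = 1 \<and> (\<forall>z\<in>centered_ellipsoid A. z \<bullet> u \<le> x \<bullet> u)"
    by (simp add: ellipsoid_unit_normal[OF x])
  have x0: "x \<noteq> 0" using x by (auto simp: frontier_ellipsoid)
  let ?S = "\<lambda>x. transpose B *v (B *v x)"
  have "linear ?S" by (rule linear_compose[OF matrix_vector_mul_linear matrix_vector_mul_linear, unfolded o_def])
  then have d: "?S differentiable (at x)" by (rule linear_imp_differentiable)
  have s0: "?S x \<noteq> 0" using x0 by (simp add: mv_eq_0_iff[OF AB])
  have "(\<lambda>x. norm (?S x)) differentiable (at x)"
    by (rule differentiable_compose[OF _ d]) (rule differentiable_norm_at[OF s0])
  then have "(\<lambda>x. sphere_proj (?S x)) differentiable (at x)"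
    unfolding sphere_proj_def using s0 d by (intro differentiable_scaleR differentiable_inverse) auto
  then obtain N' where "((\<lambda>x. sphere_proj (?S x)) has_derivative N') (at x within frontier (centered_ellipsoid A))"
    by (auto simp: differentiable_def intro: has_derivative_at_withinI)
  from has_derivative_transform[OF x ellipsoid_outer_normal this]
  show "outer_normal (centered_ellipsoid A) differentiable (at x within frontier (centered_ellipsoid A))"
    by (auto simp: differentiable_def)
qed

end

context
  fixes A B :: "real ^ 'n::finite ^ 'n"
  assumes AB: "A ** B = mat 1" "B ** A = mat 1"
begin

text \<open>The homogeneous Gauss map of an ellipsoid is the linear map \<open>?S\<close> followed
  by the radial map \<open>\<psi>\<close>, so its Jacobian is explicit. Comparing it with
  \<open>det_hom_gauss'\<close> determines the curvature. This is the source of the constancy of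
  \<open>f * h ^ (n + 1)\<close>.\<close>

lemma gauss_curvature_ellipsoid:
  assumes x: "x \<in> frontier (centered_ellipsoid A)"
  shows "gauss_curvature (centered_ellipsoid A) x =
    support_function (centered_ellipsoid A) (outer_normal (centered_ellipsoid A) x) ^ (CARD('n) + 1) / (det A)\<^sup>2"
proof -
  let ?E = "centered_ellipsoid A" and ?S = "\<lambda>x. transpose B *v (B *v x)"
  note sm = smooth_body_ellipsoid[OF AB]
  have x1: "norm (B *v x) = 1" using x by (simp add: frontier_ellipsoid[OF AB])
  then have x0: "x \<noteq> 0" by auto
  have s0: "?S z \<noteq> 0" if "z \<noteq> 0" for z using that by (simp add: mv_eq_0_iff[OF AB])
  have lS: "linear ?S" by (rule linear_compose[OF matrix_vector_mul_linear matrix_vector_mul_linear, unfolded o_def])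
  have dS: "(?S has_derivative ?S) (at x)" by (rule linear_imp_has_derivative[OF lS])
  define \<psi> where "\<psi> z = (norm (transpose A *v z) / norm z) *\<^sub>R z" for z :: "real ^ 'n"
  have hg: "hom_gauss ?E z = \<psi> (?S z)" if z: "z \<noteq> 0" for z
  proof -
    have n: "norm (B *v z) > 0" using z by (simp add: mv_eq_0_iff[OF AB])
    have "z /\<^sub>R norm (B *v z) \<in> frontier ?E"
      using n by (simp add: frontier_ellipsoid[OF AB] matrix_vector_mult_scaleR)
    from ellipsoid_outer_normal[OF AB this]
    have "outer_normal ?E (z /\<^sub>R norm (B *v z)) = ?S z /\<^sub>R norm (?S z)"
      using n by (simp add: matrix_vector_mult_scaleR sphere_proj_def)
    then show ?thesis
      by (simp add: hom_gauss_def Let_def gauge_ellipsoid[OF AB] \<psi>_def mv_inverse[OF AB] divide_inverse)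
  qed
  obtain P where P: "(\<psi> has_derivative P) (at (?S x))" "det (matrix P) = (norm (transpose A *v ?S x) / norm (?S x)) ^ CARD('n)"
    using radial_gauge_derivative(1)[OF smooth_body_ellipsoid[OF transpose_inverse[OF AB]] s0[OF x0]]
    unfolding gauge_ellipsoid[OF transpose_inverse[OF AB]] \<psi>_def[abs_def] by blast
  have "((\<lambda>z. \<psi> (?S z)) has_derivative (\<lambda>w. P (?S w))) (at x)"
    by (rule has_derivative_compose[OF dS P(1)])
  then have "(hom_gauss ?E has_derivative (\<lambda>w. P (?S w))) (at x)"
    by (rule has_derivative_transform_within_open[of _ _ _ _ "- {0}"]) (use x0 hg in auto)
  then have "hom_gauss' ?E x = (\<lambda>w. P (?S w))"
    using hom_gauss_has_derivative[OF sm x0] has_derivative_unique by blast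
  moreover have "linear P" using P(1) by (simp add: has_derivative_bounded_linear bounded_linear.linear)
  ultimately have "det (matrix (hom_gauss' ?E x)) = det (matrix P) * det (matrix ?S)"
    using det_matrix_compose[OF lS] by simp
  also have "det (matrix ?S) = (det B)\<^sup>2"
  proof -
    have "?S = (*v) (transpose B ** B)" by (simp add: fun_eq_iff matrix_vector_mul_assoc)
    then show ?thesis by (simp add: det_mul power2_eq_square)
  qed
  also have "(det B)\<^sup>2 = 1 / (det A)\<^sup>2"
  proof -
    have "det A * det B = 1" using AB(1) by (metis det_I det_mul)
    then have "(det A)\<^sup>2 * (det B)\<^sup>2 = 1" by (metis power_mult_distrib power_one)
    then show ?thesis by (metis div_by_0 eq_divide_imp mult.commute mult_zero_left zero_neq_one)
  qed
  also have "det (matrix P) = (1 / norm (?S x)) ^ CARD('n)"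
    by (simp add: P(2) mv_inverse[OF AB] x1)
  finally have d: "det (matrix (hom_gauss' ?E x)) = (1 / norm (?S x)) ^ CARD('n) / (det A)\<^sup>2" by simp
  have n: "outer_normal ?E x = ?S x /\<^sub>R norm (?S x)"
    using ellipsoid_outer_normal[OF AB x] by (simp add: sphere_proj_def)
  have h: "support_function ?E (outer_normal ?E x) = 1 / norm (?S x)"
    by (simp add: n support_ellipsoid[OF AB] matrix_vector_mult_scaleR mv_inverse[OF AB] x1 divide_inverse)
  have xn: "x \<bullet> outer_normal ?E x = 1 / norm (?S x)"
    using outer_normal_props(2)[OF sm x] h by simp
  have "det (matrix (hom_gauss' ?E x)) = gauss_curvature ?E x / (1 / norm (?S x))"
    using det_hom_gauss'[OF sm x0] by (simp add: gauge_ellipsoid[OF AB] x1 xn)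
  then have "gauss_curvature ?E x = (1 / norm (?S x)) ^ CARD('n) / (det A)\<^sup>2 * (1 / norm (?S x))"
    using s0[OF x0] d by (simp add: field_simps)
  then show ?thesis by (simp add: h)
qed

lemma regular_body_ellipsoid: "regular_body (centered_ellipsoid A)"
  unfolding regular_body_def
proof (intro conjI ballI)
  show sm: "smooth_body (centered_ellipsoid A)" by (rule smooth_body_ellipsoid[OF AB])
  fix x assume x: "x \<in> frontier (centered_ellipsoid A)"
  have "det A * det B = 1" using AB(1) by (metis det_I det_mul)
  then have "det A \<noteq> 0" by auto
  moreover have "support_function (centered_ellipsoid A) (outer_normal (centered_ellipsoid A) x) > 0"
    using outer_normal_props(2)[OF sm x] outer_normal_inner_pos[OF sm x] by simp
  ultimately show "gauss_curvature (centered_ellipsoid A) x > 0"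
    by (simp add: gauss_curvature_ellipsoid[OF x])
qed

lemma curvature_function_ellipsoid:
  assumes "norm u = 1"
  shows "curvature_function (centered_ellipsoid A) u * support_function (centered_ellipsoid A) u ^ (CARD('n) + 1) = (det A)\<^sup>2"
proof -
  let ?E = "centered_ellipsoid A"
  obtain x where x: "x \<in> frontier ?E" "outer_normal ?E x = u"
    using frontier_normal_exists[OF smooth_body_ellipsoid[OF AB] assms] by blast
  have "support_function ?E u > 0"
    using assms by (intro support_pos[OF origin_body_ellipsoid[OF AB]]) force
  then show ?thesis
    using curvature_function_normal[OF regular_body_ellipsoid x(1)] gauss_curvature_ellipsoid[OF x(1)] x(2) by simp
qed

end

lemma symmetric_ellipsoid_centered:
  fixes E :: "(real ^ 'n::finite) set"
  assumes "ellipsoid E" "origin_symmetric E"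
  shows "\<exists>A B. A ** B = mat 1 \<and> B ** A = mat 1 \<and> E = centered_ellipsoid A"
proof -
  obtain A :: "real ^ 'n ^ 'n" and a where A: "invertible A" and E: "E = (\<lambda>x. a + A *v x) ` cball 0 1"
    using assms(1) unfolding ellipsoid_def by blast
  then obtain B where B: "A ** B = mat 1" "B ** A = mat 1" by (auto simp: invertible_def)
  have memE: "y \<in> E \<longleftrightarrow> norm (B *v (y - a)) \<le> 1" for y
  proof
    assume "norm (B *v (y - a)) \<le> 1"
    then show "y \<in> E" unfolding E
      by (intro image_eqI[of _ _ "B *v (y - a)"]) (auto simp: mv_inverse[OF B])
  qed (auto simp: E mv_inverse[OF B])
  have "a = 0"
  proof (rule ccontr)
    assume "a \<noteq> 0"
    define c where "c = B *v a"
    have c0: "norm c > 0" using \<open>a \<noteq> 0\<close> by (simp add: c_def mv_eq_0_iff[OF B])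
    \<comment> \<open>The point of \<open>E\<close> farthest out in the direction of the center
      \<open>a\<close>. In the norm \<open>norm (B *v x)\<close> its reflection has distance
      \<open>2 * norm c + 1\<close> from the center, so it lies outside \<open>E\<close>.\<close>
    define y where "y = a + A *v (c /\<^sub>R norm c)"
    have Ac: "A *v c = a" by (simp add: c_def mv_inverse[OF B])
    have yE: "y \<in> E" using c0 by (simp add: memE y_def mv_inverse[OF B])
    have "y = (1 + inverse (norm c)) *\<^sub>R a" by (simp add: y_def matrix_vector_mult_scaleR Ac algebra_simps)
    then have "- y - a = - (2 + inverse (norm c)) *\<^sub>R a" by (simp add: algebra_simps scaleR_2)
    then have "B *v (- y - a) = - (2 + inverse (norm c)) *\<^sub>R c"
      by (simp only: matrix_vector_mult_scaleR c_def)
    moreover have "2 + inverse (norm c) > 0" using c0 by (simp add: add_pos_pos)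
    ultimately have "norm (B *v (- y - a)) = (2 + inverse (norm c)) * norm c"
      by (simp only: norm_scaleR abs_minus_cancel abs_of_pos)
    also have "\<dots> = 2 * norm c + 1" using c0 by (simp add: algebra_simps)
    finally have "- y \<notin> E" using c0 by (simp add: memE)
    moreover have "- y \<in> E" using assms(2) yE by (auto simp: origin_symmetric_def)
    ultimately show False by blast
  qed
  then show ?thesis using B E by (auto simp: centered_ellipsoid_def)
qed

section \<open>The Prekopa--Leindler inequality\<close>

text \<open>\<open>A\<close> may be unbounded or may miss its supremum, so there need not be a last
  point at which to cut. A point of \<open>A\<close> beyond almost all of its measure is enough for
  the one-dimensional Brunn--Minkowski inequality.\<close>

lemma emeasure_initial_segment:
  fixes A :: "real set"
  assumes A[measurable]: "A \<in> sets borel" and ne: "A \<noteq> {}" and c: "c < emeasure lborel A"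
  shows "\<exists>a\<in>A. c < emeasure lborel (A \<inter> {..a})"
proof -
  \<comment> \<open>An increasing sequence of cuts, each passed by some element of \<open>A\<close>.
    Together they cover \<open>A\<close> except possibly the null set
    \<open>{Sup A}\<close>.\<close>
  define t :: "nat \<Rightarrow> real" where "t n = (if bdd_above A then Sup A - 1 / (n + 1) else n)" for n
  have inc: "incseq (\<lambda>n. A \<inter> {..t n})"
  proof (rule incseq_SucI, rule Int_mono[OF order_refl])
    fix n :: nat
    have "1 / (real (Suc n) + 1) \<le> 1 / (real n + 1)" by (rule frac_le) auto
    then show "{..t n} \<subseteq> {..t (Suc n)}" by (auto simp: t_def)
  qed
  have cof: "\<exists>a\<in>A. t n \<le> a" for n
  proof (cases "bdd_above A")
    case True
    have "t n < Sup A" by (simp add: t_def True)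
    then show ?thesis using less_cSup_iff[OF ne True] less_imp_le by blast
  next
    case False
    then obtain x where "x \<in> A" "real n < x" unfolding bdd_above_def by (metis not_le)
    then show ?thesis using False by (auto simp: t_def intro!: bexI[of _ x])
  qed
  have sub: "A - {Sup A} \<subseteq> (\<Union>n. A \<inter> {..t n})"
  proof
    fix x assume x: "x \<in> A - {Sup A}"
    have "\<exists>n. x \<le> t n"
    proof (cases "bdd_above A")
      case True
      then have "Sup A - x > 0" using x cSup_upper[of x A] by force
      then obtain n where "1 / (real n + 1) < Sup A - x"
        using reals_Archimedean[of "Sup A - x"] by (auto simp: inverse_eq_divide add.commute)
      then show ?thesis using True by (auto simp: t_def intro!: exI[of _ n])
    next
      case False
      then show ?thesis using real_arch_simple[of x] by (simp add: t_def)
    qed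
    then show "x \<in> (\<Union>n. A \<inter> {..t n})" using x by auto
  qed
  have "emeasure lborel A = emeasure lborel (A - {Sup A})"
    by (rule emeasure_Diff_null_set[symmetric]) auto
  also have "\<dots> \<le> emeasure lborel (\<Union>n. A \<inter> {..t n})" by (rule emeasure_mono[OF sub]) auto
  also have "\<dots> = (SUP n. emeasure lborel (A \<inter> {..t n}))"
    by (rule SUP_emeasure_incseq[symmetric]) (auto simp: inc)
  finally have "c < (SUP n. emeasure lborel (A \<inter> {..t n}))" using c by simp
  then obtain n where n: "c < emeasure lborel (A \<inter> {..t n})" by (auto simp: less_SUP_iff)
  obtain a where a: "a \<in> A" "t n \<le> a" using cof by blast
  have "emeasure lborel (A \<inter> {..t n}) \<le> emeasure lborel (A \<inter> {..a})"
    using a by (intro emeasure_mono) auto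
  then show ?thesis using a n by (intro bexI[of _ a]) auto
qed

lemma emeasure_final_segment:
  fixes A :: "real set"
  assumes A[measurable]: "A \<in> sets borel" and ne: "A \<noteq> {}" and c: "c < emeasure lborel A"
  shows "\<exists>a\<in>A. c < emeasure lborel (A \<inter> {a..})"
proof -
  have refl: "emeasure lborel (uminus -` X) = emeasure lborel X" if [measurable]: "X \<in> sets borel" for X :: "real set"
    using arg_cong[OF lborel_distr_uminus, of "\<lambda>M. emeasure M X"] by (simp add: emeasure_distr)
  have "uminus -` A \<in> sets (borel :: real measure)" using measurable_sets[of uminus borel borel A] by simp
  moreover have "uminus -` A \<noteq> {}" using ne by (metis all_not_in_conv minus_minus vimageI)
  ultimately obtain a where a: "- a \<in> A" "c < emeasure lborel (uminus -` A \<inter> {..a})"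
    using emeasure_initial_segment[of "uminus -` A" c] c by (auto simp: refl)
  have "uminus -` A \<inter> {..a} = uminus -` (A \<inter> {-a..})" by auto
  then have "c < emeasure lborel (A \<inter> {-a..})" using a(2) refl[of "A \<inter> {-a..}"] by simp
  then show ?thesis using a(1) by blast
qed

text \<open>Averaging the part of \<open>A\<close> below \<open>a\<close> with \<open>b\<close>
  lands in \<open>L\<close> to the left of the midpoint of \<open>a\<close> and \<open>b\<close>;
  averaging the part of \<open>B\<close> above \<open>b\<close> with \<open>a\<close> lands to the
  right. Each averaging halves lengths and the images share at most one point, so the measures add
  up. Finally \<open>a\<close> and \<open>b\<close> are pushed to the ends of their sets.\<close>

lemma brunn_minkowski_midpoint:
  fixes A B L :: "real set"
  assumes [measurable]: "A \<in> sets borel" "B \<in> sets borel" "L \<in> sets borel"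
    and ne: "A \<noteq> {}" "B \<noteq> {}" and mid: "\<And>a b. a \<in> A \<Longrightarrow> b \<in> B \<Longrightarrow> (a + b) / 2 \<in> L"
  shows "emeasure lborel A + emeasure lborel B \<le> 2 * emeasure lborel L"
proof -
  have half: "emeasure lborel {x. (c + x) / 2 \<in> X} = 2 * emeasure lborel X" if [measurable]: "X \<in> sets borel" for X :: "real set" and c
  proof -
    have "emeasure lborel {x. (c + x) / 2 \<in> X} = (\<integral>\<^sup>+x. indicator X ((c + x) / 2) \<partial>lborel)"
    proof -
      have "emeasure lborel {x. (c + x) / 2 \<in> X} = (\<integral>\<^sup>+x. indicator {x. (c + x) / 2 \<in> X} x \<partial>lborel)"
        by (rule nn_integral_indicator[symmetric]) simp
      then show ?thesis by (simp add: indicator_def)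
    qed
    also have "\<dots> = ennreal 2 * (\<integral>\<^sup>+x. indicator X x \<partial>lborel)"
      by (subst nn_integral_real_affine[where c = 2 and t = "-c"]) (auto simp: algebra_simps add_divide_distrib)
    finally show ?thesis by simp
  qed
  have seg: "emeasure lborel (A \<inter> {..a}) + emeasure lborel (B \<inter> {b..}) \<le> 2 * emeasure lborel L"
    if a: "a \<in> A" and b: "b \<in> B" for a b
  proof -
    let ?m = "(a + b) / 2"
    have "emeasure lborel (A \<inter> {..a}) \<le> emeasure lborel {x. (b + x) / 2 \<in> L \<inter> {..?m}}"
      using mid b by (intro emeasure_mono) (auto simp: add.commute)
    moreover have "emeasure lborel (B \<inter> {b..}) \<le> emeasure lborel {x. (a + x) / 2 \<in> L \<inter> {?m..}}"
      using mid a by (intro emeasure_mono) auto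
    ultimately have "emeasure lborel (A \<inter> {..a}) + emeasure lborel (B \<inter> {b..})
        \<le> 2 * emeasure lborel (L \<inter> {..?m}) + 2 * emeasure lborel (L \<inter> {?m..})"
      by (subst (asm) half, simp, subst (asm) half, simp) (rule add_mono)
    also have "emeasure lborel (L \<inter> {?m..}) = emeasure lborel (L \<inter> {?m<..})"
      by (rule emeasure_eq_AE) (use AE_lborel_singleton[of ?m] in \<open>auto elim!: eventually_mono\<close>)
    also have "2 * emeasure lborel (L \<inter> {..?m}) + 2 * emeasure lborel (L \<inter> {?m<..}) = 2 * emeasure lborel ((L \<inter> {..?m}) \<union> (L \<inter> {?m<..}))"
      by (subst plus_emeasure[symmetric]) (auto simp: distrib_left)
    also have "(L \<inter> {..?m}) \<union> (L \<inter> {?m<..}) = L" by auto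
    finally show ?thesis .
  qed
  have eqA: "emeasure lborel A = (SUP a\<in>A. emeasure lborel (A \<inter> {..a}))"
    by (intro antisym SUP_least emeasure_mono) (auto simp: le_SUP_iff intro!: emeasure_initial_segment ne)
  have eqB: "emeasure lborel B = (SUP b\<in>B. emeasure lborel (B \<inter> {b..}))"
    by (intro antisym SUP_least emeasure_mono) (auto simp: le_SUP_iff intro!: emeasure_final_segment ne)
  have "emeasure lborel A + emeasure lborel (B \<inter> {b..}) \<le> 2 * emeasure lborel L" if "b \<in> B" for b
    unfolding eqA ennreal_SUP_add_left[OF ne(1), symmetric] by (intro SUP_least seg that)
  then show ?thesis
    by (simp add: eqB ennreal_SUP_add_right[OF ne(2)] SUP_le_iff)
qed

text \<open>The layer-cake formula cut off at level 1. For a function with supremum 1 these are the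
  levels whose superlevel sets are non-empty, as the Brunn--Minkowski step demands.\<close>

lemma nn_integral_layers:
  fixes F :: "real \<Rightarrow> ennreal"
  assumes [measurable]: "F \<in> borel_measurable borel"
  shows "(\<integral>\<^sup>+x. min 1 (F x) \<partial>lborel) = (\<integral>\<^sup>+\<tau>. indicator {0..<1} \<tau> * emeasure lborel {x. ennreal \<tau> < F x} \<partial>lborel)"
proof -
  have "min 1 (F x) = (\<integral>\<^sup>+\<tau>. indicator {0..<1} \<tau> * indicator {x. ennreal \<tau> < F x} x \<partial>lborel)" for x
  proof -
    define m where "m = enn2real (min 1 (F x))"
    have m: "0 \<le> m" "ennreal m = min 1 (F x)"
      by (auto simp: m_def min_def less_top[symmetric] ennreal_enn2real_if top_unique)
    have "indicator {0..<1} \<tau> * indicator {x. ennreal \<tau> < F x} x = (indicator {0..<m} \<tau> :: ennreal)" for \<tau> :: real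
    proof (cases "\<tau> \<ge> 0")
      case True
      have "\<tau> < m \<longleftrightarrow> ennreal \<tau> < min 1 (F x)" using True by (simp add: m(2)[symmetric] ennreal_less_iff)
      then show ?thesis using True by (auto simp: indicator_def ennreal_less_one_iff)
    qed simp
    then show ?thesis using m by simp
  qed
  then have "(\<integral>\<^sup>+x. min 1 (F x) \<partial>lborel) = (\<integral>\<^sup>+x. \<integral>\<^sup>+\<tau>. indicator {0..<1} \<tau> * indicator {x. ennreal \<tau> < F x} x \<partial>lborel \<partial>lborel)"
    by simp
  also have "\<dots> = (\<integral>\<^sup>+\<tau>. \<integral>\<^sup>+x. indicator {0..<1} \<tau> * indicator {x. ennreal \<tau> < F x} x \<partial>lborel \<partial>lborel)"
    by (intro lborel_pair.Fubini') measurable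
  also have "\<dots> = (\<integral>\<^sup>+\<tau>. indicator {0..<1} \<tau> * emeasure lborel {x. ennreal \<tau> < F x} \<partial>lborel)"
    by (intro nn_integral_cong) (simp add: nn_integral_cmult)
  finally show ?thesis .
qed

lemma ennreal_arith_geo:
  fixes a b c :: ennreal
  assumes "a + b \<le> 2 * c" shows "a * b \<le> c\<^sup>2"
proof (cases c)
  case (real z)
  have "2 * c < top" using real by (simp add: ennreal_mult_less_top)
  then have "a + b < top" using assms by (rule le_less_trans[rotated])
  then have fin: "a < top" "b < top" by simp_all
  obtain x y where xy: "a = ennreal x" "b = ennreal y" "0 \<le> x" "0 \<le> y"
    by (rule that[of "enn2real a" "enn2real b"]) (use fin in simp_all)
  have "ennreal (x + y) \<le> ennreal (2 * z)" using assms real xy by (simp add: ennreal_mult)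
  then have "x + y \<le> 2 * z" using real by (simp add: ennreal_le_iff)
  moreover have "4 * (x * y) \<le> (x + y)\<^sup>2" using sum_squares_ge_zero[of "x - y" 0] by (simp add: power2_eq_square algebra_simps)
  ultimately have "4 * (x * y) \<le> (2 * z)\<^sup>2" using xy by (meson add_nonneg_nonneg order_trans power_mono)
  then have "x * y \<le> z\<^sup>2" by simp
  then show ?thesis using xy real by (simp add: ennreal_mult[symmetric] ennreal_power ennreal_leI)
qed simp

text \<open>Equal suprema allow superlevel sets of \<open>F\<close>, \<open>G\<close> and
  \<open>H\<close> to be compared at one common level. Integrating the Brunn--Minkowski inequality
  over the levels bounds the arithmetic mean of the integrals, which dominates the geometric
  mean.\<close>

lemma prekopa_leindler_normalized:
  fixes F G H :: "real \<Rightarrow> ennreal"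
  assumes [measurable]: "F \<in> borel_measurable borel" "G \<in> borel_measurable borel" "H \<in> borel_measurable borel"
    and sup: "(SUP x. F x) = 1" "(SUP x. G x) = 1"
    and le: "\<And>a b. F a * G b \<le> (H ((a + b) / 2))\<^sup>2"
  shows "(\<integral>\<^sup>+x. F x \<partial>lborel) * (\<integral>\<^sup>+x. G x \<partial>lborel) \<le> (\<integral>\<^sup>+x. H x \<partial>lborel)\<^sup>2"
proof (rule ennreal_arith_geo)
  have "F x \<le> 1" "G x \<le> 1" for x using sup by (metis SUP_upper UNIV_I)+
  then have F: "(\<lambda>x. min 1 (F x)) = F" "(\<lambda>x. min 1 (G x)) = G" by (auto simp: min_def fun_eq_iff antisym)
  have *: "indicator {0..<1} \<tau> * emeasure lborel {x. ennreal \<tau> < F x} + indicator {0..<1} \<tau> * emeasure lborel {x. ennreal \<tau> < G x}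
      \<le> 2 * (indicator {0..<1} \<tau> * emeasure lborel {x. ennreal \<tau> < H x})" for \<tau>
  proof (cases "\<tau> \<in> {0..<1}")
    case True
    then have \<tau>: "ennreal \<tau> < 1" by (simp add: ennreal_less_one_iff)
    have "emeasure lborel {x. ennreal \<tau> < F x} + emeasure lborel {x. ennreal \<tau> < G x} \<le> 2 * emeasure lborel {x. ennreal \<tau> < H x}"
    proof (rule brunn_minkowski_midpoint)
      show "{x. ennreal \<tau> < F x} \<noteq> {}" "{x. ennreal \<tau> < G x} \<noteq> {}"
        using \<tau> sup less_SUP_iff[of "ennreal \<tau>" F UNIV] less_SUP_iff[of "ennreal \<tau>" G UNIV] by auto
      fix a b assume ab: "a \<in> {x. ennreal \<tau> < F x}" "b \<in> {x. ennreal \<tau> < G x}"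
      show "(a + b) / 2 \<in> {x. ennreal \<tau> < H x}"
      proof (rule ccontr)
        assume "\<not> ?thesis"
        then have "H ((a + b) / 2) \<le> ennreal \<tau>" by (simp add: not_less)
        then have "(H ((a + b) / 2))\<^sup>2 \<le> ennreal \<tau> * ennreal \<tau>" by (simp add: power2_eq_square mult_mono)
        also have "\<dots> < F a * G b" 
        proof -
          have fin: "F a < top" "G b < top" using \<open>F a \<le> 1\<close> \<open>G b \<le> 1\<close> by (auto intro: le_less_trans)
          obtain x y where xy: "F a = ennreal x" "G b = ennreal y" "0 \<le> x" "0 \<le> y"
            by (rule that[of "enn2real (F a)" "enn2real (G b)"]) (use fin in simp_all)
          have "\<tau> < x" "\<tau> < y" using ab xy True by (auto simp: ennreal_less_iff)
          then have "\<tau> * \<tau> < x * y" using True by (intro mult_strict_mono) auto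
          then show ?thesis using xy True by (simp add: ennreal_mult[symmetric] ennreal_lessI ennreal_less_iff)
        qed
        finally show False using le[of a b] by simp
      qed
    qed measurable
    then show ?thesis using True by simp
  qed simp
  have "(\<integral>\<^sup>+x. F x \<partial>lborel) + (\<integral>\<^sup>+x. G x \<partial>lborel) =
      (\<integral>\<^sup>+\<tau>. indicator {0..<1} \<tau> * emeasure lborel {x. ennreal \<tau> < F x} + indicator {0..<1} \<tau> * emeasure lborel {x. ennreal \<tau> < G x} \<partial>lborel)"
    using nn_integral_layers[of F] nn_integral_layers[of G] unfolding F
    by (subst nn_integral_add) simp_all
  also have "\<dots> \<le> (\<integral>\<^sup>+\<tau>. 2 * (indicator {0..<1} \<tau> * emeasure lborel {x. ennreal \<tau> < H x}) \<partial>lborel)"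
    by (intro nn_integral_mono *)
  also have "\<dots> = 2 * (\<integral>\<^sup>+x. min 1 (H x) \<partial>lborel)"
    by (simp add: nn_integral_cmult nn_integral_layers)
  also have "\<dots> \<le> 2 * (\<integral>\<^sup>+x. H x \<partial>lborel)" by (intro mult_left_mono nn_integral_mono) auto
  finally show "(\<integral>\<^sup>+x. F x \<partial>lborel) + (\<integral>\<^sup>+x. G x \<partial>lborel) \<le> 2 * (\<integral>\<^sup>+x. H x \<partial>lborel)" .
qed

lemma prekopa_leindler_bounded:
  fixes F G H :: "real \<Rightarrow> ennreal"
  assumes [measurable]: "F \<in> borel_measurable borel" "G \<in> borel_measurable borel" "H \<in> borel_measurable borel"
    and bdd: "\<And>x. F x \<le> ennreal k" "\<And>x. G x \<le> ennreal l"
    and le: "\<And>a b. F a * G b \<le> (H ((a + b) / 2))\<^sup>2"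
  shows "(\<integral>\<^sup>+x. F x \<partial>lborel) * (\<integral>\<^sup>+x. G x \<partial>lborel) \<le> (\<integral>\<^sup>+x. H x \<partial>lborel)\<^sup>2"
proof (cases "(SUP x. F x) = 0 \<or> (SUP x. G x) = 0")
  case True
  then have "(\<forall>x. F x = 0) \<or> (\<forall>x. G x = 0)" by (auto simp: SUP_eq_iff bot_ennreal)
  then show ?thesis by auto
next
  case False
  have "(SUP x. F x) < top" "(SUP x. G x) < top"
    using SUP_least[of UNIV F "ennreal k"] SUP_least[of UNIV G "ennreal l"] bdd by (auto intro: le_less_trans)
  then obtain s t where st: "(SUP x. F x) = ennreal s" "(SUP x. G x) = ennreal t" "s \<ge> 0" "t \<ge> 0"
    by (metis enn2real_nonneg ennreal_enn2real)
  then have pos: "s > 0" "t > 0" using False by (auto simp: order_less_le)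
  \<comment> \<open>Dividing \<open>F\<close> by \<open>s\<close> and \<open>G\<close> by
    \<open>t\<close> forces \<open>H\<close> to be divided by the geometric mean of \<open>s\<close>
    and \<open>t\<close> for the hypothesis to persist.\<close>
  define q where "q = sqrt (s * t)"
  have q: "q > 0" "q * q = s * t" using pos by (auto simp: q_def)
  have st': "ennreal (1 / (s * t)) = ennreal (1 / s) * ennreal (1 / t)"
    using pos by (simp add: ennreal_mult[symmetric])
  have qq: "ennreal (1 / (s * t)) = (ennreal (1 / q))\<^sup>2"
    using q(1) unfolding q(2)[symmetric] by (simp add: ennreal_power power_divide power2_eq_square ennreal_mult[symmetric])
  have inv: "ennreal (1 / a) * ennreal a = 1" if "a > 0" for a
    using that by (simp add: ennreal_mult[symmetric])
  have "(\<integral>\<^sup>+x. ennreal (1 / s) * F x \<partial>lborel) * (\<integral>\<^sup>+x. ennreal (1 / t) * G x \<partial>lborel) \<le> (\<integral>\<^sup>+x. ennreal (1 / q) * H x \<partial>lborel)\<^sup>2"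
  proof (rule prekopa_leindler_normalized)
    show "(SUP x. ennreal (1 / s) * F x) = 1" "(SUP x. ennreal (1 / t) * G x) = 1"
      using pos inv by (simp_all add: SUP_mult_left_ennreal[symmetric] st)
    fix a b
    have "ennreal (1 / s) * F a * (ennreal (1 / t) * G b) = ennreal (1 / (s * t)) * (F a * G b)"
      by (simp add: st' mult_ac)
    also have "\<dots> \<le> ennreal (1 / (s * t)) * (H ((a + b) / 2))\<^sup>2" by (intro mult_left_mono le) simp
    also have "\<dots> = (ennreal (1 / q) * H ((a + b) / 2))\<^sup>2"
      by (simp add: qq power_mult_distrib)
    finally show "ennreal (1 / s) * F a * (ennreal (1 / t) * G b) \<le> (ennreal (1 / q) * H ((a + b) / 2))\<^sup>2" .
  qed measurable
  then have *: "ennreal (1 / s) * (\<integral>\<^sup>+x. F x \<partial>lborel) * (ennreal (1 / t) * (\<integral>\<^sup>+x. G x \<partial>lborel)) \<le> (ennreal (1 / q) * (\<integral>\<^sup>+x. H x \<partial>lborel))\<^sup>2"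
    by (simp add: nn_integral_cmult)
  let ?P = "(\<integral>\<^sup>+x. F x \<partial>lborel) * (\<integral>\<^sup>+x. G x \<partial>lborel)" and ?Q = "(\<integral>\<^sup>+x. H x \<partial>lborel)\<^sup>2"
  have e1: "ennreal (1 / s) * (\<integral>\<^sup>+x. F x \<partial>lborel) * (ennreal (1 / t) * (\<integral>\<^sup>+x. G x \<partial>lborel)) = ennreal (1 / (s * t)) * ?P"
    by (simp add: st' mult_ac)
  have e2: "(ennreal (1 / q) * (\<integral>\<^sup>+x. H x \<partial>lborel))\<^sup>2 = ennreal (1 / (s * t)) * ?Q"
    by (simp add: qq power_mult_distrib)
  have "ennreal (s * t) * (ennreal (1 / (s * t)) * ?P) \<le> ennreal (s * t) * (ennreal (1 / (s * t)) * ?Q)"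
    using * unfolding e1 e2 by (rule mult_left_mono) simp
  then show ?thesis using inv[of "s * t"] pos by (simp add: mult.assoc[symmetric] mult.commute[of "ennreal (s * t)"])
qed

lemma nn_integral_SUP_truncation:
  fixes F :: "'a \<Rightarrow> ennreal"
  assumes [measurable]: "F \<in> borel_measurable M"
  shows "(\<integral>\<^sup>+x. F x \<partial>M) = (SUP k::nat. \<integral>\<^sup>+x. min (F x) (of_nat k) \<partial>M)"
proof -
  have "F x = (SUP k::nat. min (F x) (of_nat k))" for x
    by (simp add: inf_min[symmetric] inf_SUP[symmetric] ennreal_SUP_of_nat_eq_top)
  then have "(\<integral>\<^sup>+x. F x \<partial>M) = (\<integral>\<^sup>+x. (SUP k::nat. min (F x) (of_nat k)) \<partial>M)" by simp
  also have "\<dots> = (SUP k::nat. \<integral>\<^sup>+x. min (F x) (of_nat k) \<partial>M)"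
    by (rule nn_integral_monotone_convergence_SUP)
       (auto simp: incseq_def le_fun_def min_def intro: order_trans)
  finally show ?thesis .
qed

theorem prekopa_leindler:
  fixes F G H :: "real \<Rightarrow> ennreal"
  assumes [measurable]: "F \<in> borel_measurable borel" "G \<in> borel_measurable borel" "H \<in> borel_measurable borel"
    and le: "\<And>a b. F a * G b \<le> (H ((a + b) / 2))\<^sup>2"
  shows "(\<integral>\<^sup>+x. F x \<partial>lborel) * (\<integral>\<^sup>+x. G x \<partial>lborel) \<le> (\<integral>\<^sup>+x. H x \<partial>lborel)\<^sup>2"
proof -
  have "(\<integral>\<^sup>+x. min (F x) (of_nat k) \<partial>lborel) * (\<integral>\<^sup>+x. min (G x) (of_nat l) \<partial>lborel) \<le> (\<integral>\<^sup>+x. H x \<partial>lborel)\<^sup>2" for k l :: nat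
  proof (rule prekopa_leindler_bounded[of _ _ _ "real k" "real l"])
    fix a b
    have "min (F a) (of_nat k) * min (G b) (of_nat l) \<le> F a * G b" by (intro mult_mono) auto
    then show "min (F a) (of_nat k) * min (G b) (of_nat l) \<le> (H ((a + b) / 2))\<^sup>2" using le order_trans by blast
  qed (auto simp: ennreal_of_nat_eq_real_of_nat)
  moreover have "F \<in> borel_measurable lborel" "G \<in> borel_measurable lborel" by simp_all
  ultimately show ?thesis
    unfolding nn_integral_SUP_truncation[OF \<open>F \<in> borel_measurable lborel\<close>]
      nn_integral_SUP_truncation[OF \<open>G \<in> borel_measurable lborel\<close>]
    by (simp only: SUP_mult_left_ennreal SUP_mult_right_ennreal SUP_le_iff) blast
qed

section \<open>The Santalo inequality on the half-line\<close>

lemma nn_integral_exp_substitution: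
  fixes f :: "real \<Rightarrow> ennreal"
  assumes [measurable]: "f \<in> borel_measurable borel"
  shows "(\<integral>\<^sup>+s. f s * indicator {0<..} s \<partial>lborel) = (\<integral>\<^sup>+a. f (exp a) * ennreal (exp a) \<partial>lborel)"
proof -
  have *: "(\<integral>\<^sup>+s. f s * indicator {exp (- real k)..exp (real k)} s \<partial>lborel) = (\<integral>\<^sup>+a. f (exp a) * ennreal (exp a) * indicator {- real k..real k} a \<partial>lborel)" for k :: nat
  proof (cases "k = 0")
    \<comment> \<open>Both intervals are single points here, outside the scope of the substitution
      rule, and both integrals vanish.\<close>
    case True
    have h1: "AE s in lborel. f s * indicator {exp (- real k)..exp (real k)} s = 0"
      using AE_lborel_singleton[of "1 :: real"] by eventually_elim (simp add: True)
    have h2: "AE a in lborel. f (exp a) * ennreal (exp a) * indicator {- real k..real k} a = 0"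
      using AE_lborel_singleton[of "0 :: real"] by eventually_elim (simp add: True)
    show ?thesis unfolding nn_integral_cong_AE[OF h1] nn_integral_cong_AE[OF h2] by simp
  next
    case False
    then show ?thesis
      by (intro nn_integral_substitution_aux) (auto intro!: derivative_eq_intros continuous_intros)
  qed
  have inc: "incseq (\<lambda>k s. f s * indicator {exp (- real k)..exp (real k)} s)"
    by (auto simp: incseq_def le_fun_def indicator_def) (meson exp_le_cancel_iff neg_le_iff_le of_nat_mono order_trans)+
  have inc': "incseq (\<lambda>k a. f (exp a) * ennreal (exp a) * indicator {- real k..real k} a)"
    by (auto simp: incseq_def le_fun_def indicator_def)
  have "(SUP k. f s * indicator {exp (- real k)..exp (real k)} s) = f s * indicator {0<..} s" for s
  proof -
    have "(SUP k::nat. indicator {exp (- real k)..exp (real k)} s :: ennreal) = indicator {0<..} s"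
    proof (cases "s > 0")
      case True
      obtain k :: nat where k: "real k \<ge> \<bar>ln s\<bar>" using real_arch_simple by blast
      then have "s \<le> exp (real k)" "exp (- real k) \<le> s"
        using True by (metis abs_le_iff exp_le_cancel_iff exp_ln, metis abs_le_iff exp_le_cancel_iff exp_ln minus_le_iff)
      then have "(1::ennreal) \<le> (SUP k::nat. indicator {exp (- real k)..exp (real k)} s)"
        by (intro SUP_upper2[of k]) auto
      then show ?thesis using True by (intro antisym SUP_least) (auto simp: indicator_def)
    next
      case False
      then have "indicator {exp (- real k)..exp (real k)} s = (0::ennreal)" for k :: nat
        by (auto simp: indicator_def) (meson exp_gt_zero less_le_trans)
      then show ?thesis using False by simp
    qed
    then show ?thesis by (simp only: SUP_mult_left_ennreal[symmetric])
  qed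
  moreover have "(SUP k::nat. f (exp a) * ennreal (exp a) * indicator {- real k..real k} a) = f (exp a) * ennreal (exp a)" for a
  proof -
    obtain k :: nat where k: "real k \<ge> \<bar>a\<bar>" using real_arch_simple by blast
    have "(SUP k::nat. indicator {- real k..real k} a :: ennreal) = 1"
      by (intro antisym SUP_least SUP_upper2[of k]) (use k in \<open>auto simp: indicator_def\<close>)
    then show ?thesis by (simp only: SUP_mult_left_ennreal[symmetric]) simp
  qed
  ultimately have "(\<integral>\<^sup>+s. f s * indicator {0<..} s \<partial>lborel) = (\<integral>\<^sup>+s. (SUP k. f s * indicator {exp (- real k)..exp (real k)} s) \<partial>lborel)"
    "(\<integral>\<^sup>+a. f (exp a) * ennreal (exp a) \<partial>lborel) = (\<integral>\<^sup>+a. (SUP k::nat. f (exp a) * ennreal (exp a) * indicator {- real k..real k} a) \<partial>lborel)"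
    by simp_all
  then show ?thesis
    by (simp add: nn_integral_monotone_convergence_SUP[OF inc] nn_integral_monotone_convergence_SUP[OF inc'] *)
qed

definition half_gauss :: ennreal where
  "half_gauss = (\<integral>\<^sup>+u. ennreal (exp (- (u\<^sup>2 / 2))) * indicator {0<..} u \<partial>lborel)"

text \<open>The substitution \<open>s = exp a\<close>, \<open>t = exp b\<close> turns the geometric
  mean of \<open>s\<close> and \<open>t\<close> into the midpoint of \<open>a\<close> and
  \<open>b\<close>. With the Jacobians included, the bound on \<open>f s * g t\<close> is exactly
  the square of \<open>?H\<close> at that midpoint, so Prekopa--Leindler applies.\<close>

lemma santalo_half_line:
  fixes f g :: "real \<Rightarrow> ennreal"
  assumes [measurable]: "f \<in> borel_measurable borel" "g \<in> borel_measurable borel" and c: "c \<ge> 0"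
    and le: "\<And>s t. s > 0 \<Longrightarrow> t > 0 \<Longrightarrow> f s * g t \<le> ennreal (c * exp (- s * t))"
  shows "(\<integral>\<^sup>+s. f s * indicator {0<..} s \<partial>lborel) * (\<integral>\<^sup>+t. g t * indicator {0<..} t \<partial>lborel) \<le> ennreal c * half_gauss\<^sup>2"
proof -
  let ?H = "\<lambda>m. ennreal (sqrt c) * (ennreal (exp (- ((exp m)\<^sup>2 / 2))) * ennreal (exp m))"
  have "(\<integral>\<^sup>+a. f (exp a) * ennreal (exp a) \<partial>lborel) * (\<integral>\<^sup>+b. g (exp b) * ennreal (exp b) \<partial>lborel) \<le> (\<integral>\<^sup>+m. ?H m \<partial>lborel)\<^sup>2"
  proof (rule prekopa_leindler)
    fix a b :: real
    have "f (exp a) * ennreal (exp a) * (g (exp b) * ennreal (exp b)) = (f (exp a) * g (exp b)) * ennreal (exp (a + b))"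
      by (simp add: ennreal_mult exp_add mult_ac)
    also have "\<dots> \<le> ennreal (c * exp (- exp a * exp b)) * ennreal (exp (a + b))"
      by (intro mult_right_mono le) auto
    also have "\<dots> = (?H ((a + b) / 2))\<^sup>2"
    proof -
      have e: "(exp ((a + b) / 2))\<^sup>2 = exp (a + b)" by (simp add: power2_eq_square exp_add[symmetric])
      have e2: "(exp (- ((exp ((a + b) / 2))\<^sup>2 / 2)))\<^sup>2 = exp (- exp a * exp b)"
        unfolding e by (simp add: power2_eq_square exp_add[symmetric])
      have "(?H ((a + b) / 2))\<^sup>2 = ennreal ((sqrt c)\<^sup>2 * ((exp (- ((exp ((a + b) / 2))\<^sup>2 / 2)))\<^sup>2 * (exp ((a + b) / 2))\<^sup>2))"
        using c by (simp add: ennreal_mult[symmetric] ennreal_power power_mult_distrib)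
      also have "\<dots> = ennreal (c * exp (- exp a * exp b)) * ennreal (exp (a + b))"
        unfolding e2 unfolding e using c by (simp add: ennreal_mult[symmetric] mult.assoc)
      finally show ?thesis by simp
    qed
    finally show "f (exp a) * ennreal (exp a) * (g (exp b) * ennreal (exp b)) \<le> (?H ((a + b) / 2))\<^sup>2" .
  qed measurable
  also have "(\<integral>\<^sup>+m. ?H m \<partial>lborel) = ennreal (sqrt c) * half_gauss"
    unfolding half_gauss_def by (subst nn_integral_exp_substitution) (simp_all add: nn_integral_cmult)
  also have "(ennreal (sqrt c) * half_gauss)\<^sup>2 = ennreal c * half_gauss\<^sup>2"
    using c by (simp add: power_mult_distrib ennreal_power)
  finally show ?thesis by (simp add: nn_integral_exp_substitution)
qed

section \<open>The functional Santalo inequality\<close>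

text \<open>Products over a finite index set replace \<open>real ^ 'n\<close> in this section, since
  the induction on the dimension has to vary the set of coordinates within one type.\<close>

abbreviation lebP :: "'i set \<Rightarrow> ('i \<Rightarrow> real) measure" where
  "lebP I \<equiv> Pi\<^sub>M I (\<lambda>_. lborel)"

interpretation lebP: product_sigma_finite "\<lambda>_ :: 'i. lborel :: real measure"
  by standard

definition ip :: "'i set \<Rightarrow> ('i \<Rightarrow> real) \<Rightarrow> ('i \<Rightarrow> real) \<Rightarrow> real" where
  "ip I x y = (\<Sum>i\<in>I. x i * y i)"

lemma measurable_ip [measurable (raw)]:
  assumes "\<And>i. i \<in> I \<Longrightarrow> (\<lambda>w. X w i) \<in> borel_measurable N" "\<And>i. i \<in> I \<Longrightarrow> (\<lambda>w. Y w i) \<in> borel_measurable N"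
  shows "(\<lambda>w. ip I (X w) (Y w)) \<in> borel_measurable N"
  unfolding ip_def using assms by measurable

lemma ip_commute: "ip I x y = ip I y x"
  by (simp add: ip_def mult.commute)

definition tame :: "'i set \<Rightarrow> (('i \<Rightarrow> real) \<Rightarrow> ennreal) \<Rightarrow> bool" where
  "tame I f \<longleftrightarrow> f \<in> borel_measurable (lebP I) \<and> (\<integral>\<^sup>+x. f x \<partial>lebP I) < \<infinity> \<and>
     (\<forall>i\<in>I. (\<integral>\<^sup>+x. ennreal \<bar>x i\<bar> * f x \<partial>lebP I) < \<infinity>)"

text \<open>As \<open>ennreal\<close> sends negative numbers to 0, the two integrals are the
  positive and negative parts of a first moment. Being finite and equal, they say that the
  barycenter is the origin.\<close>

definition centered :: "'i set \<Rightarrow> (('i \<Rightarrow> real) \<Rightarrow> ennreal) \<Rightarrow> bool" where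
  "centered I f \<longleftrightarrow> f \<in> borel_measurable (lebP I) \<and> (\<integral>\<^sup>+x. f x \<partial>lebP I) < \<infinity> \<and>
     (\<forall>i\<in>I. (\<integral>\<^sup>+x. ennreal (x i) * f x \<partial>lebP I) < \<infinity> \<and>
        (\<integral>\<^sup>+x. ennreal (x i) * f x \<partial>lebP I) = (\<integral>\<^sup>+x. ennreal (- x i) * f x \<partial>lebP I))"

definition polar_pair :: "'i set \<Rightarrow> real \<Rightarrow> (('i \<Rightarrow> real) \<Rightarrow> ennreal) \<Rightarrow> (('i \<Rightarrow> real) \<Rightarrow> ennreal) \<Rightarrow> bool" where
  "polar_pair I c f g \<longleftrightarrow> (\<forall>x\<in>space (lebP I). \<forall>y\<in>space (lebP I). f x * g y \<le> ennreal (c * exp (- ip I x y)))"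

text \<open>This is \<open>(2 * pi) ^ card I\<close>, but the value of \<open>half_gauss\<close> never matters.\<close>

definition santalo_const :: "'i set \<Rightarrow> ennreal" where
  "santalo_const I = (4 * half_gauss\<^sup>2) ^ card I"

text \<open>Moving the origin to \<open>z\<close> in the domain of \<open>f\<close> multiplies a polar partner \<open>g\<close> by
  \<open>exp (ip I z y)\<close>. The induction on the dimension requires that \<open>z\<close> depends on \<open>f\<close> only.\<close>

definition santalo_point :: "'i set \<Rightarrow> bool" where
  "santalo_point I \<longleftrightarrow> (\<forall>f. tame I f \<longrightarrow> (\<exists>z. \<forall>g\<in>borel_measurable (lebP I). polar_pair I 1 f g \<longrightarrow>
     (\<integral>\<^sup>+x. f x \<partial>lebP I) * (\<integral>\<^sup>+y. g y * ennreal (exp (ip I z y)) \<partial>lebP I) \<le> santalo_const I))"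

text \<open>Integrate \<open>1 + ip I z x \<le> exp (ip I z x)\<close> against \<open>f\<close>; the
  linear term vanishes because \<open>f\<close> is centered. This is what discards the weight
  appearing in \<open>santalo_point\<close>.\<close>

lemma centered_tilt:
  assumes fin: "finite I" and f: "centered I f"
  shows "(\<integral>\<^sup>+x. f x \<partial>lebP I) \<le> (\<integral>\<^sup>+x. f x * ennreal (exp (ip I z x)) \<partial>lebP I)"
proof -
  have [measurable]: "f \<in> borel_measurable (lebP I)" using f by (simp add: centered_def)
  let ?p = "\<lambda>i. \<integral>\<^sup>+x. ennreal (z i * x i) * f x \<partial>lebP I" and ?m = "\<lambda>i. \<integral>\<^sup>+x. ennreal (- (z i * x i)) * f x \<partial>lebP I"
  have pm: "?p i = ?m i \<and> ?p i < \<infinity>" if i: "i \<in> I" for i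
  proof -
    have fi: "(\<integral>\<^sup>+x. ennreal (- x i) * f x \<partial>lebP I) = (\<integral>\<^sup>+x. ennreal (x i) * f x \<partial>lebP I)"
      "(\<integral>\<^sup>+x. ennreal (x i) * f x \<partial>lebP I) < top"
      using f i by (auto simp: centered_def)
    have [measurable]: "(\<lambda>x. x i) \<in> borel_measurable (lebP I)" using i by measurable
    show ?thesis
  proof (cases "z i \<ge> 0")
    case True
    have "ennreal (z i * a) = ennreal (z i) * ennreal a" "ennreal (- (z i * a)) = ennreal (z i) * ennreal (- a)" for a
      using ennreal_mult'[OF True, of a] ennreal_mult'[OF True, of "- a"] by simp_all
    then show ?thesis
      by (simp add: mult.assoc nn_integral_cmult ennreal_mult_less_top fi)
  next
    case False
    have "ennreal (z i * a) = ennreal (- z i) * ennreal (- a)" "ennreal (- (z i * a)) = ennreal (- z i) * ennreal a" for a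
      using False ennreal_mult'[of "- z i" "- a"] ennreal_mult'[of "- z i" a] by simp_all
    then show ?thesis
      by (simp add: mult.assoc nn_integral_cmult ennreal_mult_less_top fi)
  qed
  qed
  \<comment> \<open>The inequality \<open>1 + t \<le> exp t\<close> with the negative parts of the
    linear term moved to the right, since subtraction in \<open>ennreal\<close> is truncated. They
    are cancelled after integration, where they are finite.\<close>
  have le: "1 + (\<Sum>i\<in>I. ennreal (z i * x i)) \<le> ennreal (exp (ip I z x)) + (\<Sum>i\<in>I. ennreal (- (z i * x i)))" for x :: "'a \<Rightarrow> real"
  proof -
    have e: "(\<Sum>i\<in>I. ennreal (a i)) = ennreal (\<Sum>i\<in>I. max 0 (a i))" for a :: "'a \<Rightarrow> real"
    proof -
      have "(\<Sum>i\<in>I. ennreal (a i)) = (\<Sum>i\<in>I. ennreal (max 0 (a i)))" by (simp only: ennreal_max_0)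
      also have "\<dots> = ennreal (\<Sum>i\<in>I. max 0 (a i))" by (rule sum_ennreal) simp
      finally show ?thesis .
    qed
    have "1 + (\<Sum>i\<in>I. max 0 (z i * x i)) \<le> exp (ip I z x) + (\<Sum>i\<in>I. max 0 (- (z i * x i)))"
    proof -
      have "(\<Sum>i\<in>I. max 0 (z i * x i)) = ip I z x + (\<Sum>i\<in>I. max 0 (- (z i * x i)))"
        unfolding ip_def sum.distrib[symmetric] by (intro sum.cong) auto
      then show ?thesis using exp_ge_add_one_self[of "ip I z x"] by linarith
    qed
    then have "ennreal (1 + (\<Sum>i\<in>I. max 0 (z i * x i))) \<le> ennreal (exp (ip I z x) + (\<Sum>i\<in>I. max 0 (- (z i * x i))))"
      by (rule ennreal_leI)
    moreover have "0 \<le> (\<Sum>i\<in>I. max 0 (z i * x i))" "0 \<le> (\<Sum>i\<in>I. max 0 (- (z i * x i)))"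
      by (simp_all add: sum_nonneg)
    ultimately show ?thesis by (simp only: e ennreal_1 ennreal_plus zero_le_one exp_ge_zero)
  qed
  have "(\<integral>\<^sup>+x. f x \<partial>lebP I) + (\<Sum>i\<in>I. ?p i) = (\<integral>\<^sup>+x. (1 + (\<Sum>i\<in>I. ennreal (z i * x i))) * f x \<partial>lebP I)"
    by (simp add: distrib_right sum_distrib_right nn_integral_add nn_integral_sum)
  also have "\<dots> \<le> (\<integral>\<^sup>+x. (ennreal (exp (ip I z x)) + (\<Sum>i\<in>I. ennreal (- (z i * x i)))) * f x \<partial>lebP I)"
    by (intro nn_integral_mono mult_right_mono le) simp
  also have "\<dots> = (\<integral>\<^sup>+x. f x * ennreal (exp (ip I z x)) \<partial>lebP I) + (\<Sum>i\<in>I. ?m i)"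
    by (simp add: distrib_right sum_distrib_right nn_integral_add nn_integral_sum mult.commute[of "f _"])
  also have "(\<Sum>i\<in>I. ?m i) = (\<Sum>i\<in>I. ?p i)" using pm by (intro sum.cong) auto
  finally have "(\<Sum>i\<in>I. ?p i) + (\<integral>\<^sup>+x. f x \<partial>lebP I) \<le> (\<Sum>i\<in>I. ?p i) + (\<integral>\<^sup>+x. f x * ennreal (exp (ip I z x)) \<partial>lebP I)"
    by (simp add: add.commute)
  moreover have "\<forall>i\<in>I. ?p i < top" using pm unfolding infinity_ennreal_def by blast
  then have "(\<Sum>i\<in>I. ?p i) < top" using fin by simp
  ultimately show ?thesis by (auto simp: ennreal_add_left_cancel_le)
qed

lemma half_gauss_finite: "half_gauss < \<infinity>"
proof -
  have "half_gauss \<le> (\<integral>\<^sup>+u. ennreal (exp (1/2 - u)) * indicator {0..} u \<partial>lborel)"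
    unfolding half_gauss_def
  proof (intro nn_integral_mono mult_mono)
    fix u :: real
    have "0 \<le> (u - 1)\<^sup>2" by simp
    then have "- (u\<^sup>2 / 2) \<le> 1/2 - u" by (simp add: power2_eq_square algebra_simps)
    then show "ennreal (exp (- (u\<^sup>2 / 2))) \<le> ennreal (exp (1/2 - u))" by (intro ennreal_leI) simp
  qed (auto simp: indicator_def)
  also have "\<dots> = ennreal (0 - (- exp (1/2 - 0)))"
  proof (rule nn_integral_FTC_atLeast)
    have "filterlim (\<lambda>u :: real. 1/2 - u) at_bot at_top"
      unfolding filterlim_at_bot eventually_at_top_linorder
    proof
      fix Z :: real
      show "\<exists>N. \<forall>u\<ge>N. 1/2 - u \<le> Z" by (intro exI[of _ "1/2 - Z"]) auto
    qed
    then show "((\<lambda>u. - exp (1/2 - u)) \<longlongrightarrow> 0) (at_top :: real filter)"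
      using tendsto_minus[OF filterlim_compose[OF exp_at_bot]] by fastforce
  qed (auto intro!: derivative_eq_intros)
  also have "\<dots> < \<infinity>" by simp
  finally show ?thesis .
qed

lemma santalo_point_centered:
  fixes I :: "'i set"
  assumes fin: "finite I" and P: "santalo_point I" and f: "centered I f"
    and g[measurable]: "g \<in> borel_measurable (lebP I)" and c: "c \<ge> 0" and fg: "polar_pair I c f g"
  shows "(\<integral>\<^sup>+x. f x \<partial>lebP I) * (\<integral>\<^sup>+y. g y \<partial>lebP I) \<le> ennreal c * santalo_const I"
proof (cases "c = 0")
  \<comment> \<open>Set apart because \<open>G\<close> divides by \<open>c\<close>; here
    \<open>f x * g y\<close> vanishes identically.\<close>
  case True
  have [measurable]: "f \<in> borel_measurable (lebP I)" using f by (simp add: centered_def)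
  have "(\<integral>\<^sup>+x. f x \<partial>lebP I) * (\<integral>\<^sup>+y. g y \<partial>lebP I) = (\<integral>\<^sup>+x. \<integral>\<^sup>+y. f x * g y \<partial>lebP I \<partial>lebP I)"
    by (simp add: nn_integral_cmult nn_integral_multc)
  also have "\<dots> = (\<integral>\<^sup>+x. \<integral>\<^sup>+y. 0 \<partial>lebP I \<partial>lebP I)"
    using fg True unfolding polar_pair_def by (intro nn_integral_cong) fastforce
  finally have "(\<integral>\<^sup>+x. f x \<partial>lebP I) * (\<integral>\<^sup>+y. g y \<partial>lebP I) = 0" by simp
  then show ?thesis by (metis zero_le)
next
  case False
  then have c: "c > 0" using c by simp
  have fm[measurable]: "f \<in> borel_measurable (lebP I)" using f by (simp add: centered_def)
  define B where "B k = (\<Pi>\<^sub>E i\<in>I. {- real k..real k})" for k :: nat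
  have Bm[measurable]: "B k \<in> sets (lebP I)" for k unfolding B_def by (intro sets_PiM_I_finite fin) auto
  have Bfin: "emeasure (lebP I) (B k) < \<infinity>" for k
  proof -
    have "emeasure (lebP I) (B k) = (\<Prod>i\<in>I. emeasure lborel {- real k..real k})"
      unfolding B_def by (rule lebP.emeasure_PiM[OF fin]) simp
    then show ?thesis by (simp add: ennreal_power flip: ennreal_mult)
  qed
  define G where "G k y = ennreal (1 / c) * (min (g y) (of_nat k) * indicator (B k) y)" for k :: nat and y
  have Gm[measurable]: "G k \<in> borel_measurable (lebP I)" for k unfolding G_def by measurable
  have GB: "G k y \<le> ennreal (real k / c) * indicator (B k) y" for k y
  proof -
    have "min (g y) (of_nat k) \<le> ennreal (real k)" by (simp add: ennreal_of_nat_eq_real_of_nat)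
    then have "ennreal (1 / c) * (min (g y) (of_nat k) * indicator (B k) y) \<le> ennreal (1 / c) * (ennreal (real k) * indicator (B k) y)"
      by (intro mult_left_mono mult_right_mono) auto
    then show ?thesis using c by (simp add: G_def mult.assoc[symmetric] ennreal_mult[symmetric])
  qed
  have tame: "tame I (G k)" for k
    unfolding tame_def
  proof (intro conjI ballI Gm)
    have "(\<integral>\<^sup>+y. G k y \<partial>lebP I) \<le> (\<integral>\<^sup>+y. ennreal (real k / c) * indicator (B k) y \<partial>lebP I)"
      by (intro nn_integral_mono GB)
    also have "\<dots> < \<infinity>" using Bfin[of k] by (simp add: nn_integral_cmult ennreal_mult_less_top)
    finally show "(\<integral>\<^sup>+y. G k y \<partial>lebP I) < \<infinity>" .
    fix i assume i: "i \<in> I"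
    have "(\<integral>\<^sup>+y. ennreal \<bar>y i\<bar> * G k y \<partial>lebP I) \<le> (\<integral>\<^sup>+y. ennreal (real k) * (ennreal (real k / c) * indicator (B k) y) \<partial>lebP I)"
    proof (intro nn_integral_mono)
      fix y
      show "ennreal \<bar>y i\<bar> * G k y \<le> ennreal (real k) * (ennreal (real k / c) * indicator (B k) y)"
      proof (cases "y \<in> B k")
        case True
        then have "\<bar>y i\<bar> \<le> real k" using i by (auto simp: B_def PiE_def Pi_def)
        then show ?thesis by (intro mult_mono GB ennreal_leI) auto
      next
        case False
        then have "G k y = 0" by (simp add: G_def)
        then show ?thesis by simp
      qed
    qed
    also have "\<dots> < \<infinity>" using Bfin[of k] by (simp add: nn_integral_cmult ennreal_mult_less_top)
    finally show "(\<integral>\<^sup>+y. ennreal \<bar>y i\<bar> * G k y \<partial>lebP I) < \<infinity>" .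
  qed
  have pp: "polar_pair I 1 (G k) f" for k
    unfolding polar_pair_def
  proof (intro ballI)
    fix y x assume xy: "y \<in> space (lebP I)" "x \<in> space (lebP I)"
    have "G k y \<le> ennreal (1 / c) * g y"
      unfolding G_def by (intro mult_left_mono) (auto simp: indicator_def)
    then have "G k y * f x \<le> ennreal (1 / c) * (f x * g y)"
      by (metis (no_types, lifting) mult.assoc mult.commute mult_right_mono zero_le)
    also have "\<dots> \<le> ennreal (1 / c) * ennreal (c * exp (- ip I x y))"
      using fg xy unfolding polar_pair_def by (intro mult_left_mono) auto
    also have "\<dots> = ennreal (1 * exp (- ip I y x))" using c by (simp add: ennreal_mult[symmetric] ip_commute)
    finally show "G k y * f x \<le> ennreal (1 * exp (- ip I y x))" .
  qed
  have bound: "(\<integral>\<^sup>+y. G k y \<partial>lebP I) * (\<integral>\<^sup>+x. f x \<partial>lebP I) \<le> santalo_const I" for k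
  proof -
    obtain z where "\<forall>h\<in>borel_measurable (lebP I). polar_pair I 1 (G k) h \<longrightarrow>
       (\<integral>\<^sup>+x. G k x \<partial>lebP I) * (\<integral>\<^sup>+y. h y * ennreal (exp (ip I z y)) \<partial>lebP I) \<le> santalo_const I"
      using P tame unfolding santalo_point_def by blast
    then have "(\<integral>\<^sup>+x. G k x \<partial>lebP I) * (\<integral>\<^sup>+y. f y * ennreal (exp (ip I z y)) \<partial>lebP I) \<le> santalo_const I"
      using fm pp by blast
    then show ?thesis
      using mult_left_mono[OF centered_tilt[OF fin f, of z], of "\<integral>\<^sup>+x. G k x \<partial>lebP I"] by (simp add: order_trans)
  qed
  have sup: "(SUP k. G k y) = ennreal (1 / c) * g y" if y: "y \<in> space (lebP I)" for y
  proof -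
    obtain k0 :: nat where k0: "(\<Sum>i\<in>I. \<bar>y i\<bar>) \<le> real k0" using real_arch_simple by blast
    have yB: "y \<in> B k" if "k0 \<le> k" for k
    proof -
      have "\<bar>y i\<bar> \<le> real k" if "i \<in> I" for i
        using member_le_sum[of i I "\<lambda>i. \<bar>y i\<bar>"] that fin k0 \<open>k0 \<le> k\<close> by simp
      then show ?thesis using y by (fastforce simp: B_def space_PiM PiE_def Pi_def abs_le_iff)
    qed
    have "(SUP k. min (g y) (of_nat k) * indicator (B k) y) = g y"
    proof (rule antisym)
      show "(SUP k. min (g y) (of_nat k) * indicator (B k) y) \<le> g y"
        by (rule SUP_least) (auto simp: indicator_def)
      have "min (g y) (of_nat k) \<le> (SUP k. min (g y) (of_nat k) * indicator (B k) y)" for k :: nat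
      proof (rule SUP_upper2[of "max k k0"])
        have "(of_nat k :: ennreal) \<le> of_nat (max k k0)" by (intro of_nat_mono) simp
        then show "min (g y) (of_nat k) \<le> min (g y) (of_nat (max k k0)) * indicator (B (max k k0)) y"
          using yB[of "max k k0"] by (simp add: min.coboundedI2)
      qed simp
      moreover have "g y = (SUP k::nat. min (g y) (of_nat k))"
        by (simp add: inf_min[symmetric] inf_SUP[symmetric] ennreal_SUP_of_nat_eq_top)
      ultimately show "g y \<le> (SUP k. min (g y) (of_nat k) * indicator (B k) y)"
        by (metis (no_types, lifting) SUP_least)
    qed
    then show ?thesis by (simp add: G_def SUP_mult_left_ennreal[symmetric])
  qed
  have incG: "incseq G"
  proof (rule incseq_SucI, rule le_funI)
    fix k y
    have "B k \<subseteq> B (Suc k)" unfolding B_def by (intro PiE_mono) auto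
    moreover have "(of_nat k :: ennreal) \<le> of_nat (Suc k)" by (intro of_nat_mono) simp
    ultimately show "G k y \<le> G (Suc k) y"
      unfolding G_def by (intro mult_left_mono mult_mono min.mono) (auto simp: indicator_def)
  qed
  have "ennreal (1 / c) * (\<integral>\<^sup>+y. g y \<partial>lebP I) = (\<integral>\<^sup>+y. (SUP k. G k y) \<partial>lebP I)"
    by (simp add: nn_integral_cmult[symmetric] sup cong: nn_integral_cong)
  also have "\<dots> = (SUP k. \<integral>\<^sup>+y. G k y \<partial>lebP I)"
    by (rule nn_integral_monotone_convergence_SUP[OF incG]) simp
  finally have "ennreal (1 / c) * (\<integral>\<^sup>+y. g y \<partial>lebP I) * (\<integral>\<^sup>+x. f x \<partial>lebP I) \<le> santalo_const I"
    by (simp add: SUP_mult_right_ennreal SUP_le_iff bound)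
  then have "ennreal c * (ennreal (1 / c) * (\<integral>\<^sup>+y. g y \<partial>lebP I) * (\<integral>\<^sup>+x. f x \<partial>lebP I)) \<le> ennreal c * santalo_const I"
    by (rule mult_left_mono) simp
  moreover have "ennreal c * ennreal (1 / c) = 1" using c by (simp add: ennreal_mult[symmetric])
  ultimately show ?thesis by (simp add: mult.assoc[symmetric] mult.commute[of "\<integral>\<^sup>+x. f x \<partial>lebP I"])
qed

section \<open>Translations, splitting off one coordinate, and shears\<close>

lemma lebP_translate:
  fixes I :: "'i set"
  assumes fin: "finite I" and [measurable]: "F \<in> borel_measurable (lebP I)"
  shows "(\<integral>\<^sup>+x. F (\<lambda>i\<in>I. x i + c i) \<partial>lebP I) = (\<integral>\<^sup>+x. F x \<partial>lebP I)"
proof -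
  let ?T = "\<lambda>x. \<lambda>i\<in>I. x i + c i"
  have [measurable]: "?T \<in> lebP I \<rightarrow>\<^sub>M lebP I" by measurable
  have "distr (lebP I) (lebP I) ?T = lebP I"
  proof (rule lebP.PiM_eqI[OF fin])
    fix A :: "'i \<Rightarrow> real set" assume A: "\<And>i. i \<in> I \<Longrightarrow> A i \<in> sets lborel"
    let ?A = "\<lambda>i. (\<lambda>s. s + c i) -` A i"
    have A': "?A i \<in> sets lborel" if "i \<in> I" for i
      using measurable_sets[of "\<lambda>s. s + c i" borel borel "A i"] A[OF that] by simp
    have "emeasure (distr (lebP I) (lebP I) ?T) (Pi\<^sub>E I A) = emeasure (lebP I) (?T -` Pi\<^sub>E I A \<inter> space (lebP I))"
      using A by (intro emeasure_distr sets_PiM_I_finite fin) auto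
    also have "?T -` Pi\<^sub>E I A \<inter> space (lebP I) = Pi\<^sub>E I ?A"
      by (auto simp: space_PiM PiE_def Pi_def)
    also have "emeasure (lebP I) (Pi\<^sub>E I ?A) = (\<Prod>i\<in>I. emeasure lborel (?A i))"
      by (rule lebP.emeasure_PiM[OF fin A'])
    also have "\<dots> = (\<Prod>i\<in>I. emeasure lborel (A i))"
    proof (rule prod.cong[OF refl])
      fix i assume i: "i \<in> I"
      have "emeasure lborel (A i) = emeasure (distr lborel borel ((+) (c i))) (A i)" by (simp add: lborel_distr_plus)
      also have "\<dots> = emeasure lborel ((+) (c i) -` A i)" using A[OF i] by (subst emeasure_distr) auto
      also have "(+) (c i) -` A i = ?A i" by (auto simp: add.commute)
      finally show "emeasure lborel (?A i) = emeasure lborel (A i)" by simp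
    qed
    finally show "emeasure (distr (lebP I) (lebP I) ?T) (Pi\<^sub>E I A) = (\<Prod>i\<in>I. emeasure lborel (A i))" .
  qed simp
  then have "(\<integral>\<^sup>+x. F x \<partial>lebP I) = (\<integral>\<^sup>+x. F x \<partial>distr (lebP I) (lebP I) ?T)" by simp
  also have "\<dots> = (\<integral>\<^sup>+x. F (?T x) \<partial>lebP I)" by (rule nn_integral_distr) auto
  finally show ?thesis by simp
qed

lemma nn_integral_translate_real:
  fixes F :: "real \<Rightarrow> ennreal"
  assumes [measurable]: "F \<in> borel_measurable borel"
  shows "(\<integral>\<^sup>+s. F (t + s) \<partial>lborel) = (\<integral>\<^sup>+s. F s \<partial>lborel)"
  using nn_integral_real_affine[of F 1 t] by simp

lemma nn_integral_reflect_real: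
  fixes F :: "real \<Rightarrow> ennreal"
  assumes [measurable]: "F \<in> borel_measurable borel" and "\<sigma> = 1 \<or> \<sigma> = -1"
  shows "(\<integral>\<^sup>+s. F (\<sigma> * s) \<partial>lborel) = (\<integral>\<^sup>+s. F s \<partial>lborel)"
  using nn_integral_real_affine[of F \<sigma> 0] assms(2) by auto

text \<open>Unlike \<open>x(n := s)\<close>, the values outside the index set are reset to
  \<open>undefined\<close>, so the result lies in the space of the product measure even for
  arguments such as \<open>\<lambda>i. x i + z i\<close>.\<close>

definition glue :: "'i set \<Rightarrow> 'i \<Rightarrow> ('i \<Rightarrow> real) \<Rightarrow> real \<Rightarrow> 'i \<Rightarrow> real" where
  "glue I n x s = (\<lambda>i\<in>insert n I. if i = n then s else x i)"

lemma glue_simps [simp]: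
  "glue I n x s n = s" "i \<in> I \<Longrightarrow> i \<noteq> n \<Longrightarrow> glue I n x s i = x i"
  by (auto simp: glue_def)

lemma measurable_glue [measurable (raw)]:
  assumes X: "\<And>i. i \<in> I \<Longrightarrow> (\<lambda>w. X w i) \<in> borel_measurable N" and S: "S \<in> borel_measurable N"
  shows "(\<lambda>w. glue I n (X w) (S w)) \<in> N \<rightarrow>\<^sub>M lebP (insert n I)"
  unfolding glue_def
proof (rule measurable_restrict)
  fix i assume "i \<in> insert n I"
  then show "(\<lambda>w. if i = n then S w else X w i) \<in> N \<rightarrow>\<^sub>M lborel"
    using X S by (cases "i = n") auto
qed

context
  fixes I :: "'i set" and n :: 'i
  assumes fin: "finite I" and n: "n \<notin> I"
begin

lemma integral_glue:
  assumes [measurable]: "F \<in> borel_measurable (lebP (insert n I))"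
  shows "(\<integral>\<^sup>+x. \<integral>\<^sup>+s. F (glue I n x s) \<partial>lborel \<partial>lebP I) = (\<integral>\<^sup>+x. F x \<partial>lebP (insert n I))"
proof -
  have "glue I n x s = x(n := s)" if "x \<in> space (lebP I)" for x s
    using that n by (auto simp: glue_def space_PiM PiE_def extensional_def fun_eq_iff)
  then show ?thesis
    by (subst lebP.product_nn_integral_insert[OF fin n]) (auto intro!: nn_integral_cong)
qed

lemma pair_swap:
  fixes F :: "('i \<Rightarrow> real) \<Rightarrow> real \<Rightarrow> ennreal"
  assumes [measurable]: "case_prod F \<in> borel_measurable (lebP I \<Otimes>\<^sub>M lborel)"
  shows "(\<integral>\<^sup>+x. \<integral>\<^sup>+s. F x s \<partial>lborel \<partial>lebP I) = (\<integral>\<^sup>+s. \<integral>\<^sup>+x. F x s \<partial>lebP I \<partial>lborel)"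
proof -
  interpret I: finite_product_sigma_finite "\<lambda>_. lborel" I by standard (rule fin)
  interpret pair_sigma_finite "lebP I" "lborel :: real measure" ..
  show ?thesis by (rule Fubini'[OF assms, symmetric])
qed

lemma glue_ext: "(\<And>i. i \<in> I \<Longrightarrow> x i = y i) \<Longrightarrow> glue I n x s = glue I n y s"
  by (auto simp: glue_def fun_eq_iff)

text \<open>For fixed \<open>s\<close> the shear is a translation of the coordinates in
  \<open>I\<close>, so exchanging the order of integration removes it; what remains is a translation
  in \<open>s\<close>.\<close>

lemma integral_shear:
  assumes [measurable]: "F \<in> borel_measurable (lebP (insert n I))"
  shows "(\<integral>\<^sup>+x. \<integral>\<^sup>+s. F (glue I n (\<lambda>i. x i + (z i + s * \<beta> i)) (t + s)) \<partial>lborel \<partial>lebP I) = (\<integral>\<^sup>+x. F x \<partial>lebP (insert n I))"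
proof -
  have "(\<integral>\<^sup>+x. \<integral>\<^sup>+s. F (glue I n (\<lambda>i. x i + (z i + s * \<beta> i)) (t + s)) \<partial>lborel \<partial>lebP I) =
      (\<integral>\<^sup>+s. \<integral>\<^sup>+x. F (glue I n (\<lambda>i. x i + (z i + s * \<beta> i)) (t + s)) \<partial>lebP I \<partial>lborel)"
    by (rule pair_swap) (simp add: split_beta')
  also have "\<dots> = (\<integral>\<^sup>+s. \<integral>\<^sup>+x. F (glue I n x (t + s)) \<partial>lebP I \<partial>lborel)"
  proof (rule nn_integral_cong)
    fix s
    have "(\<integral>\<^sup>+x. F (glue I n (\<lambda>i. x i + (z i + s * \<beta> i)) (t + s)) \<partial>lebP I) =
        (\<integral>\<^sup>+x. F (glue I n (\<lambda>i\<in>I. x i + (z i + s * \<beta> i)) (t + s)) \<partial>lebP I)"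
      by (intro nn_integral_cong arg_cong[where f = F] glue_ext) simp
    also have "\<dots> = (\<integral>\<^sup>+x. F (glue I n x (t + s)) \<partial>lebP I)"
      by (rule lebP_translate[OF fin, of "\<lambda>x. F (glue I n x (t + s))"]) measurable
    finally show "(\<integral>\<^sup>+x. F (glue I n (\<lambda>i. x i + (z i + s * \<beta> i)) (t + s)) \<partial>lebP I) = (\<integral>\<^sup>+x. F (glue I n x (t + s)) \<partial>lebP I)" .
  qed
  also have "\<dots> = (\<integral>\<^sup>+x. \<integral>\<^sup>+s. F (glue I n x (t + s)) \<partial>lborel \<partial>lebP I)"
    by (rule pair_swap[symmetric]) (simp add: split_beta')
  also have "\<dots> = (\<integral>\<^sup>+x. \<integral>\<^sup>+s. F (glue I n x s) \<partial>lborel \<partial>lebP I)"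
    by (intro nn_integral_cong nn_integral_translate_real[of "\<lambda>s. F (glue I n x s)" for x]) measurable
  also have "\<dots> = (\<integral>\<^sup>+x. F x \<partial>lebP (insert n I))" by (rule integral_glue) simp
  finally show ?thesis .
qed

lemma integral_shear_dual:
  assumes [measurable]: "F \<in> borel_measurable (lebP (insert n I))"
  shows "(\<integral>\<^sup>+y. \<integral>\<^sup>+u. F (glue I n y (u - ip I \<beta> y)) \<partial>lborel \<partial>lebP I) = (\<integral>\<^sup>+y. F y \<partial>lebP (insert n I))"
proof -
  have "(\<integral>\<^sup>+u. F (glue I n y (u - ip I \<beta> y)) \<partial>lborel) = (\<integral>\<^sup>+u. F (glue I n y u) \<partial>lborel)" for y
    using nn_integral_translate_real[of "\<lambda>u. F (glue I n y u)" "- ip I \<beta> y"] by simp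
  then show ?thesis by (simp add: integral_glue)
qed

lemma ip_insert: "ip (insert n I) x y = x n * y n + ip I x y"
  using fin n by (simp add: ip_def)

text \<open>Explains the dual shear: subtracting \<open>ip I \<beta> y\<close> from the last
  coordinate of the dual variable cancels the \<open>\<beta>\<close> terms. Relative to the base
  point \<open>glue I n z t\<close> the pairing then splits into one on \<open>I\<close> and a
  product of two reals.\<close>

lemma ip_shear:
  "ip (insert n I) (glue I n (\<lambda>i. x i + (z i + s * \<beta> i)) (t + s)) (glue I n y (u - ip I \<beta> y)) -
   ip (insert n I) (glue I n z t) (glue I n y (u - ip I \<beta> y)) = ip I x y + s * u"
proof -
  have *: "ip I (glue I n a b) (glue I n c d) = ip I a c" for a b c d
    using n unfolding ip_def by (intro sum.cong refl) (metis glue_simps(2))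
  have "ip I (\<lambda>i. x i + (z i + s * \<beta> i)) y = ip I x y + ip I z y + s * ip I \<beta> y"
    by (simp add: ip_def algebra_simps sum.distrib sum_distrib_left)
  then show ?thesis by (simp add: ip_insert * algebra_simps)
qed

lemma AE_hyperplane: "AE x in lebP (insert n I). x n \<noteq> t"
proof -
  have "emeasure (lebP (insert n I)) {x \<in> space (lebP (insert n I)). x n = t} = (\<integral>\<^sup>+x. indicator {t} (x n) \<partial>lebP (insert n I))"
  proof -
    let ?S = "{x \<in> space (lebP (insert n I)). x n = t}"
    have "emeasure (lebP (insert n I)) ?S = (\<integral>\<^sup>+x. indicator ?S x \<partial>lebP (insert n I))"
      by (rule nn_integral_indicator[symmetric]) measurable
    also have "\<dots> = (\<integral>\<^sup>+x. indicator {t} (x n) \<partial>lebP (insert n I))"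
      by (intro nn_integral_cong) (simp add: indicator_def)
    finally show ?thesis .
  qed
  also have "\<dots> = (\<integral>\<^sup>+x. \<integral>\<^sup>+s. indicator {t} s \<partial>lborel \<partial>lebP I)"
    by (subst integral_glue[symmetric]) simp_all
  also have "\<dots> = 0" by simp
  finally show ?thesis by (subst AE_iff_measurable[OF _ refl]) auto
qed

text \<open>The hyperplane \<open>x n = t\<close> bisects the mass of \<open>f\<close>; the line through the barycenters of the two
  halves meets it at \<open>z\<close> and has slope \<open>\<beta>\<close>.\<close>

lemma balanced_shear:
  assumes f: "tame (insert n I) f" and pos: "(\<integral>\<^sup>+x. f x \<partial>lebP (insert n I)) > 0"
  obtains m t z \<beta> where
    "(\<integral>\<^sup>+x. f x \<partial>lebP (insert n I)) = ennreal (2 * m)" "m > 0"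
    "\<forall>\<sigma>. \<sigma> = 1 \<or> \<sigma> = -1 \<longrightarrow> (\<integral>\<^sup>+x. f x * indicator {0<..} (\<sigma> * (x n - t)) \<partial>lebP (insert n I)) = ennreal m"
    "\<forall>\<sigma> i. \<sigma> = 1 \<or> \<sigma> = -1 \<longrightarrow> i \<in> I \<longrightarrow>
       (\<integral>\<^sup>+x. ennreal (x i - z i - (x n - t) * \<beta> i) * (f x * indicator {0<..} (\<sigma> * (x n - t))) \<partial>lebP (insert n I)) < \<infinity> \<and>
       (\<integral>\<^sup>+x. ennreal (x i - z i - (x n - t) * \<beta> i) * (f x * indicator {0<..} (\<sigma> * (x n - t))) \<partial>lebP (insert n I)) =
       (\<integral>\<^sup>+x. ennreal (- (x i - z i - (x n - t) * \<beta> i)) * (f x * indicator {0<..} (\<sigma> * (x n - t))) \<partial>lebP (insert n I))"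
proof -
  let ?J = "insert n I"
  have [measurable]: "f \<in> borel_measurable (lebP ?J)" using f by (simp add: tame_def)
  have [measurable]: "(\<lambda>x. x i) \<in> borel_measurable (lebP ?J)" if "i \<in> ?J" for i using that by measurable
  define \<mu> where "\<mu> = density (lebP ?J) f"
  have [simp, measurable_cong]: "sets \<mu> = sets (lebP ?J)" by (simp add: \<mu>_def)
  have sp: "space \<mu> = space (lebP ?J)" by (simp add: \<mu>_def)
  have nn\<mu>: "(\<integral>\<^sup>+x. k x \<partial>\<mu>) = (\<integral>\<^sup>+x. k x * f x \<partial>lebP ?J)" if "k \<in> borel_measurable (lebP ?J)" for k
    unfolding \<mu>_def using that by (subst nn_integral_density) (auto simp: mult.commute)
  have tot: "emeasure \<mu> (space \<mu>) = (\<integral>\<^sup>+x. f x \<partial>lebP ?J)"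
    unfolding sp \<mu>_def by (subst emeasure_density) (auto intro!: nn_integral_cong)
  interpret \<mu>: finite_measure \<mu>
    by standard (use f tot in \<open>auto simp: tame_def\<close>)
  define M where "M = measure \<mu> (space \<mu>)"
  have M: "(\<integral>\<^sup>+x. f x \<partial>lebP ?J) = ennreal M" "M > 0"
  proof -
    show e: "(\<integral>\<^sup>+x. f x \<partial>lebP ?J) = ennreal M" unfolding M_def tot[symmetric] by (rule \<mu>.emeasure_eq_measure)
    show "M > 0" using pos unfolding e by simp
  qed
  have ints: "integrable \<mu> (\<lambda>x. x i)" if i: "i \<in> ?J" for i
  proof (rule integrableI_bounded)
    have "(\<integral>\<^sup>+x. ennreal (norm (x i)) \<partial>\<mu>) = (\<integral>\<^sup>+x. ennreal \<bar>x i\<bar> * f x \<partial>lebP ?J)"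
      using i by (subst nn\<mu>) auto
    then show "(\<integral>\<^sup>+x. ennreal (norm (x i)) \<partial>\<mu>) < \<infinity>" using f i by (auto simp: tame_def)
  qed (use i in measurable)
  have AEn: "AE x in \<mu>. x n \<noteq> s" for s
    unfolding \<mu>_def by (subst AE_density) (use AE_hyperplane[of s] in \<open>auto elim!: eventually_mono\<close>)
  define D where "D = distr \<mu> borel (\<lambda>x. x n)"
  have [measurable]: "(\<lambda>x. x n) \<in> borel_measurable \<mu>" by measurable
  have "finite_measure D" unfolding D_def by (rule \<mu>.finite_measure_distr) measurable
  then interpret D: finite_borel_measure D
    by (intro finite_borel_measure.intro finite_borel_measure_axioms.intro) (simp_all add: D_def)
  have D: "measure D A = measure \<mu> {x \<in> space \<mu>. x n \<in> A}" if "A \<in> sets borel" for A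
    unfolding D_def using that by (subst measure_distr) (auto intro!: arg_cong[where f = "measure \<mu>"])
  have "measure D {s} = 0" for s
  proof -
    have "measure \<mu> {x \<in> space \<mu>. x n \<in> {s}} = measure \<mu> {}"
    proof (rule measure_eq_AE)
      show "AE x in \<mu>. (x \<in> {x \<in> space \<mu>. x n \<in> {s}}) = (x \<in> {})" using AEn[of s] by eventually_elim auto
    qed measurable
    then show ?thesis by (simp add: D)
  qed
  then have cont: "isCont (cdf D) s" for s by (simp add: D.isCont_cdf)
  have DM: "measure D (space D) = M" unfolding M_def by (simp add: D D_def[symmetric] D.borel_UNIV) 
  obtain a where a: "cdf D a < M / 2"
    using order_tendstoD(2)[OF D.cdf_lim_at_bot, of "M / 2"] M(2) by (auto simp: eventually_at_bot_linorder)
  obtain b where b: "cdf D b > M / 2"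
    using order_tendstoD(1)[OF D.cdf_lim_at_top, of "M / 2"] M(2) by (auto simp: DM eventually_at_top_linorder)
  have "a \<le> b" using a b D.cdf_nondecreasing[of b a] by linarith
  then obtain t where t: "cdf D t = M / 2"
    using IVT[of "cdf D" a "M / 2" b] a b cont by auto
  define S where "S \<sigma> = {x \<in> space \<mu>. 0 < \<sigma> * (x n - t)}" for \<sigma> :: real
  have Sm[measurable]: "S \<sigma> \<in> sets \<mu>" for \<sigma> unfolding S_def by measurable
  have eS1: "measure \<mu> (S 1) = M / 2"
  proof -
    have "measure \<mu> (space \<mu> - {x \<in> space \<mu>. x n \<in> {..t}}) = M - M / 2"
    proof -
      have "{x \<in> space \<mu>. x n \<in> {..t}} \<in> sets \<mu>" by measurable
      from \<mu>.finite_measure_compl[OF this] show ?thesis using t by (simp add: M_def cdf_def D)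
    qed
    moreover have "space \<mu> - {x \<in> space \<mu>. x n \<in> {..t}} = S 1" by (auto simp: S_def)
    ultimately show ?thesis by simp
  qed
  have eS2: "measure \<mu> (S (-1)) = M / 2"
  proof -
    have "measure \<mu> (S (-1)) = measure \<mu> {x \<in> space \<mu>. x n \<in> {..t}}"
    proof (rule measure_eq_AE)
      show "AE x in \<mu>. (x \<in> S (-1)) = (x \<in> {x \<in> space \<mu>. x n \<in> {..t}})"
        using AEn[of t] by eventually_elim (auto simp: S_def)
    qed measurable
    then show ?thesis using t by (simp add: cdf_def D)
  qed
  define A where "A \<sigma> i = (\<integral>x. indicator (S \<sigma>) x * x i \<partial>\<mu>)" for \<sigma> i
  define d where "d \<sigma> = (\<integral>x. indicator (S \<sigma>) x * (\<sigma> * (x n - t)) \<partial>\<mu>)" for \<sigma>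
  have intS: "integrable \<mu> (\<lambda>x. indicator (S \<sigma>) x * k x)" if "integrable \<mu> k" for \<sigma> and k :: "_ \<Rightarrow> real"
    using integrable_mult_indicator[OF Sm that] by simp
  have w: "integrable \<mu> (\<lambda>x. c * (x n - t))" for c by (intro integrable_mult_right Bochner_Integration.integrable_diff ints) auto
  have dpos: "d 1 + d (-1) > 0"
  proof -
    have sum: "d 1 + d (-1) = (\<integral>x. \<bar>x n - t\<bar> \<partial>\<mu>)"
      unfolding d_def
      by (subst Bochner_Integration.integral_add[symmetric], (rule intS w)+)
         (auto intro!: Bochner_Integration.integral_cong simp: S_def indicator_def)
    have i: "integrable \<mu> (\<lambda>x. \<bar>x n - t\<bar>)" using w[of 1] by simp
    have "(\<integral>x. \<bar>x n - t\<bar> \<partial>\<mu>) \<noteq> 0"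
    proof
      assume "(\<integral>x. \<bar>x n - t\<bar> \<partial>\<mu>) = 0"
      then have "AE x in \<mu>. \<bar>x n - t\<bar> = 0" using integral_nonneg_eq_0_iff_AE[OF i] by simp
      then have "AE x in \<mu>. False" using AEn[of t] by eventually_elim simp
      then have "emeasure \<mu> (space \<mu>) = 0" by (subst (asm) AE_iff_measurable[of "space \<mu>"]) (auto simp: sp)
      then show False using M tot by simp
    qed
    then show ?thesis unfolding sum by (simp add: order_less_le integral_nonneg_AE)
  qed
  \<comment> \<open>Up to the common factor \<open>M / 2\<close>, \<open>A 1 i\<close> and
    \<open>A (-1) i\<close> are the \<open>i\<close>-th coordinates of the two barycenters, and
    \<open>d 1 + d (-1)\<close> is the difference of their \<open>n\<close>-th coordinates; so
    \<open>\<beta>\<close> is the slope of the line joining them. Next, \<open>z\<close> slides the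
    upper barycenter along that line down to the hyperplane.\<close>
  define \<beta> where "\<beta> i = (A 1 i - A (-1) i) / (d 1 + d (-1))" for i
  define z where "z i = (A 1 i - \<beta> i * d 1) / (M / 2)" for i
  have bary: "(\<integral>x. indicator (S \<sigma>) x * (x i - z i - (x n - t) * \<beta> i) \<partial>\<mu>) = 0" if \<sigma>: "\<sigma> = 1 \<or> \<sigma> = -1" and i: "i \<in> I" for \<sigma> i
  proof -
    have "(\<integral>x. indicator (S \<sigma>) x * (x i - z i - (x n - t) * \<beta> i) \<partial>\<mu>) =
        (\<integral>x. (indicator (S \<sigma>) x * x i - z i * indicator (S \<sigma>) x) - (\<sigma> * \<beta> i) * (indicator (S \<sigma>) x * (\<sigma> * (x n - t))) \<partial>\<mu>)"
      using \<sigma> by (intro Bochner_Integration.integral_cong) (auto simp: algebra_simps)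
    also have "\<dots> = (A \<sigma> i - z i * measure \<mu> (S \<sigma>)) - (\<sigma> * \<beta> i) * d \<sigma>"
    proof -
      have iS: "integrable \<mu> (\<lambda>x. indicator (S \<sigma>) x :: real)"
        using Sm[of \<sigma>] by (intro integrable_real_indicator) (auto simp: \<mu>.emeasure_finite less_top[symmetric])
      have ix: "integrable \<mu> (\<lambda>x. indicator (S \<sigma>) x * x i)" using i by (intro intS ints) simp
      have "(\<integral>x. (indicator (S \<sigma>) x * x i - z i * indicator (S \<sigma>) x) \<partial>\<mu>) = A \<sigma> i - z i * measure \<mu> (S \<sigma>)"
        unfolding A_def using iS ix Sm[of \<sigma>]
        by (subst Bochner_Integration.integral_diff) (auto simp: sp[symmetric] sets.Int_space_eq1 sets.sets_into_space Int_absorb1)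
      moreover have "(\<integral>x. (\<sigma> * \<beta> i) * (indicator (S \<sigma>) x * (\<sigma> * (x n - t))) \<partial>\<mu>) = (\<sigma> * \<beta> i) * d \<sigma>"
        unfolding d_def by (rule integral_mult_right_zero)
      ultimately show ?thesis
        using iS ix by (subst Bochner_Integration.integral_diff)
          (auto intro!: Bochner_Integration.integrable_diff integrable_mult_right intS w)
    qed
    also have "\<dots> = 0"
    proof -
      have z: "z i * (M / 2) = A 1 i - \<beta> i * d 1" using M(2) by (simp add: z_def)
      have b: "\<beta> i * (d 1 + d (-1)) = A 1 i - A (-1) i" using dpos by (simp add: \<beta>_def)
      show ?thesis using \<sigma> z b by (auto simp: eS1 eS2 algebra_simps)
    qed
    finally show ?thesis .
  qed
  show ?thesis
  proof (rule that[of "M / 2" t z \<beta>]; (intro allI impI)?)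
    show "(\<integral>\<^sup>+x. f x \<partial>lebP ?J) = ennreal (2 * (M / 2))" "M / 2 > 0" using M by simp_all
    fix \<sigma> :: real assume \<sigma>: "\<sigma> = 1 \<or> \<sigma> = -1"
    have ind: "indicator {0<..} (\<sigma> * (x n - t)) = (indicator (S \<sigma>) x :: ennreal)" if "x \<in> space (lebP ?J)" for x
      using that by (simp add: S_def indicator_def sp)
    have "(\<integral>\<^sup>+x. f x * indicator {0<..} (\<sigma> * (x n - t)) \<partial>lebP ?J) = (\<integral>\<^sup>+x. indicator (S \<sigma>) x * f x \<partial>lebP ?J)"
      by (intro nn_integral_cong) (simp add: ind mult.commute)
    also have "\<dots> = emeasure \<mu> (S \<sigma>)" using Sm[of \<sigma>] by (subst nn\<mu>[symmetric]) auto
    also have "\<dots> = ennreal (M / 2)" using \<sigma> eS1 eS2 by (auto simp: \<mu>.emeasure_eq_measure)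
    finally show "(\<integral>\<^sup>+x. f x * indicator {0<..} (\<sigma> * (x n - t)) \<partial>lebP ?J) = ennreal (M / 2)" .
    fix i assume i: "i \<in> I"
    let ?k = "\<lambda>x. indicator (S \<sigma>) x * (x i - z i - (x n - t) * \<beta> i)"
    have ik: "integrable \<mu> ?k"
      using i by (intro intS Bochner_Integration.integrable_diff ints integrable_mult_left) auto
    have iJ: "i \<in> ?J" using i by simp
    then have [measurable]: "(\<lambda>x. x i) \<in> borel_measurable (lebP ?J)" by measurable
    have conv: "(\<integral>\<^sup>+x. ennreal (c * (x i - z i - (x n - t) * \<beta> i)) * (f x * indicator {0<..} (\<sigma> * (x n - t))) \<partial>lebP ?J) = (\<integral>\<^sup>+x. ennreal (c * ?k x) \<partial>\<mu>)" for c
    proof -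
      have "(\<lambda>x. ennreal (c * ?k x)) \<in> borel_measurable (lebP ?J)" using Sm[of \<sigma>] i by simp
      then have "(\<integral>\<^sup>+x. ennreal (c * ?k x) \<partial>\<mu>) = (\<integral>\<^sup>+x. ennreal (c * ?k x) * f x \<partial>lebP ?J)" by (rule nn\<mu>)
      also have "\<dots> = (\<integral>\<^sup>+x. ennreal (c * (x i - z i - (x n - t) * \<beta> i)) * (f x * indicator {0<..} (\<sigma> * (x n - t))) \<partial>lebP ?J)"
      proof (rule nn_integral_cong)
        fix x assume x: "x \<in> space (lebP ?J)"
        show "ennreal (c * ?k x) * f x = ennreal (c * (x i - z i - (x n - t) * \<beta> i)) * (f x * indicator {0<..} (\<sigma> * (x n - t)))"
          unfolding ind[OF x] by (cases "x \<in> S \<sigma>") simp_all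
      qed
      finally show ?thesis by simp
    qed
    define P N where "P = (\<integral>\<^sup>+x. ennreal (?k x) \<partial>\<mu>)" and "N = (\<integral>\<^sup>+x. ennreal (- ?k x) \<partial>\<mu>)"
    have fin: "P \<noteq> \<infinity>" "N \<noteq> \<infinity>"
      using ik unfolding real_integrable_def P_def N_def by blast+
    have "enn2real P - enn2real N = 0"
      using real_lebesgue_integral_def[OF ik] bary[OF \<sigma> i] unfolding P_def N_def by metis
    then have "P = N" using fin by (metis eq_iff_diff_eq_0 ennreal_enn2real infinity_ennreal_def less_top)
    then have "(\<integral>\<^sup>+x. ennreal (?k x) \<partial>\<mu>) < \<infinity> \<and> (\<integral>\<^sup>+x. ennreal (?k x) \<partial>\<mu>) = (\<integral>\<^sup>+x. ennreal (- ?k x) \<partial>\<mu>)"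
      using fin by (simp add: P_def[symmetric] N_def[symmetric] less_top[symmetric])
    then show "(\<integral>\<^sup>+x. ennreal (x i - z i - (x n - t) * \<beta> i) * (f x * indicator {0<..} (\<sigma> * (x n - t))) \<partial>lebP ?J) < \<infinity> \<and>
       (\<integral>\<^sup>+x. ennreal (x i - z i - (x n - t) * \<beta> i) * (f x * indicator {0<..} (\<sigma> * (x n - t))) \<partial>lebP ?J) =
       (\<integral>\<^sup>+x. ennreal (- (x i - z i - (x n - t) * \<beta> i)) * (f x * indicator {0<..} (\<sigma> * (x n - t))) \<partial>lebP ?J)"
      unfolding conv[of 1, unfolded mult_1] conv[of "-1", unfolded mult_minus1] .
  qed
qed

text \<open>In coordinates sheared along the line of barycenters, integrating \<open>f\<close> over
  the half-fibers on either side of the median hyperplane gives two centered functions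
  \<open>F 1\<close> and \<open>F (-1)\<close> of equal mass. The half-line inequality on fibers
  makes each of them polar to the corresponding half \<open>G \<sigma>\<close> of the tilted
  \<open>g\<close>, and the induction hypothesis applies to each pair. The base point
  \<open>Z\<close> is built from \<open>f\<close> alone.\<close>

lemma santalo_point_insert:
  assumes P: "santalo_point I"
  shows "santalo_point (insert n I)"
  unfolding santalo_point_def
proof (intro allI impI)
  let ?J = "insert n I"
  fix f assume f: "tame ?J f"
  have [measurable]: "f \<in> borel_measurable (lebP ?J)" using f by (simp add: tame_def)
  show "\<exists>z. \<forall>g\<in>borel_measurable (lebP ?J). polar_pair ?J 1 f g \<longrightarrow>
     (\<integral>\<^sup>+x. f x \<partial>lebP ?J) * (\<integral>\<^sup>+y. g y * ennreal (exp (ip ?J z y)) \<partial>lebP ?J) \<le> santalo_const ?J"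
  proof (cases "(\<integral>\<^sup>+x. f x \<partial>lebP ?J) = 0")
    case False
    then have fpos: "(\<integral>\<^sup>+x. f x \<partial>lebP ?J) > 0" by (simp add: zero_less_iff_neq_zero)
    obtain m t z \<beta> where m: "(\<integral>\<^sup>+x. f x \<partial>lebP ?J) = ennreal (2 * m)" "m > 0"
      and half': "\<forall>\<sigma>. \<sigma> = 1 \<or> \<sigma> = -1 \<longrightarrow> (\<integral>\<^sup>+x. f x * indicator {0<..} (\<sigma> * (x n - t)) \<partial>lebP ?J) = ennreal m"
      and bary': "\<forall>\<sigma> i. \<sigma> = 1 \<or> \<sigma> = -1 \<longrightarrow> i \<in> I \<longrightarrow>
       (\<integral>\<^sup>+x. ennreal (x i - z i - (x n - t) * \<beta> i) * (f x * indicator {0<..} (\<sigma> * (x n - t))) \<partial>lebP ?J) < \<infinity> \<and>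
       (\<integral>\<^sup>+x. ennreal (x i - z i - (x n - t) * \<beta> i) * (f x * indicator {0<..} (\<sigma> * (x n - t))) \<partial>lebP ?J) =
       (\<integral>\<^sup>+x. ennreal (- (x i - z i - (x n - t) * \<beta> i)) * (f x * indicator {0<..} (\<sigma> * (x n - t))) \<partial>lebP ?J)"
      by (rule balanced_shear[OF f fpos])
    note half = half'[rule_format] and bary = bary'[rule_format]
    define \<kappa> where "\<kappa> = enn2real (half_gauss\<^sup>2)"
    have \<kappa>: "\<kappa> \<ge> 0" "ennreal \<kappa> = half_gauss\<^sup>2"
      using half_gauss_finite by (simp_all add: \<kappa>_def power2_eq_square ennreal_mult_less_top)
    define Z where "Z = glue I n z t"
    define X where "X x s = glue I n (\<lambda>i. x i + (z i + s * \<beta> i)) (t + s)" for x s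
    define Y where "Y y u = glue I n y (u - ip I \<beta> y)" for y u
    have X [simp]: "X x s n = t + s" "i \<in> I \<Longrightarrow> X x s i = x i + (z i + s * \<beta> i)" for x s i
      using n by (auto simp: X_def glue_def)
    have Xsp: "X x s \<in> space (lebP ?J)" and Ysp: "Y y u \<in> space (lebP ?J)" for x s y u
      by (auto simp: X_def Y_def glue_def space_PiM)
    have Xm [measurable (raw)]: "(\<lambda>w. X (a w) (b w)) \<in> N \<rightarrow>\<^sub>M lebP ?J"
      if "\<And>i. i \<in> I \<Longrightarrow> (\<lambda>w. a w i) \<in> borel_measurable N" "b \<in> borel_measurable N"
      for a b and N :: "'z measure"
      unfolding X_def using that by measurable
    have Ym [measurable (raw)]: "(\<lambda>w. Y (a w) (b w)) \<in> N \<rightarrow>\<^sub>M lebP ?J"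
      if "\<And>i. i \<in> I \<Longrightarrow> (\<lambda>w. a w i) \<in> borel_measurable N" "b \<in> borel_measurable N"
      for a b and N :: "'z measure"
      unfolding Y_def using that by measurable
    define F where "F \<sigma> x = (\<integral>\<^sup>+s. f (X x (\<sigma> * s)) * indicator {0<..} s \<partial>lborel)" for \<sigma> x
    have Feq: "F \<sigma> x = (\<integral>\<^sup>+s. f (X x s) * indicator {0<..} (\<sigma> * s) \<partial>lborel)" if x: "x \<in> space (lebP I)" and \<sigma>: "\<sigma> = 1 \<or> \<sigma> = -1" for \<sigma> x
    proof -
      have "(\<lambda>s. f (X x s) * indicator {0<..} (\<sigma> * s)) \<in> borel_measurable borel" by measurable
      from nn_integral_reflect_real[OF this \<sigma>] show ?thesis
        unfolding F_def using \<sigma> by (auto simp: mult.assoc[symmetric])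
    qed
    have Fint: "(\<integral>\<^sup>+x. k x * F \<sigma> x \<partial>lebP I) = (\<integral>\<^sup>+x. K x * (f x * indicator {0<..} (\<sigma> * (x n - t))) \<partial>lebP ?J)"
      if \<sigma>: "\<sigma> = 1 \<or> \<sigma> = -1" and km[measurable]: "k \<in> borel_measurable (lebP I)" "K \<in> borel_measurable (lebP ?J)"
        and kK: "\<And>x s. K (X x s) = k x" for k K \<sigma>
    proof -
      have "(\<integral>\<^sup>+x. k x * F \<sigma> x \<partial>lebP I) = (\<integral>\<^sup>+x. \<integral>\<^sup>+s. k x * (f (X x s) * indicator {0<..} (\<sigma> * s)) \<partial>lborel \<partial>lebP I)"
        using Feq[OF _ \<sigma>] by (intro nn_integral_cong) (simp add: nn_integral_cmult)
      also have "\<dots> = (\<integral>\<^sup>+x. \<integral>\<^sup>+s. K (X x s) * (f (X x s) * indicator {0<..} (\<sigma> * (X x s n - t))) \<partial>lborel \<partial>lebP I)"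
        by (simp add: kK)
      also have "\<dots> = (\<integral>\<^sup>+x. K x * (f x * indicator {0<..} (\<sigma> * (x n - t))) \<partial>lebP ?J)"
        unfolding X_def by (rule integral_shear) measurable
      finally show ?thesis .
    qed
    have Fm [measurable]: "F \<sigma> \<in> borel_measurable (lebP I)" for \<sigma>
      unfolding F_def[abs_def] by measurable
    have F1: "(\<integral>\<^sup>+x. F \<sigma> x \<partial>lebP I) = ennreal m" if \<sigma>: "\<sigma> = 1 \<or> \<sigma> = -1" for \<sigma>
    proof -
      have "(\<integral>\<^sup>+x. 1 * F \<sigma> x \<partial>lebP I) = (\<integral>\<^sup>+x. 1 * (f x * indicator {0<..} (\<sigma> * (x n - t))) \<partial>lebP ?J)"
        by (rule Fint[OF \<sigma>]) auto
      then show ?thesis by (simp only: mult_1 half[OF \<sigma>])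
    qed
    have cF: "centered I (F \<sigma>)" if \<sigma>: "\<sigma> = 1 \<or> \<sigma> = -1" for \<sigma>
      unfolding centered_def
    proof (intro conjI ballI Fm)
      show "(\<integral>\<^sup>+x. F \<sigma> x \<partial>lebP I) < \<infinity>" by (simp add: F1[OF \<sigma>])
      fix i assume i: "i \<in> I"
      have [measurable]: "(\<lambda>x. x i) \<in> borel_measurable (lebP I)" "(\<lambda>x. x i) \<in> borel_measurable (lebP ?J)"
        using measurable_component_singleton[of i _ "\<lambda>_. lborel"] i by simp_all
      have [measurable]: "(\<lambda>x. x n) \<in> borel_measurable (lebP ?J)"
        using measurable_component_singleton[of n ?J "\<lambda>_. lborel"] by simp
      have h: "(\<lambda>x. ennreal (x i - z i - (x n - t) * \<beta> i)) \<in> borel_measurable (lebP ?J)"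
        "(\<lambda>x. ennreal (- (x i - z i - (x n - t) * \<beta> i))) \<in> borel_measurable (lebP ?J)"
        by measurable
      have e1: "(\<integral>\<^sup>+x. ennreal (x i) * F \<sigma> x \<partial>lebP I) = (\<integral>\<^sup>+x. ennreal (x i - z i - (x n - t) * \<beta> i) * (f x * indicator {0<..} (\<sigma> * (x n - t))) \<partial>lebP ?J)"
        using i by (intro Fint[OF \<sigma> _ h(1)]) auto
      have e2: "(\<integral>\<^sup>+x. ennreal (- x i) * F \<sigma> x \<partial>lebP I) = (\<integral>\<^sup>+x. ennreal (- (x i - z i - (x n - t) * \<beta> i)) * (f x * indicator {0<..} (\<sigma> * (x n - t))) \<partial>lebP ?J)"
        using i by (intro Fint[OF \<sigma> _ h(2)]) auto
      show "(\<integral>\<^sup>+x. ennreal (x i) * F \<sigma> x \<partial>lebP I) < \<infinity>" "(\<integral>\<^sup>+x. ennreal (x i) * F \<sigma> x \<partial>lebP I) = (\<integral>\<^sup>+x. ennreal (- x i) * F \<sigma> x \<partial>lebP I)"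
        unfolding e1 e2 using bary[OF \<sigma> i] by blast+
    qed
    show ?thesis
    proof (intro exI[of _ Z] ballI impI)
      fix g assume gm[measurable]: "g \<in> borel_measurable (lebP ?J)" and fg: "polar_pair ?J 1 f g"
      define g' where "g' y = g y * ennreal (exp (ip ?J Z y))" for y
      have [measurable]: "g' \<in> borel_measurable (lebP ?J)" unfolding g'_def[abs_def] by measurable
      define G where "G \<sigma> y = (\<integral>\<^sup>+u. g' (Y y (\<sigma> * u)) * indicator {0<..} u \<partial>lborel)" for \<sigma> y
      have Gm [measurable]: "G \<sigma> \<in> borel_measurable (lebP I)" for \<sigma> unfolding G_def[abs_def] by measurable
      \<comment> \<open>The tilt built into \<open>g'\<close> supplies the term
        \<open>ip ?J Z (Y y u)\<close> that \<open>ip_shear\<close> subtracts.\<close>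
      have fib: "f (X x s) * g' (Y y u) \<le> ennreal (exp (- ip I x y) * exp (- s * u))" for x y s u
      proof -
        have "f (X x s) * g' (Y y u) \<le> ennreal (1 * exp (- ip ?J (X x s) (Y y u))) * ennreal (exp (ip ?J Z (Y y u)))"
          unfolding g'_def mult.assoc[symmetric]
          using fg Xsp Ysp unfolding polar_pair_def by (intro mult_right_mono) auto
        also have "\<dots> = ennreal (exp (- (ip ?J (X x s) (Y y u) - ip ?J Z (Y y u))))"
          by (simp add: ennreal_mult[symmetric] exp_add[symmetric])
        also have "\<dots> = ennreal (exp (- ip I x y) * exp (- s * u))"
          unfolding X_def Y_def Z_def ip_shear by (simp add: exp_add[symmetric])
        finally show ?thesis .
      qed
      have FG: "(\<integral>\<^sup>+x. F \<sigma> x \<partial>lebP I) * (\<integral>\<^sup>+y. G \<sigma> y \<partial>lebP I) \<le> ennreal \<kappa> * santalo_const I" if \<sigma>: "\<sigma> = 1 \<or> \<sigma> = -1" for \<sigma>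
      proof (rule santalo_point_centered[OF fin P cF[OF \<sigma>] Gm \<kappa>(1)])
        show "polar_pair I \<kappa> (F \<sigma>) (G \<sigma>)"
          unfolding polar_pair_def
        proof (intro ballI)
          fix x y assume "x \<in> space (lebP I)" "y \<in> space (lebP I)"
          have "F \<sigma> x * G \<sigma> y \<le> ennreal (exp (- ip I x y)) * half_gauss\<^sup>2"
            unfolding F_def G_def
          proof (rule santalo_half_line)
            fix s u :: real
            \<comment> \<open>Both fiber variables carry the same sign \<open>\<sigma>\<close>, so
              their product is unchanged.\<close>
            show "f (X x (\<sigma> * s)) * g' (Y y (\<sigma> * u)) \<le> ennreal (exp (- ip I x y) * exp (- s * u))"
              using fib[of x "\<sigma> * s" y "\<sigma> * u"] \<sigma> by auto
          qed auto
          also have "\<dots> = ennreal (\<kappa> * exp (- ip I x y))"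
            using \<kappa> by (simp add: ennreal_mult mult.commute)
          finally show "F \<sigma> x * G \<sigma> y \<le> ennreal (\<kappa> * exp (- ip I x y))" .
        qed
      qed
      have Gsum: "G 1 y + G (-1) y = (\<integral>\<^sup>+u. g' (Y y u) \<partial>lborel)" for y
      proof -
        have "(\<lambda>u. g' (Y y u) * indicator {0<..} (-1 * u)) \<in> borel_measurable borel" by measurable
        from nn_integral_reflect_real[OF this, of "-1"]
        have "G (-1) y = (\<integral>\<^sup>+u. g' (Y y u) * indicator {0<..} (- u) \<partial>lborel)" by (simp add: G_def)
        then have "G 1 y + G (-1) y = (\<integral>\<^sup>+u. g' (Y y u) * indicator {0<..} u + g' (Y y u) * indicator {0<..} (- u) \<partial>lborel)"
          by (subst nn_integral_add) (auto simp: G_def)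
        also have "\<dots> = (\<integral>\<^sup>+u. g' (Y y u) \<partial>lborel)"
        proof (rule nn_integral_cong_AE)
          show "AE u in lborel. g' (Y y u) * indicator {0<..} u + g' (Y y u) * indicator {0<..} (- u) = g' (Y y u)"
            using AE_lborel_singleton[of "0 :: real"] by eventually_elim (auto simp: indicator_def)
        qed
        finally show ?thesis .
      qed
      have "(\<integral>\<^sup>+y. G 1 y \<partial>lebP I) + (\<integral>\<^sup>+y. G (-1) y \<partial>lebP I) = (\<integral>\<^sup>+y. \<integral>\<^sup>+u. g' (Y y u) \<partial>lborel \<partial>lebP I)"
        by (subst nn_integral_add[symmetric]) (auto simp: Gsum)
      also have "\<dots> = (\<integral>\<^sup>+y. g' y \<partial>lebP ?J)"
        unfolding Y_def by (rule integral_shear_dual) simp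
      finally have Gtot: "(\<integral>\<^sup>+y. g' y \<partial>lebP ?J) = (\<integral>\<^sup>+y. G 1 y \<partial>lebP I) + (\<integral>\<^sup>+y. G (-1) y \<partial>lebP I)" by simp
      \<comment> \<open>Each half of \<open>f\<close> has mass \<open>m\<close>, half of the total.
        The factor 2 from the mass and the factor 2 from adding two bounds form the 4 that
        \<open>santalo_const\<close> gains with each dimension.\<close>
      have "ennreal (2 * m) * (\<integral>\<^sup>+y. g' y \<partial>lebP ?J) = 2 * (ennreal m * (\<integral>\<^sup>+y. G 1 y \<partial>lebP I) + ennreal m * (\<integral>\<^sup>+y. G (-1) y \<partial>lebP I))"
        using m(2) by (simp add: Gtot ennreal_mult distrib_left mult.assoc)
      also have "\<dots> \<le> 2 * (ennreal \<kappa> * santalo_const I + ennreal \<kappa> * santalo_const I)"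
        using FG[of 1] FG[of "-1"] by (intro mult_left_mono add_mono) (simp_all add: F1)
      also have "\<dots> = santalo_const ?J"
      proof -
        have "2 * (a + a) = 4 * a" for a :: ennreal by (simp add: mult_2[symmetric] mult.assoc[symmetric])
        then show ?thesis using fin n by (simp add: santalo_const_def \<kappa> mult.assoc)
      qed
      finally show "(\<integral>\<^sup>+x. f x \<partial>lebP ?J) * (\<integral>\<^sup>+y. g y * ennreal (exp (ip ?J Z y)) \<partial>lebP ?J) \<le> santalo_const ?J"
        unfolding m(1) g'_def .
    qed
  qed (simp add: zero_le)
qed

end

lemma santalo_point_finite: "finite I \<Longrightarrow> santalo_point I"
proof (induction I rule: finite_induct)
  case empty
  show ?case
    unfolding santalo_point_def
  proof (intro allI impI exI ballI)
    fix f g :: "('a \<Rightarrow> real) \<Rightarrow> ennreal"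
    assume fg: "polar_pair {} 1 f g" and f: "tame {} f" and g: "g \<in> borel_measurable (lebP {})"
    have "f (\<lambda>_. undefined) * g (\<lambda>_. undefined) \<le> 1"
      using fg by (simp add: polar_pair_def space_PiM ip_def)
    then show "(\<integral>\<^sup>+x. f x \<partial>lebP {}) * (\<integral>\<^sup>+y. g y * ennreal (exp (ip {} undefined y)) \<partial>lebP {}) \<le> santalo_const {}"
      by (simp add: PiM_empty nn_integral_count_space_finite ip_def santalo_const_def)
  qed
next
  case (insert n I)
  then show ?case by (intro santalo_point_insert)
qed

theorem functional_santalo:
  assumes "finite I" "centered I f" "g \<in> borel_measurable (lebP I)" "polar_pair I 1 f g"
  shows "(\<integral>\<^sup>+x. f x \<partial>lebP I) * (\<integral>\<^sup>+y. g y \<partial>lebP I) \<le> santalo_const I"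
  using santalo_point_centered[OF assms(1) santalo_point_finite[OF assms(1)] assms(2,3) _ assms(4)] by simp

section \<open>The Blaschke--Santalo inequality\<close>

text \<open>The Gaussian \<open>exp (- (a\<^sup>2 / 2))\<close> is the superposition of the layers
  \<open>s \<ge> a\<close> with density \<open>s * exp (- (s\<^sup>2 / 2))\<close>;
  \<open>s ^ m\<close> is the factor by which an integral of homogeneity \<open>m\<close> grows over
  the dilate by \<open>s\<close>.\<close>

definition layer_weight :: "nat \<Rightarrow> ennreal" where
  "layer_weight m = (\<integral>\<^sup>+s. ennreal (s ^ m * (s * exp (- (s\<^sup>2 / 2)))) * indicator {0<..} s \<partial>lborel)"

lemma layer_weight_finite: "layer_weight m < \<infinity>"
proof -
  have "layer_weight m \<le> (\<integral>\<^sup>+s. ennreal (exp (1/2)) * (ennreal (s ^ Suc m * exp (- s)) * indicator {0..} s) \<partial>lborel)"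
    unfolding layer_weight_def
  proof (intro nn_integral_mono)
    fix s :: real
    show "ennreal (s ^ m * (s * exp (- (s\<^sup>2 / 2)))) * indicator {0<..} s \<le> ennreal (exp (1/2)) * (ennreal (s ^ Suc m * exp (- s)) * indicator {0..} s)"
    proof (cases "s > 0")
      case True
      have "0 \<le> (s - 1)\<^sup>2" by simp
      then have "- (s\<^sup>2 / 2) \<le> 1/2 + - s" by (simp add: power2_eq_square algebra_simps)
      then have "exp (- (s\<^sup>2 / 2)) \<le> exp (1/2) * exp (- s)" unfolding exp_add[symmetric] by simp
      then have "s ^ Suc m * exp (- (s\<^sup>2 / 2)) \<le> s ^ Suc m * (exp (1/2) * exp (- s))"
        using True by (intro mult_left_mono) auto
      then show ?thesis using True by (simp add: ennreal_mult[symmetric] mult_ac ennreal_leI)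
    qed simp
  qed
  also have "\<dots> = ennreal (exp (1/2)) * real_of_nat (fact (Suc m))"
    by (simp add: nn_integral_cmult nn_intergal_power_times_exp_Ici del: fact_Suc power_Suc)
  also have "\<dots> < \<infinity>" by (simp add: ennreal_mult_less_top)
  finally show ?thesis .
qed

lemma gauss_layers:
  assumes "a \<ge> 0"
  shows "(\<integral>\<^sup>+s. ennreal (s * exp (- (s\<^sup>2 / 2))) * indicator {a..} s \<partial>lborel) = ennreal (exp (- (a\<^sup>2 / 2)))"
proof -
  have "(\<integral>\<^sup>+s. ennreal (s * exp (- (s\<^sup>2 / 2))) * indicator {a..} s \<partial>lborel) = ennreal (0 - (- exp (- (a\<^sup>2 / 2))))"
  proof (rule nn_integral_FTC_atLeast)
    show "((\<lambda>s. - exp (- (s\<^sup>2 / 2))) has_real_derivative s * exp (- (s\<^sup>2 / 2))) (at s)" for s :: real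
      by (auto intro!: derivative_eq_intros)
    have "filterlim (\<lambda>s :: real. - (s\<^sup>2 / 2)) at_bot at_top"
      unfolding filterlim_at_bot eventually_at_top_linorder
    proof
      fix Z :: real
      show "\<exists>N. \<forall>s\<ge>N. - (s\<^sup>2 / 2) \<le> Z"
      proof (intro exI allI impI)
        fix s assume s: "max 1 (-2 * Z) \<le> s"
        then have "s \<le> s\<^sup>2" by (simp add: power2_eq_square)
        then show "- (s\<^sup>2 / 2) \<le> Z" using s by linarith
      qed
    qed
    then show "((\<lambda>s. - exp (- (s\<^sup>2 / 2))) \<longlongrightarrow> 0) (at_top :: real filter)"
      using tendsto_minus[OF filterlim_compose[OF exp_at_bot]] by fastforce
  qed (use assms in auto)
  then show ?thesis by simp
qed

lemma nn_integral_lborel_scale: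
  fixes G :: "'a::euclidean_space \<Rightarrow> ennreal"
  assumes [measurable]: "G \<in> borel_measurable borel" and s: "s > 0"
  shows "(\<integral>\<^sup>+x. G x \<partial>lborel) = ennreal (s ^ DIM('a)) * (\<integral>\<^sup>+x. G (s *\<^sub>R x) \<partial>lborel)"
proof -
  have "(\<integral>\<^sup>+x. G x \<partial>lborel) = (\<integral>\<^sup>+x. G x \<partial>density (distr lborel borel (\<lambda>x. 0 + s *\<^sub>R x)) (\<lambda>_. \<bar>s\<bar> ^ DIM('a)))"
    using lborel_affine[of s "0 :: 'a"] s by simp
  also have "\<dots> = (\<integral>\<^sup>+x. ennreal (s ^ DIM('a)) * G (s *\<^sub>R x) \<partial>lborel)"
    using s by (subst nn_integral_density) (simp_all add: nn_integral_distr)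
  finally show ?thesis by (simp add: nn_integral_cmult)
qed

text \<open>Writing the Gaussian of the gauge as a superposition of indicators of dilates of
  \<open>K\<close>, each dilate contributes \<open>s ^ CARD('n)\<close> from the volume and
  \<open>s ^ k\<close> from \<open>F\<close>. With \<open>k = 0\<close> this gives volumes; with
  \<open>k = 1\<close> it turns the centroid of \<open>K\<close> into the barycenter of the Gaussian
  function.\<close>

lemma gauss_gauge_integral:
  fixes K :: "(real ^ 'n::finite) set" and F :: "real ^ 'n \<Rightarrow> ennreal"
  assumes K: "origin_body K" and [measurable]: "F \<in> borel_measurable borel"
    and hom: "\<And>s x. s > 0 \<Longrightarrow> F (s *\<^sub>R x) = ennreal (s ^ k) * F x"
  shows "(\<integral>\<^sup>+x. F x * ennreal (exp (- ((support_function (polar_body K) x)\<^sup>2 / 2))) \<partial>lborel) =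
    layer_weight (CARD('n) + k) * (\<integral>\<^sup>+x. F x * indicator K x \<partial>lborel)"
proof -
  let ?p = "support_function (polar_body K)"
  note K' = origin_body_polar[OF K]
  have pm[measurable]: "?p \<in> borel_measurable borel"
    by (intro borel_measurable_continuous_onI continuous_support[OF K'])
  have Km[measurable]: "K \<in> sets borel" using origin_bodyD(6)[OF K] by (rule borel_closed)
  have "(\<integral>\<^sup>+x. F x * ennreal (exp (- ((?p x)\<^sup>2 / 2))) \<partial>lborel) =
      (\<integral>\<^sup>+x. \<integral>\<^sup>+s. F x * (ennreal (s * exp (- (s\<^sup>2 / 2))) * indicator {?p x..} s) \<partial>lborel \<partial>lborel)"
    by (simp add: nn_integral_cmult gauss_layers[OF support_nonneg[OF K']])
  also have "\<dots> = (\<integral>\<^sup>+s. \<integral>\<^sup>+x. F x * (ennreal (s * exp (- (s\<^sup>2 / 2))) * indicator {?p x..} s) \<partial>lborel \<partial>lborel)"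
    by (rule lborel_pair.Fubini'[symmetric]) (simp add: split_beta' indicator_def)
  also have "\<dots> = (\<integral>\<^sup>+s. (ennreal (s ^ (CARD('n) + k) * (s * exp (- (s\<^sup>2 / 2)))) * indicator {0<..} s) * (\<integral>\<^sup>+x. F x * indicator K x \<partial>lborel) \<partial>lborel)"
  proof (rule nn_integral_cong_AE)
    have "(\<integral>\<^sup>+x. F x * (ennreal (s * exp (- (s\<^sup>2 / 2))) * indicator {?p x..} s) \<partial>lborel) =
      (ennreal (s ^ (CARD('n) + k) * (s * exp (- (s\<^sup>2 / 2)))) * indicator {0<..} s) * (\<integral>\<^sup>+x. F x * indicator K x \<partial>lborel)"
      if "s \<noteq> 0" for s :: real
    proof (cases "s > 0")
      case True
      let ?c = "ennreal (s * exp (- (s\<^sup>2 / 2)))"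
      have "(\<integral>\<^sup>+x. F x * (?c * indicator {?p x..} s) \<partial>lborel) = ennreal (s ^ CARD('n)) * (\<integral>\<^sup>+x. F (s *\<^sub>R x) * (?c * indicator {?p (s *\<^sub>R x)..} s) \<partial>lborel)"
        using nn_integral_lborel_scale[of "\<lambda>x. F x * (?c * indicator {?p x..} s)", OF _ True] by (simp add: indicator_def)
      also have "(\<integral>\<^sup>+x. F (s *\<^sub>R x) * (?c * indicator {?p (s *\<^sub>R x)..} s) \<partial>lborel) = (\<integral>\<^sup>+x. (ennreal (s ^ k) * ?c) * (F x * indicator K x) \<partial>lborel)"
      proof (rule nn_integral_cong)
        fix x
        have "indicator {?p (s *\<^sub>R x)..} s = (indicator K x :: ennreal)"
          using True by (subst (2) body_eq[OF K]) (simp add: support_scale[OF K'] indicator_def)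
        then show "F (s *\<^sub>R x) * (?c * indicator {?p (s *\<^sub>R x)..} s) = (ennreal (s ^ k) * ?c) * (F x * indicator K x)"
          by (simp only: hom[OF True] mult_ac)
      qed
      also have "\<dots> = (ennreal (s ^ k) * ?c) * (\<integral>\<^sup>+x. F x * indicator K x \<partial>lborel)"
        by (rule nn_integral_cmult) simp
      finally show ?thesis using True by (simp add: ennreal_mult power_add mult_ac)
    next
      case False
      then have "indicator {?p x..} s = (0::ennreal)" for x
        using support_nonneg[OF K', of x] that by (simp add: indicator_def)
      then show ?thesis using False by simp
    qed
    then show "AE s in lborel. (\<integral>\<^sup>+x. F x * (ennreal (s * exp (- (s\<^sup>2 / 2))) * indicator {?p x..} s) \<partial>lborel) =
      (ennreal (s ^ (CARD('n) + k) * (s * exp (- (s\<^sup>2 / 2)))) * indicator {0<..} s) * (\<integral>\<^sup>+x. F x * indicator K x \<partial>lborel)"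
      using AE_lborel_singleton[of "0::real"] by (auto elim!: eventually_mono)
  qed
  also have "\<dots> = layer_weight (CARD('n) + k) * (\<integral>\<^sup>+x. F x * indicator K x \<partial>lborel)"
    unfolding layer_weight_def by (rule nn_integral_multc) simp
  finally show ?thesis .
qed

lemma unit_ball_ellipsoid: "cball 0 1 = centered_ellipsoid (mat 1 :: real ^ 'n::finite ^ 'n)"
  by (simp add: centered_ellipsoid_def)

lemma unit_ball_body:
  shows "origin_body (cball 0 1 :: (real ^ 'n::finite) set)"
    and "support_function (polar_body (cball 0 1)) (x :: real ^ 'n) = norm x"
proof -
  have "(mat 1 :: real ^ 'n ^ 'n) ** mat 1 = mat 1" by simp
  then show "origin_body (cball 0 1 :: (real ^ 'n) set)" "support_function (polar_body (cball 0 1)) (x :: real ^ 'n) = norm x"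
    using origin_body_ellipsoid[of "mat 1 :: real ^ 'n ^ 'n" "mat 1"] gauge_ellipsoid[of "mat 1 :: real ^ 'n ^ 'n" "mat 1" x]
    by (simp_all add: unit_ball_ellipsoid)
qed

lemma gauss_line: "(\<integral>\<^sup>+s. ennreal (exp (- (s\<^sup>2 / 2))) \<partial>lborel) = 2 * half_gauss"
proof -
  let ?g = "\<lambda>s :: real. ennreal (exp (- (s\<^sup>2 / 2)))"
  have "(\<integral>\<^sup>+s. ?g s \<partial>lborel) = (\<integral>\<^sup>+s. ?g s * indicator {0<..} s + ?g s * indicator {0<..} (- s) \<partial>lborel)"
    by (rule nn_integral_cong_AE, use AE_lborel_singleton[of "0::real"] in eventually_elim) (auto simp: indicator_def)
  also have "\<dots> = half_gauss + (\<integral>\<^sup>+s. ?g s * indicator {0<..} (- s) \<partial>lborel)"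
    unfolding half_gauss_def by (rule nn_integral_add) auto
  also have "(\<integral>\<^sup>+s. ?g s * indicator {0<..} (- s) \<partial>lborel) = half_gauss"
    using nn_integral_reflect_real[of "\<lambda>s. ?g s * indicator {0<..} s" "-1"] by (simp add: half_gauss_def)
  finally show ?thesis by (simp add: mult_2)
qed

lemma gauss_norm_integral:
  "(\<integral>\<^sup>+x. ennreal (exp (- ((norm (x :: real ^ 'n::finite))\<^sup>2 / 2))) \<partial>lborel) = (2 * half_gauss) ^ CARD('n)"
proof -
  have "exp (- ((norm x)\<^sup>2 / 2)) = (\<Prod>b\<in>Basis. exp (- ((x \<bullet> b)\<^sup>2 / 2)))" for x :: "real ^ 'n"
  proof -
    have "(norm x)\<^sup>2 = (\<Sum>b\<in>Basis. (x \<bullet> b)\<^sup>2)"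
      unfolding power2_norm_eq_inner by (subst euclidean_inner) (simp add: power2_eq_square)
    then have "- ((norm x)\<^sup>2 / 2) = (\<Sum>b\<in>Basis. - ((x \<bullet> b)\<^sup>2 / 2))"
      by (simp add: sum_negf sum_divide_distrib)
    then show ?thesis by (simp add: exp_sum)
  qed
  then have "(\<integral>\<^sup>+x. ennreal (exp (- ((norm (x :: real ^ 'n))\<^sup>2 / 2))) \<partial>lborel) = (\<integral>\<^sup>+x. ennreal (\<Prod>b\<in>Basis. exp (- ((x \<bullet> b)\<^sup>2 / 2))) \<partial>(lborel :: (real ^ 'n) measure))"
    by simp
  also have "\<dots> = (\<integral>\<^sup>+x. (\<Prod>b\<in>Basis. ennreal (exp (- ((x \<bullet> b)\<^sup>2 / 2)))) \<partial>(lborel :: (real ^ 'n) measure))"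
    by (simp add: prod_ennreal)
  also have "\<dots> = (\<Prod>b\<in>(Basis :: (real ^ 'n) set). \<integral>\<^sup>+s. ennreal (exp (- (s\<^sup>2 / 2))) \<partial>lborel)"
    by (rule nn_integral_lborel_prod) auto
  finally show ?thesis by (simp add: gauss_line)
qed

definition basis_vec :: "('a \<Rightarrow> real) \<Rightarrow> 'a::euclidean_space" where
  "basis_vec x = (\<Sum>b\<in>Basis. x b *\<^sub>R b)"

lemma basis_vec_inner: "b \<in> Basis \<Longrightarrow> basis_vec x \<bullet> b = x b"
  by (simp add: basis_vec_def)

lemma measurable_basis_vec [measurable]: "basis_vec \<in> lebP Basis \<rightarrow>\<^sub>M borel"
  unfolding basis_vec_def[abs_def] by measurable

lemma nn_integral_basis_vec:
  fixes F :: "'a::euclidean_space \<Rightarrow> ennreal"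
  assumes [measurable]: "F \<in> borel_measurable borel"
  shows "(\<integral>\<^sup>+x. F (basis_vec x) \<partial>lebP Basis) = (\<integral>\<^sup>+x. F x \<partial>lborel)"
proof -
  have "distr (lebP Basis) borel basis_vec = (lborel :: 'a measure)"
    unfolding basis_vec_def[abs_def] by (rule lborel_eq[symmetric])
  then have "(\<integral>\<^sup>+x. F x \<partial>lborel) = (\<integral>\<^sup>+x. F x \<partial>distr (lebP Basis) borel basis_vec)" by (simp only:)
  also have "\<dots> = (\<integral>\<^sup>+x. F (basis_vec x) \<partial>lebP Basis)" by (rule nn_integral_distr) measurable
  finally show ?thesis by (rule sym)
qed

lemma ip_basis_vec: "ip Basis x y = basis_vec x \<bullet> basis_vec (y :: 'a::euclidean_space \<Rightarrow> real)"
  by (subst euclidean_inner) (simp add: ip_def basis_vec_inner)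

lemma measure_body:
  fixes K :: "(real ^ 'n::finite) set"
  assumes K: "origin_body K"
  shows "emeasure lborel K = ennreal (measure lebesgue K)" "measure lebesgue K > 0"
proof -
  have Km: "K \<in> sets borel" using origin_bodyD(6)[OF K] by (rule borel_closed)
  have l: "K \<in> lmeasurable" using origin_bodyD(1)[OF K] by (rule lmeasurable_compact)
  have "emeasure lebesgue K = ennreal (measure lebesgue K)"
    using l by (rule emeasure_eq_measure2)
  then show "emeasure lborel K = ennreal (measure lebesgue K)" using Km by (simp add: emeasure_completion)
  have "\<not> negligible K" using origin_bodyD(3)[OF K] open_not_negligible[OF open_interior, of K] negligible_subset[OF _ interior_subset] by blast
  then have "measure lebesgue K \<noteq> 0" using l negligible_iff_measure by blast
  then show "measure lebesgue K > 0" using measure_nonneg[of lebesgue K] by linarith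
qed

lemma centroid_zero_halves:
  fixes K :: "(real ^ 'n::finite) set"
  assumes K: "origin_body K" and c: "centroid K = 0" and b: "b \<in> Basis"
  shows "(\<integral>\<^sup>+x. ennreal (x \<bullet> b) * indicator K x \<partial>lborel) < \<infinity>"
    "(\<integral>\<^sup>+x. ennreal (x \<bullet> b) * indicator K x \<partial>lborel) = (\<integral>\<^sup>+x. ennreal (- (x \<bullet> b)) * indicator K x \<partial>lborel)"
proof -
  have i: "integrable lborel (\<lambda>x. indicator K x *\<^sub>R x)"
    using origin_bodyD(1)[OF K] by (intro borel_integrable_compact continuous_on_id)
  have "set_lebesgue_integral lebesgue K (\<lambda>x. x) = 0"
    using c measure_body(2)[OF K] by (simp add: centroid_def)
  then have z: "(\<integral>x. indicator K x *\<^sub>R x \<partial>lborel) = 0"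
    unfolding set_lebesgue_integral_def using i by (simp add: integral_completion borel_measurable_integrable)
  let ?k = "\<lambda>x. indicator K x * (x \<bullet> b)"
  have ik: "integrable lborel ?k" using integrable_inner_left[OF i, of b] by simp
  have zk: "(\<integral>x. ?k x \<partial>lborel) = 0"
    using integral_inner_left[OF i, of b] z by simp
  have e1: "ennreal (x \<bullet> b) * indicator K x = ennreal (?k x)" and e2: "ennreal (- (x \<bullet> b)) * indicator K x = ennreal (- ?k x)" for x
    by (auto simp: indicator_def)
  define P N where "P = (\<integral>\<^sup>+x. ennreal (?k x) \<partial>lborel)" and "N = (\<integral>\<^sup>+x. ennreal (- ?k x) \<partial>lborel)"
  have fin: "P \<noteq> \<infinity>" "N \<noteq> \<infinity>" using ik unfolding real_integrable_def P_def N_def by blast+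
  have "enn2real P - enn2real N = 0"
    using real_lebesgue_integral_def[OF ik] zk unfolding P_def N_def by metis
  then have "P = N" using fin by (metis eq_iff_diff_eq_0 ennreal_enn2real infinity_ennreal_def less_top)
  then show "(\<integral>\<^sup>+x. ennreal (x \<bullet> b) * indicator K x \<partial>lborel) < \<infinity>"
    "(\<integral>\<^sup>+x. ennreal (x \<bullet> b) * indicator K x \<partial>lborel) = (\<integral>\<^sup>+x. ennreal (- (x \<bullet> b)) * indicator K x \<partial>lborel)"
    unfolding e1 e2 using fin by (simp_all add: P_def[symmetric] N_def[symmetric] less_top[symmetric])
qed

text \<open>The Gaussians of the gauge and of the support function are a polar pair, because
  \<open>x \<bullet> y \<le> ?a * ?b\<close> and a product is at most half the sum of the squares.
  Their integrals are the two volumes with the same layer weight.\<close>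

theorem blaschke_santalo:
  fixes K :: "(real ^ 'n::finite) set"
  assumes K: "origin_body K" and c: "centroid K = 0"
  shows "measure lebesgue K * measure lebesgue (polar_body K) \<le> (measure lebesgue (cball 0 1 :: (real ^ 'n) set))\<^sup>2"
proof -
  let ?p = "support_function (polar_body K)" and ?h = "support_function K"
  let ?w = "layer_weight (CARD('n))"
  note K' = origin_body_polar[OF K]
  have [measurable]: "?p \<in> borel_measurable borel" "?h \<in> borel_measurable borel"
    by (intro borel_measurable_continuous_onI continuous_support K K')+
  define f where "f x = ennreal (exp (- ((?p (basis_vec x))\<^sup>2 / 2)))" for x
  define g where "g x = ennreal (exp (- ((?h (basis_vec x))\<^sup>2 / 2)))" for x
  have [measurable]: "f \<in> borel_measurable (lebP Basis)" "g \<in> borel_measurable (lebP Basis)"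
    unfolding f_def[abs_def] g_def[abs_def] by measurable
  have vol: "(\<integral>\<^sup>+x. ennreal (exp (- ((support_function (polar_body L) x)\<^sup>2 / 2))) \<partial>lborel) = ?w * ennreal (measure lebesgue L)"
    if L: "origin_body L" for L :: "(real ^ 'n) set"
    using gauss_gauge_integral[OF L, of "\<lambda>_. 1" 0] measure_body(1)[OF L] borel_closed[OF origin_bodyD(6)[OF L]] by simp
  have fi: "(\<integral>\<^sup>+x. f x \<partial>lebP Basis) = ?w * ennreal (measure lebesgue K)"
    unfolding f_def by (subst nn_integral_basis_vec) (simp_all add: vol[OF K])
  have gi: "(\<integral>\<^sup>+x. g x \<partial>lebP Basis) = ?w * ennreal (measure lebesgue (polar_body K))"
    unfolding g_def by (subst nn_integral_basis_vec) (use vol[OF K'] in \<open>simp_all add: bipolar[OF K]\<close>)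
  have mom: "(\<integral>\<^sup>+x. ennreal (\<sigma> * x b) * f x \<partial>lebP Basis) = layer_weight (CARD('n) + 1) * (\<integral>\<^sup>+x. ennreal (\<sigma> * (x \<bullet> b)) * indicator K x \<partial>lborel)"
    if b: "b \<in> Basis" for \<sigma> b
  proof -
    have "(\<integral>\<^sup>+x. ennreal (\<sigma> * x b) * f x \<partial>lebP Basis) = (\<integral>\<^sup>+x. ennreal (\<sigma> * (basis_vec x \<bullet> b)) * ennreal (exp (- ((?p (basis_vec x))\<^sup>2 / 2))) \<partial>lebP Basis)"
      by (simp add: basis_vec_inner[OF b] f_def)
    also have "\<dots> = (\<integral>\<^sup>+x. ennreal (\<sigma> * (x \<bullet> b)) * ennreal (exp (- ((?p x)\<^sup>2 / 2))) \<partial>lborel)"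
      by (rule nn_integral_basis_vec) simp
    also have "\<dots> = layer_weight (CARD('n) + 1) * (\<integral>\<^sup>+x. ennreal (\<sigma> * (x \<bullet> b)) * indicator K x \<partial>lborel)"
    proof (rule gauss_gauge_integral[OF K])
      fix s :: real and x :: "real ^ 'n" assume "s > 0"
      then show "ennreal (\<sigma> * (s *\<^sub>R x \<bullet> b)) = ennreal (s ^ 1) * ennreal (\<sigma> * (x \<bullet> b))"
        using ennreal_mult'[of s "\<sigma> * (x \<bullet> b)"] by (simp add: mult_ac)
    qed simp
    finally show ?thesis .
  qed
  have "centered Basis f"
    unfolding centered_def
  proof (intro conjI ballI)
    show "(\<integral>\<^sup>+x. f x \<partial>lebP Basis) < \<infinity>" unfolding fi using layer_weight_finite by (simp add: ennreal_mult_less_top)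
    fix b :: "real ^ 'n" assume b: "b \<in> Basis"
    show "(\<integral>\<^sup>+x. ennreal (x b) * f x \<partial>lebP Basis) < \<infinity>"
      using mom[OF b, of 1] layer_weight_finite[of "CARD('n) + 1"] centroid_zero_halves(1)[OF K c b] by (simp add: ennreal_mult_less_top)
    show "(\<integral>\<^sup>+x. ennreal (x b) * f x \<partial>lebP Basis) = (\<integral>\<^sup>+x. ennreal (- x b) * f x \<partial>lebP Basis)"
      using mom[OF b, of 1] mom[OF b, of "-1"] centroid_zero_halves(2)[OF K c b] by simp
  qed simp
  moreover have "polar_pair Basis 1 f g"
    unfolding polar_pair_def
  proof (intro ballI)
    fix x y :: "real ^ 'n \<Rightarrow> real"
    let ?a = "?p (basis_vec x)" and ?b = "?h (basis_vec y)"
    have "ip Basis x y \<le> ?a * ?b" unfolding ip_basis_vec by (rule gauge_inner_le[OF K])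
    moreover have "0 \<le> (?a - ?b)\<^sup>2" by simp
    ultimately have "- (?a\<^sup>2 / 2) + - (?b\<^sup>2 / 2) \<le> - ip Basis x y" by (simp add: power2_eq_square algebra_simps)
    then show "f x * g y \<le> ennreal (1 * exp (- ip Basis x y))"
      by (simp add: f_def g_def ennreal_mult[symmetric] exp_add[symmetric] ennreal_leI)
  qed
  ultimately have "(\<integral>\<^sup>+x. f x \<partial>lebP Basis) * (\<integral>\<^sup>+y. g y \<partial>lebP Basis) \<le> santalo_const (Basis :: (real ^ 'n) set)"
    by (intro functional_santalo) auto
  also have "santalo_const (Basis :: (real ^ 'n) set) = ((2 * half_gauss) ^ CARD('n))\<^sup>2"
  proof -
    have "4 * half_gauss\<^sup>2 = (2 * half_gauss)\<^sup>2" by (simp add: power_mult_distrib)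
    then show ?thesis by (simp only: santalo_const_def power_mult[symmetric] mult.commute DIM_cart DIM_real mult_1_right mult_1_left)
  qed
  \<comment> \<open>The constant is calibrated by the unit ball, whose gauge is the Euclidean norm.
    It obeys the same layer formula, so \<open>?w\<close> appears squared on both sides and cancels
    once it is known to be nonzero.\<close>
  also have "(2 * half_gauss) ^ CARD('n) = ?w * ennreal (measure lebesgue (cball 0 1 :: (real ^ 'n) set))"
    using gauss_norm_integral[where 'n = 'n] vol[OF unit_ball_body(1)] by (simp add: unit_ball_body(2))
  finally have main: "(?w * ennreal (measure lebesgue K)) * (?w * ennreal (measure lebesgue (polar_body K))) \<le> (?w * ennreal (measure lebesgue (cball 0 1 :: (real ^ 'n) set)))\<^sup>2"
    unfolding fi gi .
  obtain w where w: "?w = ennreal w" "w \<ge> 0"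
    using layer_weight_finite[of "CARD('n)"] by (metis enn2real_nonneg ennreal_enn2real infinity_ennreal_def)
  have "w \<noteq> 0"
  proof
    assume "w = 0"
    then have "(2 * half_gauss) ^ CARD('n) = 0"
      using gauss_norm_integral[where 'n = 'n] vol[OF unit_ball_body(1)] w by (simp add: unit_ball_body(2))
    then have "half_gauss = 0" by simp
    then have "AE u in lborel. ennreal (exp (- (u\<^sup>2 / 2))) * indicator {0<..} (u::real) = 0"
      unfolding half_gauss_def by (subst (asm) nn_integral_0_iff_AE) auto
    then have "AE u in lborel. u \<notin> {0<..<1::real}" by eventually_elim (auto simp: indicator_def)
    then have "emeasure lborel {0<..<1::real} = 0" by (subst (asm) AE_iff_measurable[of "{0<..<1}"]) auto
    then show False by simp
  qed
  have "ennreal (w\<^sup>2 * (measure lebesgue K * measure lebesgue (polar_body K))) \<le> ennreal (w\<^sup>2 * (measure lebesgue (cball 0 1 :: (real ^ 'n) set))\<^sup>2)"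
    using main w by (simp add: ennreal_mult[symmetric] ennreal_power power2_eq_square mult_ac)
  then have "w\<^sup>2 * (measure lebesgue K * measure lebesgue (polar_body K)) \<le> w\<^sup>2 * (measure lebesgue (cball 0 1 :: (real ^ 'n) set))\<^sup>2"
    by (subst (asm) ennreal_le_iff) auto
  then show ?thesis using \<open>w \<noteq> 0\<close> by simp
qed

section \<open>Mixed affine surface areas\<close>

lemma weighted_arith_geo:
  fixes a w :: "'j \<Rightarrow> real"
  assumes "finite J" "\<And>j. j \<in> J \<Longrightarrow> a j > 0" "\<And>j. j \<in> J \<Longrightarrow> w j \<ge> 0" "(\<Sum>j\<in>J. w j) = 1"
  shows "(\<Prod>j\<in>J. a j powr w j) \<le> (\<Sum>j\<in>J. w j * a j)"
proof -
  have ne: "J \<noteq> {}" using assms(4) by auto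
  have "(\<Prod>j\<in>J. a j powr w j) = exp (\<Sum>j\<in>J. w j *\<^sub>R ln (a j))"
    using assms(1,2) by (simp add: exp_sum powr_def less_imp_neq[symmetric] cong: prod.cong)
  also have "\<dots> \<le> (\<Sum>j\<in>J. w j * exp (ln (a j)))"
    by (rule convex_on_sum[OF assms(1) ne exp_convex]) (use assms in auto)
  also have "\<dots> = (\<Sum>j\<in>J. w j * a j)" using assms(2) by (intro sum.cong) auto
  finally show ?thesis .
qed

text \<open>Divide each \<open>F j\<close> by its integral and apply the weighted
  arithmetic-geometric mean inequality pointwise; the weighted means integrate to the sum of the
  weights, which is 1.\<close>

lemma holder_nn_integral:
  fixes F :: "'j \<Rightarrow> 'a::euclidean_space \<Rightarrow> real"
  assumes J: "finite J" "\<And>j. j \<in> J \<Longrightarrow> w j \<ge> 0" "(\<Sum>j\<in>J. w j) = 1"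
    and F: "\<And>j. j \<in> J \<Longrightarrow> F j absolutely_integrable_on S" "\<And>j y. j \<in> J \<Longrightarrow> y \<in> S \<Longrightarrow> F j y > 0"
    and I: "\<And>j. j \<in> J \<Longrightarrow> (LINT y:S|lebesgue. F j y) = I j" "\<And>j. j \<in> J \<Longrightarrow> I j > 0"
  shows "(\<integral>\<^sup>+y. ennreal (\<Prod>j\<in>J. F j y powr w j) * indicator S y \<partial>lebesgue) \<le> ennreal (\<Prod>j\<in>J. I j powr w j)"
proof -
  let ?P = "\<Prod>j\<in>J. I j powr w j"
  let ?G = "\<lambda>y. \<Sum>j\<in>J. (?P * w j / I j) * (indicator S y *\<^sub>R F j y)"
  have P: "?P \<ge> 0" by (intro prod_nonneg) simp
  have int: "integrable lebesgue (\<lambda>y. indicator S y *\<^sub>R F j y)" if "j \<in> J" for j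
    using F(1)[OF that] by (simp add: set_integrable_def)
  have le: "ennreal (\<Prod>j\<in>J. F j y powr w j) * indicator S y \<le> ennreal (?G y)" for y
  proof (cases "y \<in> S")
    case True
    have "(\<Prod>j\<in>J. F j y powr w j) = (\<Prod>j\<in>J. I j powr w j * (F j y / I j) powr w j)"
      using F(2)[OF _ True] I(2) by (intro prod.cong refl) (simp add: powr_mult[symmetric] less_imp_le less_imp_neq[symmetric])
    also have "\<dots> = ?P * (\<Prod>j\<in>J. (F j y / I j) powr w j)" by (rule prod.distrib)
    also have "\<dots> \<le> ?P * (\<Sum>j\<in>J. w j * (F j y / I j))"
      by (intro mult_left_mono weighted_arith_geo J P) (simp add: F(2) I(2) True)
    also have "\<dots> = ?G y" using True by (simp add: sum_distrib_left mult_ac)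
    finally show ?thesis using True by (simp add: ennreal_leI)
  qed simp
  have "(\<integral>\<^sup>+y. ennreal (\<Prod>j\<in>J. F j y powr w j) * indicator S y \<partial>lebesgue) \<le> (\<integral>\<^sup>+y. ennreal (?G y) \<partial>lebesgue)"
    by (intro nn_integral_mono le)
  also have "\<dots> = ennreal (\<integral>y. ?G y \<partial>lebesgue)"
  proof (rule nn_integral_eq_integral)
    show "integrable lebesgue ?G" by (intro Bochner_Integration.integrable_sum integrable_mult_right int)
    show "AE y in lebesgue. 0 \<le> ?G y"
    proof (rule AE_I2, rule sum_nonneg)
      fix y j assume j: "j \<in> J"
      have "0 \<le> indicator S y *\<^sub>R F j y" using F(2)[OF j, of y] by (auto simp: indicator_def less_imp_le)
      then show "0 \<le> (?P * w j / I j) * (indicator S y *\<^sub>R F j y)"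
        using P J(2)[OF j] I(2)[OF j] by (intro mult_nonneg_nonneg divide_nonneg_pos) auto
    qed
  qed
  also have "(\<integral>y. ?G y \<partial>lebesgue) = (\<Sum>j\<in>J. (?P * w j / I j) * (\<integral>y. indicator S y *\<^sub>R F j y \<partial>lebesgue))"
  proof -
    have "(\<integral>y. ?G y \<partial>lebesgue) = (\<Sum>j\<in>J. \<integral>y. (?P * w j / I j) * (indicator S y *\<^sub>R F j y) \<partial>lebesgue)"
      by (rule Bochner_Integration.integral_sum) (intro integrable_mult_right int)
    also have "\<dots> = (\<Sum>j\<in>J. (?P * w j / I j) * (\<integral>y. indicator S y *\<^sub>R F j y \<partial>lebesgue))"
      by (intro sum.cong refl integral_mult_right_zero)
    finally show ?thesis .
  qed
  also have "\<dots> = (\<Sum>j\<in>J. ?P * w j)"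
  proof (rule sum.cong[OF refl])
    fix j assume j: "j \<in> J"
    show "(?P * w j / I j) * (\<integral>y. indicator S y *\<^sub>R F j y \<partial>lebesgue) = ?P * w j"
      using I[OF j] by (simp only: set_lebesgue_integral_def) simp
  qed
  also have "\<dots> = ?P" using J(3) by (simp add: sum_distrib_left[symmetric])
  finally show ?thesis .
qed

abbreviation punctured_ball :: "(real ^ 'n) set" where
  "punctured_ball \<equiv> cball 0 1 - {0}"

section \<open>Integration over the sphere in cones\<close>

lemma sets_sphere_measure: "sets sphere_measure = sets (restrict_space borel (sphere 0 1 :: (real ^ 'n::finite) set))"
  by (simp add: sphere_measure_def)

lemma space_sphere_measure: "space sphere_measure = (sphere 0 1 :: (real ^ 'n::finite) set)"
  by (simp add: sets_eq_imp_space_eq[OF sets_sphere_measure] space_restrict_space)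

lemma sphere_proj_sphere: "y \<noteq> 0 \<Longrightarrow> norm (sphere_proj y) = 1"
  by (simp add: sphere_proj_def)

lemma nn_integral_sphere:
  fixes \<Phi> :: "real ^ 'n::finite \<Rightarrow> real"
  assumes \<Phi>: "\<Phi> \<in> borel_measurable (restrict_space borel (sphere 0 1))"
  shows "(\<integral>\<^sup>+u. ennreal (\<Phi> u) \<partial>sphere_measure) =
    of_nat CARD('n) * (\<integral>\<^sup>+y. ennreal (\<Phi> (sphere_proj y)) * indicator punctured_ball y \<partial>lebesgue)"
proof -
  let ?D = "punctured_ball :: (real ^ 'n) set"
  let ?R = "restrict_space borel (sphere 0 1) :: (real ^ 'n) measure"
  have sp: "(\<lambda>x :: real ^ 'n. x /\<^sub>R norm x) \<in> restrict_space lborel ?D \<rightarrow>\<^sub>M ?R"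
  proof (rule measurable_restrict_space2)
    show "(\<lambda>x :: real ^ 'n. x /\<^sub>R norm x) \<in> space (restrict_space lborel ?D) \<rightarrow> sphere 0 1"
      by (auto simp: space_restrict_space)
    have "(\<lambda>x :: real ^ 'n. x /\<^sub>R norm x) \<in> borel_measurable borel" by measurable
    then show "(\<lambda>x :: real ^ 'n. x /\<^sub>R norm x) \<in> restrict_space lborel ?D \<rightarrow>\<^sub>M borel"
      by (intro measurable_restrict_space1) simp
  qed
  have "(\<integral>\<^sup>+u. ennreal (\<Phi> u) \<partial>sphere_measure) = of_nat CARD('n) * (\<integral>\<^sup>+u. ennreal (\<Phi> u) \<partial>distr (restrict_space lborel ?D) ?R (\<lambda>x. x /\<^sub>R norm x))"
    unfolding sphere_measure_def by (rule nn_integral_scale_measure) (use \<Phi> in simp)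
  also have "(\<integral>\<^sup>+u. ennreal (\<Phi> u) \<partial>distr (restrict_space lborel ?D) ?R (\<lambda>x. x /\<^sub>R norm x)) = (\<integral>\<^sup>+y. ennreal (\<Phi> (sphere_proj y)) \<partial>restrict_space lborel ?D)"
    unfolding sphere_proj_def by (rule nn_integral_distr[OF sp]) (use \<Phi> in simp)
  also have "\<dots> = (\<integral>\<^sup>+y. ennreal (\<Phi> (sphere_proj y)) * indicator ?D y \<partial>lborel)"
    by (rule nn_integral_restrict_space) simp
  also have "\<dots> = (\<integral>\<^sup>+y. ennreal (\<Phi> (sphere_proj y)) * indicator ?D y \<partial>lebesgue)"
    by (rule nn_integral_completion[symmetric])
  finally show ?thesis .
qed

text \<open>If \<open>\<Phi>\<close> is not Borel measurable, then its Bochner integral is the junk value \<open>0\<close>, which is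
  harmless for an upper bound.\<close>

lemma integral_sphere_le:
  fixes \<Phi> :: "real ^ 'n::finite \<Rightarrow> real"
  assumes nn: "\<And>u. norm u = 1 \<Longrightarrow> \<Phi> u \<ge> 0" and I: "I \<ge> 0"
    and le: "(\<integral>\<^sup>+y. ennreal (\<Phi> (sphere_proj y)) * indicator punctured_ball y \<partial>lebesgue) \<le> ennreal I"
  shows "(\<integral>u. \<Phi> u \<partial>sphere_measure) \<le> real CARD('n) * I"
proof (cases "integrable sphere_measure \<Phi>")
  case True
  then have m: "\<Phi> \<in> borel_measurable sphere_measure" by simp
  then have m': "\<Phi> \<in> borel_measurable (restrict_space borel (sphere 0 1))"
    using measurable_cong_sets[OF sets_sphere_measure refl] by blast
  have "(\<integral>u. \<Phi> u \<partial>sphere_measure) = enn2real (\<integral>\<^sup>+u. ennreal (\<Phi> u) \<partial>sphere_measure)"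
    by (rule integral_eq_nn_integral[OF m]) (auto intro!: AE_I2 nn simp: space_sphere_measure)
  also have "\<dots> \<le> enn2real (ennreal (real CARD('n) * I))"
  proof (rule enn2real_mono)
    show "(\<integral>\<^sup>+u. ennreal (\<Phi> u) \<partial>sphere_measure) \<le> ennreal (real CARD('n) * I)"
      unfolding nn_integral_sphere[OF m'] using mult_left_mono[OF le, of "of_nat CARD('n)"] I
      by (simp add: ennreal_mult ennreal_of_nat_eq_real_of_nat)
  qed simp
  finally show ?thesis using I by simp
next
  case False
  then show ?thesis using I by (simp add: not_integrable_integral_eq)
qed

text \<open>An equality cannot tolerate the default value 0 of a non-integrable function, so here
  \<open>\<Phi>\<close> is Borel. The equality case for ellipsoids relies on it.\<close>

lemma integral_sphere_eq:
  fixes \<Phi> :: "real ^ 'n::finite \<Rightarrow> real"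
  assumes nn: "\<And>u. norm u = 1 \<Longrightarrow> \<Phi> u \<ge> 0" and \<Phi>: "\<Phi> \<in> borel_measurable borel"
    and int: "(\<lambda>y. \<Phi> (sphere_proj y)) absolutely_integrable_on punctured_ball"
  shows "(\<integral>u. \<Phi> u \<partial>sphere_measure) = real CARD('n) * (LINT y:punctured_ball|lebesgue. \<Phi> (sphere_proj y))"
proof -
  have m': "\<Phi> \<in> borel_measurable (restrict_space borel (sphere 0 1))"
    using \<Phi> by (rule measurable_restrict_space1)
  then have m: "\<Phi> \<in> borel_measurable sphere_measure"
    using measurable_cong_sets[OF sets_sphere_measure refl] by blast
  let ?k = "\<lambda>y. indicator punctured_ball y *\<^sub>R \<Phi> (sphere_proj y)"
  have "(\<integral>\<^sup>+y. ennreal (\<Phi> (sphere_proj y)) * indicator punctured_ball y \<partial>lebesgue) = (\<integral>\<^sup>+y. ennreal (?k y) \<partial>lebesgue)"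
    by (intro nn_integral_cong) (auto simp: indicator_def)
  also have "\<dots> = ennreal (\<integral>y. ?k y \<partial>lebesgue)"
    using int unfolding set_integrable_def
    by (rule nn_integral_eq_integral) (auto intro!: AE_I2 nn simp: indicator_def sphere_proj_sphere)
  finally have "(\<integral>\<^sup>+u. ennreal (\<Phi> u) \<partial>sphere_measure) = of_nat CARD('n) * ennreal (LINT y:punctured_ball|lebesgue. \<Phi> (sphere_proj y))"
    unfolding nn_integral_sphere[OF m'] set_lebesgue_integral_def by simp
  moreover have "(\<integral>u. \<Phi> u \<partial>sphere_measure) = enn2real (\<integral>\<^sup>+u. ennreal (\<Phi> u) \<partial>sphere_measure)"
    by (rule integral_eq_nn_integral[OF m]) (auto intro!: AE_I2 nn simp: space_sphere_measure)
  moreover have "(LINT y:punctured_ball|lebesgue. \<Phi> (sphere_proj y)) \<ge> 0"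
    unfolding set_lebesgue_integral_def
    by (rule integral_nonneg_AE) (auto intro!: AE_I2 nn simp: indicator_def sphere_proj_sphere)
  ultimately show ?thesis by (simp add: enn2real_mult ennreal_of_nat_eq_real_of_nat)
qed

lemma homogeneous_power:
  assumes "homogeneous r \<phi>" "t > 0"
  shows "\<phi> t = \<phi> 1 * t powr r"
  using assms unfolding homogeneous_def by (metis mult.commute mult.right_neutral zero_less_one)

lemma curvature_function_pos:
  fixes K :: "(real ^ 'n::finite) set"
  assumes "regular_body K" "norm u = 1"
  shows "curvature_function K u > 0"
proof -
  obtain x where x: "x \<in> frontier K" "outer_normal K x = u"
    using frontier_normal_exists[OF regular_body_smooth[OF assms(1)] assms(2)] by blast
  then have "gauss_curvature K x > 0" using assms(1) by (simp add: regular_body_def)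
  then show ?thesis using curvature_function_normal[OF assms(1) x(1)] x(2) by simp
qed

text \<open>Put \<open>a = h * f\<close> and \<open>b = 1 / h ^ n\<close>, the cone densities for
  the volumes of the body and of its polar. The argument of \<open>\<phi>\<close> is their quotient
  \<open>b / a\<close>, so homogeneity of degree \<open>r\<close> shifts the share \<open>r\<close>
  of the exponent from \<open>a\<close> to \<open>b\<close>.\<close>

lemma affine_integrand_powr:
  fixes f h q r \<phi>1 :: real
  assumes "f > 0" "h > 0" "\<phi>1 > 0"
  shows "(\<phi>1 * (1 / (f * h ^ (n + 1))) powr r * h * f) powr q =
    \<phi>1 powr q * (h * f) powr ((1 - r) * q) * (1 / h ^ n) powr (r * q)"
proof -
  define a b where "a = h * f" and "b = 1 / h ^ n"
  have pos: "a > 0" "b > 0" using assms by (simp_all add: a_def b_def)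
  have "1 / (f * h ^ (n + 1)) = b / a" by (simp add: a_def b_def mult.commute)
  moreover have "(b / a) powr r * a = a powr (1 - r) * b powr r"
    using pos by (simp add: powr_divide powr_diff)
  ultimately have e: "\<phi>1 * (1 / (f * h ^ (n + 1))) powr r * h * f = \<phi>1 * (a powr (1 - r) * b powr r)"
    by (simp only: a_def mult.assoc)
  have "(\<phi>1 * (1 / (f * h ^ (n + 1))) powr r * h * f) powr q = \<phi>1 powr q * a powr ((1 - r) * q) * b powr (r * q)"
    unfolding e using pos assms by (simp add: powr_mult powr_powr)
  then show ?thesis by (simp only: a_def b_def)
qed

context
  fixes K :: "'n::finite \<Rightarrow> (real ^ 'n) set" and \<phi> :: "'n \<Rightarrow> real \<Rightarrow> real" and r :: "'n \<Rightarrow> real"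
  assumes reg: "\<And>i. regular_body (K i)"
    and \<phi>: "\<And>i. \<phi> i \<in> Conc" "\<And>i. homogeneous (r i) (\<phi> i)"
    and r: "\<And>i. 0 \<le> r i" "\<And>i. r i < 1"
begin

lemma phi1_pos: "\<phi> i 1 > 0"
  using \<phi>(1)[of i] by (simp add: Conc_def)

lemma mixed_as_nonneg: "mixed_as \<phi> K \<ge> 0"
  unfolding mixed_as_def by (intro integral_nonneg_AE AE_I2 prod_nonneg) simp

lemma mixed_as_le:
  "mixed_as \<phi> K \<le> real CARD('n) * (\<Prod>i\<in>UNIV. \<phi> i 1 powr (1 / real CARD('n)) *
     (measure lebesgue (K i) powr ((1 - r i) * (1 / real CARD('n))) *
      measure lebesgue (polar_body (K i)) powr (r i * (1 / real CARD('n)))))"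
proof -
  let ?n = "CARD('n)" let ?q = "1 / real CARD('n)"
  let ?D = "punctured_ball :: (real ^ 'n) set"
  define h where "h i = support_function (K i)" for i
  define f where "f i = curvature_function (K i)" for i
  define \<Phi> where "\<Phi> u = (\<Prod>i\<in>UNIV. (\<phi> i (1 / (f i u * h i u ^ (?n + 1))) * h i u * f i u) powr ?q)" for u
  define C where "C = (\<Prod>i\<in>UNIV. \<phi> i 1 powr ?q)"
  \<comment> \<open>The \<open>2 * n\<close> Hoelder functions: \<open>True\<close> marks the
    density for the body and \<open>False\<close> the one for its polar. For fixed \<open>i\<close>
    the two exponents in \<open>w\<close> add up to \<open>?q\<close>, so all exponents together add
    up to 1.\<close>
  define F where "F j y = (case j of (i, b) \<Rightarrow> if b then h i (sphere_proj y) * f i (sphere_proj y) else 1 / h i (sphere_proj y) ^ ?n)"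
    for j :: "'n \<times> bool" and y
  define w where "w j = (case j of (i, b) \<Rightarrow> if b then (1 - r i) * ?q else r i * ?q)" for j :: "'n \<times> bool"
  define I where "I j = (case j of (i, b) \<Rightarrow> if b then measure lebesgue (K i) else measure lebesgue (polar_body (K i)))" for j :: "'n \<times> bool"
  have hpos: "h i u > 0" and fpos: "f i u > 0" if "norm u = 1" for i u
    using that support_pos[OF regular_body_origin[OF reg], of u i] curvature_function_pos[OF reg that] by (force simp: h_def f_def)+
  have pairs: "(\<Prod>j\<in>UNIV. g j) = (\<Prod>i\<in>UNIV. g (i, True) * g (i, False))" for g :: "'n \<times> bool \<Rightarrow> real"
  proof -
    have "(\<Prod>j\<in>UNIV. g j) = (\<Prod>i\<in>UNIV. \<Prod>b\<in>UNIV. g (i, b))" by (simp add: prod.cartesian_product)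
    then show ?thesis by (simp add: UNIV_bool mult.commute)
  qed
  have spairs: "(\<Sum>j\<in>UNIV. g j) = (\<Sum>i\<in>UNIV. g (i, True) + g (i, False))" for g :: "'n \<times> bool \<Rightarrow> real"
  proof -
    have "(\<Sum>j\<in>UNIV. g j) = (\<Sum>i\<in>UNIV. \<Sum>b\<in>UNIV. g (i, b))" by (simp add: sum.cartesian_product)
    then show ?thesis by (simp add: UNIV_bool add.commute)
  qed
  have \<Phi>: "\<Phi> (sphere_proj y) = C * (\<Prod>j\<in>UNIV. F j y powr w j)" if "y \<in> ?D" for y
  proof -
    let ?u = "sphere_proj y"
    have u: "norm ?u = 1" using that by (simp add: sphere_proj_sphere)
    have "(\<phi> i (1 / (f i ?u * h i ?u ^ (?n + 1))) * h i ?u * f i ?u) powr ?q =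
       \<phi> i 1 powr ?q * (F (i, True) y powr w (i, True) * F (i, False) y powr w (i, False))" for i
    proof -
      have "1 / (f i ?u * h i ?u ^ (?n + 1)) > 0" using hpos[OF u] fpos[OF u] by simp
      then show ?thesis
        unfolding homogeneous_power[OF \<phi>(2) \<open>1 / (f i ?u * h i ?u ^ (?n + 1)) > 0\<close>]
        using affine_integrand_powr[OF fpos[OF u] hpos[OF u] phi1_pos, of i i i ?n "r i" ?q]
        by (simp add: F_def w_def mult.assoc)
    qed
    then show ?thesis by (simp add: \<Phi>_def C_def pairs prod.distrib)
  qed
  have Fint: "F j absolutely_integrable_on ?D" for j
  proof -
    obtain i b where j: "j = (i, b)" by (cases j)
    show ?thesis
      using integral_support_curvature(1)[OF reg[of i]] integral_gauge_power(1)[OF regular_body_polar[OF reg[of i]]]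
      unfolding F_def[abs_def] j h_def f_def by (cases b) (simp_all add: bipolar[OF regular_body_origin[OF reg[of i]]])
  qed
  have C: "C \<ge> 0" unfolding C_def by (intro prod_nonneg) simp
  have "(\<integral>\<^sup>+y. ennreal (\<Prod>j\<in>UNIV. F j y powr w j) * indicator ?D y \<partial>lebesgue) \<le> ennreal (\<Prod>j\<in>UNIV. I j powr w j)"
  proof (rule holder_nn_integral)
    fix j :: "'n \<times> bool"
    obtain i b where j: "j = (i, b)" by (cases j)
    show "w j \<ge> 0" using r[of i] by (auto simp: w_def j)
    show "F j absolutely_integrable_on ?D" by (rule Fint)
    show "(LINT y:?D|lebesgue. F j y) = I j"
      using integral_support_curvature(2)[OF reg[of i]] integral_gauge_power(2)[OF regular_body_polar[OF reg[of i]]]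
      unfolding F_def[abs_def] I_def j h_def f_def by (simp add: bipolar[OF regular_body_origin[OF reg[of i]]])
    show "I j > 0" using measure_body(2)[OF regular_body_origin[OF reg[of i]]] measure_body(2)[OF regular_body_origin_polar[OF reg[of i]]] by (simp add: I_def j)
    fix y assume "y \<in> ?D"
    then have "norm (sphere_proj y) = 1" by (simp add: sphere_proj_sphere)
    then show "F j y > 0" using hpos fpos by (simp add: F_def j)
  next
    have "(\<Sum>j\<in>UNIV. w j) = (\<Sum>i\<in>(UNIV :: 'n set). ?q)"
      unfolding spairs by (intro sum.cong refl) (simp add: w_def add_divide_distrib[symmetric])
    then show "(\<Sum>j\<in>UNIV. w j) = 1" by simp
  qed simp
  then have "ennreal C * (\<integral>\<^sup>+y. ennreal (\<Prod>j\<in>UNIV. F j y powr w j) * indicator ?D y \<partial>lebesgue) \<le> ennreal C * ennreal (\<Prod>j\<in>UNIV. I j powr w j)"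
    by (rule mult_left_mono) simp
  moreover have "(\<integral>\<^sup>+y. ennreal (\<Phi> (sphere_proj y)) * indicator ?D y \<partial>lebesgue) = ennreal C * (\<integral>\<^sup>+y. ennreal (\<Prod>j\<in>UNIV. F j y powr w j) * indicator ?D y \<partial>lebesgue)"
  proof -
    have D: "?D \<in> sets lebesgue" by auto
    \<comment> \<open>Absolute integrability provides measurability of \<open>F j\<close> only after
      multiplication by the indicator of \<open>?D\<close>, so the indicator is first put inside the
      powers.\<close>
    have Fm: "(\<lambda>y. ennreal (\<Prod>j\<in>UNIV. F j y powr w j) * indicator ?D y) \<in> borel_measurable lebesgue"
    proof -
      have "(\<lambda>y. indicator ?D y *\<^sub>R F j y) \<in> borel_measurable lebesgue" for j
        using Fint unfolding set_integrable_def by (rule borel_measurable_integrable)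
      then have "(\<lambda>y. ennreal (\<Prod>j\<in>UNIV. (indicator ?D y *\<^sub>R F j y) powr w j) * indicator ?D y) \<in> borel_measurable lebesgue"
        using D by measurable
      then show ?thesis
        by (rule measurable_cong[THEN iffD1, rotated]) (auto simp: indicator_def)
    qed
    have "(\<integral>\<^sup>+y. ennreal (\<Phi> (sphere_proj y)) * indicator ?D y \<partial>lebesgue) = (\<integral>\<^sup>+y. ennreal C * (ennreal (\<Prod>j\<in>UNIV. F j y powr w j) * indicator ?D y) \<partial>lebesgue)"
      by (intro nn_integral_cong) (use C in \<open>auto simp: \<Phi> ennreal_mult prod_nonneg indicator_def\<close>)
    also have "\<dots> = ennreal C * (\<integral>\<^sup>+y. ennreal (\<Prod>j\<in>UNIV. F j y powr w j) * indicator ?D y \<partial>lebesgue)"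
      by (rule nn_integral_cmult[OF Fm])
    finally show ?thesis .
  qed
  ultimately have "(\<integral>\<^sup>+y. ennreal (\<Phi> (sphere_proj y)) * indicator ?D y \<partial>lebesgue) \<le> ennreal (C * (\<Prod>j\<in>UNIV. I j powr w j))"
    using C by (simp add: ennreal_mult prod_nonneg)
  then have "(\<integral>u. \<Phi> u \<partial>sphere_measure) \<le> real ?n * (C * (\<Prod>j\<in>UNIV. I j powr w j))"
    by (intro integral_sphere_le) (auto simp: \<Phi>_def C intro!: prod_nonneg mult_nonneg_nonneg)
  also have "(\<integral>u. \<Phi> u \<partial>sphere_measure) = mixed_as \<phi> K"
    by (simp add: mixed_as_def \<Phi>_def h_def f_def)
  also have "C * (\<Prod>j\<in>UNIV. I j powr w j) = (\<Prod>i\<in>UNIV. \<phi> i 1 powr ?q *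
     (measure lebesgue (K i) powr ((1 - r i) * ?q) * measure lebesgue (polar_body (K i)) powr (r i * ?q)))"
    by (simp add: C_def pairs prod.distrib I_def w_def)
  finally show ?thesis .
qed

end

lemma mixed_as_polar_product_le:
  fixes K :: "'n::finite \<Rightarrow> (real ^ 'n) set"
  assumes reg: "\<And>i. regular_body (K i)"
    and \<phi>: "\<And>i. \<phi> i \<in> Conc" "\<And>i. homogeneous (r i) (\<phi> i)" and r: "\<And>i. 0 \<le> r i" "\<And>i. r i < 1"
  shows "mixed_as \<phi> K * mixed_as \<phi> (\<lambda>i. polar_body (K i)) \<le> (real CARD('n))\<^sup>2 *
    (\<Prod>i\<in>UNIV. ((\<phi> i 1)\<^sup>2 * measure lebesgue (K i) * measure lebesgue (polar_body (K i))) powr (1 / real CARD('n)))"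
proof -
  let ?q = "1 / real CARD('n)"
  note reg' = regular_body_polar[OF reg]
  define a where "a i = measure lebesgue (K i)" for i
  define b where "b i = measure lebesgue (polar_body (K i))" for i
  define c where "c i = \<phi> i 1" for i
  have pos: "a i > 0" "b i > 0" "c i > 0" for i
    using measure_body(2)[OF regular_body_origin[OF reg[of i]]] measure_body(2)[OF regular_body_origin_polar[OF reg[of i]]] \<phi>(1)[of i]
    by (auto simp: a_def b_def c_def Conc_def)
  define P where "P = (\<Prod>i\<in>UNIV. c i powr ?q * (a i powr ((1 - r i) * ?q) * b i powr (r i * ?q)))"
  define Q where "Q = (\<Prod>i\<in>UNIV. c i powr ?q * (b i powr ((1 - r i) * ?q) * a i powr (r i * ?q)))"
  have P: "P \<ge> 0" unfolding P_def by (intro prod_nonneg) simp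
  have "mixed_as \<phi> K \<le> real CARD('n) * P"
    using mixed_as_le[OF reg \<phi> r] by (simp add: P_def a_def b_def c_def)
  moreover have "mixed_as \<phi> (\<lambda>i. polar_body (K i)) \<le> real CARD('n) * Q"
    using mixed_as_le[OF reg' \<phi> r] by (simp add: Q_def a_def b_def c_def bipolar[OF regular_body_origin[OF reg]])
  ultimately have "mixed_as \<phi> K * mixed_as \<phi> (\<lambda>i. polar_body (K i)) \<le> (real CARD('n) * P) * (real CARD('n) * Q)"
    using P mixed_as_nonneg[OF reg' \<phi> r] by (intro mult_mono) auto
  also have "\<dots> = (real CARD('n))\<^sup>2 * (P * Q)" by (simp add: power2_eq_square mult_ac)
  also have "P * Q = (\<Prod>i\<in>UNIV. ((c i)\<^sup>2 * a i * b i) powr ?q)"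
    unfolding P_def Q_def prod.distrib[symmetric]
  proof (rule prod.cong[OF refl])
    fix i
    have s: "x powr ((1 - r i) * ?q) * x powr (r i * ?q) = x powr ?q" for x
    proof -
      have "(1 - r i) * ?q + r i * ?q = ?q" unfolding distrib_right[symmetric] by simp
      then show ?thesis by (simp only: powr_add[symmetric])
    qed
    have "c i powr ?q * (a i powr ((1 - r i) * ?q) * b i powr (r i * ?q)) * (c i powr ?q * (b i powr ((1 - r i) * ?q) * a i powr (r i * ?q))) =
       (c i powr ?q * c i powr ?q) * (a i powr ((1 - r i) * ?q) * a i powr (r i * ?q)) * (b i powr ((1 - r i) * ?q) * b i powr (r i * ?q))"
      by (simp only: mult_ac)
    also have "\<dots> = (c i powr ?q * c i powr ?q) * a i powr ?q * b i powr ?q" by (simp only: s)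
    also have "\<dots> = ((c i)\<^sup>2 * a i * b i) powr ?q" using pos[of i] by (simp add: powr_mult power2_eq_square)
    finally show "c i powr ?q * (a i powr ((1 - r i) * ?q) * b i powr (r i * ?q)) * (c i powr ?q * (b i powr ((1 - r i) * ?q) * a i powr (r i * ?q))) = ((c i)\<^sup>2 * a i * b i) powr ?q" .
  qed
  finally show ?thesis by (simp add: a_def b_def c_def)
qed

section \<open>Ellipsoids and the equality case\<close>

lemma volume_ellipsoid:
  fixes A B :: "real ^ 'n::finite ^ 'n"
  assumes AB: "A ** B = mat 1" "B ** A = mat 1"
  shows "measure lebesgue (centered_ellipsoid A) = \<bar>det A\<bar> * measure lebesgue (cball 0 1 :: (real ^ 'n) set)"
proof -
  let ?U = "cball 0 1 :: (real ^ 'n) set"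
  have inj: "inj_on ((*v) A) ?U" by (rule inj_onI) (metis mv_inverse(2)[OF AB])
  have m: "?U \<in> lmeasurable" by (rule lmeasurable_compact) simp
  have lm: "integrable lebesgue (indicator S :: _ \<Rightarrow> real)" "(\<integral>x. indicator S x \<partial>lebesgue) = measure lebesgue S"
    if "S \<in> lmeasurable" for S :: "(real ^ 'n) set"
    using that by (auto simp: fmeasurable_def intro!: integrable_real_indicator)
  have "(\<lambda>x. \<bar>det (matrix ((*v) A))\<bar> * 1) absolutely_integrable_on ?U \<and>
      (LINT x:?U|lebesgue. \<bar>det (matrix ((*v) A))\<bar> * 1) = \<bar>det A\<bar> * measure lebesgue ?U"
    unfolding set_integrable_def set_lebesgue_integral_def using lm[OF m] by (simp add: mult.commute)
  then have "(\<lambda>x. 1 :: real) absolutely_integrable_on ((*v) A ` ?U) \<and> (LINT x:(*v) A ` ?U|lebesgue. 1) = \<bar>det A\<bar> * measure lebesgue ?U"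
    by (rule change_of_variables_real[where f = "\<lambda>_. 1", THEN iffD1, rotated 3])
       (use inj m in \<open>auto intro: fmeasurableD linear_imp_has_derivative\<close>)
  moreover have "(*v) A ` ?U \<in> lmeasurable"
    using origin_bodyD(1)[OF origin_body_ellipsoid[OF AB]] unfolding centered_ellipsoid_def by (rule lmeasurable_compact)
  ultimately show ?thesis using lm unfolding centered_ellipsoid_def set_lebesgue_integral_def by simp
qed

lemma scaled_ellipsoid:
  fixes A :: "real ^ 'n::finite ^ 'n"
  shows "centered_ellipsoid (c *\<^sub>R A) = (\<lambda>x. c *\<^sub>R x) ` centered_ellipsoid A"
  by (auto simp: centered_ellipsoid_def image_image scaleR_matrix_vector_assoc)

lemma scaled_inverse:
  fixes A B :: "real ^ 'n::finite ^ 'n"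
  assumes "A ** B = mat 1" "B ** A = mat 1" "c \<noteq> 0"
  shows "(c *\<^sub>R A) ** ((1 / c) *\<^sub>R B) = mat 1" "((1 / c) *\<^sub>R B) ** (c *\<^sub>R A) = mat 1"
  using assms by (simp_all add: scalar_matrix_assoc[symmetric] matrix_scalar_ac)

text \<open>Constancy of \<open>f * h ^ (n + 1)\<close> freezes the argument of each
  \<open>\<phi> i\<close> and leaves \<open>h * f\<close> proportional to \<open>1 / h ^ n\<close>.
  For dilates of one ellipsoid all \<open>n\<close> factors are then constants times the same
  \<open>1 / ?h u\<close>; their product is the cone density of the polar volume.\<close>

lemma mixed_as_ellipsoids:
  fixes A B :: "real ^ 'n::finite ^ 'n" and c :: "'n \<Rightarrow> real"
  assumes AB: "A ** B = mat 1" "B ** A = mat 1" and c: "\<And>i. c i > 0"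
    and \<phi>: "\<And>i. \<phi> i \<in> Conc" "\<And>i. homogeneous (r i) (\<phi> i)"
  shows "mixed_as \<phi> (\<lambda>i. centered_ellipsoid (c i *\<^sub>R A)) =
    real CARD('n) * measure lebesgue (polar_body (centered_ellipsoid A)) *
    (\<Prod>i\<in>UNIV. (\<phi> i 1 * ((det A)\<^sup>2 * c i ^ (2 * CARD('n))) powr (- r i) * ((det A)\<^sup>2 * c i ^ CARD('n))) powr (1 / real CARD('n)))"
proof -
  let ?n = "CARD('n)" let ?q = "1 / real ?n" let ?d = "(det A)\<^sup>2"
  let ?E = "centered_ellipsoid A" let ?h = "support_function (centered_ellipsoid A)"
  let ?c = "\<lambda>i. \<phi> i 1 * (?d * c i ^ (2 * ?n)) powr (- r i) * (?d * c i ^ ?n)"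
  have "det A * det B = 1" using AB(1) by (metis det_I det_mul)
  then have d: "?d > 0" by auto
  have phi: "\<phi> i 1 > 0" for i using \<phi>(1)[of i] by (simp add: Conc_def)
  have cc: "?c i > 0" for i using phi[of i] d c[of i] by simp
  have hm: "?h \<in> borel_measurable borel"
    by (intro borel_measurable_continuous_onI continuous_support[OF origin_body_ellipsoid[OF AB]])
  define C where "C = (\<Prod>i\<in>UNIV. ?c i powr ?q)"
  have pt: "(\<Prod>i\<in>UNIV. (\<phi> i (1 / (curvature_function (centered_ellipsoid (c i *\<^sub>R A)) u * support_function (centered_ellipsoid (c i *\<^sub>R A)) u ^ (?n + 1)))
           * support_function (centered_ellipsoid (c i *\<^sub>R A)) u * curvature_function (centered_ellipsoid (c i *\<^sub>R A)) u) powr ?q) = C * (1 / ?h u ^ ?n)"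
    if u: "norm u = 1" for u
  proof -
    have hu: "?h u > 0" using u by (intro support_pos[OF origin_body_ellipsoid[OF AB]]) force
    have "(\<phi> i (1 / (curvature_function (centered_ellipsoid (c i *\<^sub>R A)) u * support_function (centered_ellipsoid (c i *\<^sub>R A)) u ^ (?n + 1)))
           * support_function (centered_ellipsoid (c i *\<^sub>R A)) u * curvature_function (centered_ellipsoid (c i *\<^sub>R A)) u) powr ?q = ?c i powr ?q * (1 / ?h u)" for i
    proof -
      have ci: "c i \<noteq> 0" using c[of i] by simp
      let ?H = "support_function (centered_ellipsoid (c i *\<^sub>R A)) u" and ?f = "curvature_function (centered_ellipsoid (c i *\<^sub>R A)) u"
      note S = scaled_inverse[OF AB ci]
      have H: "?H = c i * ?h u"
        using c[of i] by (simp add: support_ellipsoid[OF S] support_ellipsoid[OF AB] transpose_scalar scaleR_matrix_vector_assoc[symmetric])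
      have dc: "(det (c i *\<^sub>R A))\<^sup>2 = ?d * c i ^ (2 * ?n)"
      proof -
        have "det (c i *\<^sub>R A) = det (matrix (\<lambda>x. c i *\<^sub>R (A *v x)))"
          by (simp add: scaleR_matrix_vector_assoc)
        also have "\<dots> = c i ^ ?n * det A"
          using det_matrix_compose[of "(*v) A" "\<lambda>x. c i *\<^sub>R x"] by (simp add: det_matrix_scale linear_scaleR)
        finally show ?thesis by (simp add: power_mult_distrib power_mult[symmetric] mult.commute)
      qed
      have fH: "?f * ?H ^ (?n + 1) = ?d * c i ^ (2 * ?n)"
        using curvature_function_ellipsoid[OF S u] dc by simp
      then have "?H * ?f * ?H ^ ?n = ?d * c i ^ (2 * ?n)" by (simp add: mult_ac)
      then have Hf: "?H * ?f = ?d * c i ^ ?n * (1 / ?h u ^ ?n)"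
      proof -
        have "(?H * ?f * ?h u ^ ?n) * c i ^ ?n = (?d * c i ^ ?n) * c i ^ ?n"
          using \<open>?H * ?f * ?H ^ ?n = ?d * c i ^ (2 * ?n)\<close>
          unfolding H power_mult_distrib mult_2 power_add by (simp only: mult_ac)
        then have "?H * ?f * ?h u ^ ?n = ?d * c i ^ ?n" using ci by simp
        then show ?thesis using hu by (simp add: field_simps)
      qed
      have t: "1 / (?d * c i ^ (2 * ?n)) > 0" using d c[of i] by simp
      have "\<phi> i (1 / (?f * ?H ^ (?n + 1))) * ?H * ?f = ?c i * (1 / ?h u ^ ?n)"
        unfolding fH homogeneous_power[OF \<phi>(2) t] mult.assoc Hf
        using d c[of i] by (simp add: powr_minus_divide powr_divide)
      then have "(\<phi> i (1 / (?f * ?H ^ (?n + 1))) * ?H * ?f) powr ?q = ?c i powr ?q * (1 / ?h u ^ ?n) powr ?q"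
        using cc[of i] hu by (simp only: powr_mult less_imp_le zero_le_divide_1_iff zero_le_power)
      also have "(1 / ?h u ^ ?n) powr ?q = 1 / ?h u"
        using hu by (simp add: powr_divide powr_realpow[symmetric] powr_powr)
      finally show ?thesis .
    qed
    then show ?thesis by (simp only: C_def prod.distrib prod_constant power_one_over)
  qed
  have "mixed_as \<phi> (\<lambda>i. centered_ellipsoid (c i *\<^sub>R A)) = (\<integral>u. C * (1 / ?h u ^ ?n) \<partial>sphere_measure)"
    unfolding mixed_as_def by (rule Bochner_Integration.integral_cong[OF refl]) (simp only: pt space_sphere_measure mem_sphere_0)
  also have "\<dots> = C * (\<integral>u. 1 / ?h u ^ ?n \<partial>sphere_measure)" by (rule integral_mult_right_zero)
  also have "(\<integral>u. 1 / ?h u ^ ?n \<partial>sphere_measure) = real ?n * (LINT y:punctured_ball|lebesgue. 1 / ?h (sphere_proj y) ^ ?n)"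
  proof (rule integral_sphere_eq)
    show "0 \<le> 1 / ?h u ^ ?n" for u using support_nonneg[OF origin_body_ellipsoid[OF AB], of u] by simp
    show "(\<lambda>u. 1 / ?h u ^ ?n) \<in> borel_measurable borel" using hm by measurable
    show "(\<lambda>y. 1 / ?h (sphere_proj y) ^ ?n) absolutely_integrable_on punctured_ball"
      using integral_gauge_power(1)[OF regular_body_polar[OF regular_body_ellipsoid[OF AB]]]
      by (simp add: bipolar[OF origin_body_ellipsoid[OF AB]])
  qed
  also have "(LINT y:punctured_ball|lebesgue. 1 / ?h (sphere_proj y) ^ ?n) = measure lebesgue (polar_body ?E)"
    using integral_gauge_power(2)[OF regular_body_polar[OF regular_body_ellipsoid[OF AB]]]
    by (simp add: bipolar[OF origin_body_ellipsoid[OF AB]])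
  finally show ?thesis by (simp add: C_def mult_ac)
qed

lemma mixed_as_unit_ball:
  fixes \<phi> :: "'n::finite \<Rightarrow> real \<Rightarrow> real"
  assumes \<phi>: "\<And>i. \<phi> i \<in> Conc" "\<And>i. homogeneous (r i) (\<phi> i)"
  shows "mixed_as \<phi> (\<lambda>_. cball 0 1) = real CARD('n) * measure lebesgue (cball 0 1 :: (real ^ 'n) set) *
    (\<Prod>i\<in>UNIV. \<phi> i 1 powr (1 / real CARD('n)))"
proof -
  have I: "(mat 1 :: real ^ 'n ^ 'n) ** mat 1 = mat 1" by simp
  have "polar_body (cball 0 1) = (cball 0 1 :: (real ^ 'n) set)"
    unfolding unit_ball_ellipsoid polar_ellipsoid[OF I I] by (simp add: transpose_mat)
  then show ?thesis
    using mixed_as_ellipsoids[OF I I, of "\<lambda>_. 1" \<phi> r] \<phi> by (simp add: unit_ball_ellipsoid[symmetric])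
qed

lemma volume_product_ellipsoid:
  fixes A B :: "real ^ 'n::finite ^ 'n"
  assumes AB: "A ** B = mat 1" "B ** A = mat 1"
  shows "measure lebesgue (centered_ellipsoid A) * measure lebesgue (polar_body (centered_ellipsoid A)) =
    (measure lebesgue (cball 0 1 :: (real ^ 'n) set))\<^sup>2"
proof -
  have "det A * det B = 1" using AB(1) by (metis det_I det_mul)
  then have "\<bar>det A\<bar> * \<bar>det B\<bar> = 1" by (metis abs_mult abs_one)
  then show ?thesis
    unfolding polar_ellipsoid[OF AB] volume_ellipsoid[OF AB] volume_ellipsoid[OF transpose_inverse[OF AB]]
    by (simp add: power2_eq_square)
qed

text \<open>Polarity replaces \<open>A\<close> by \<open>transpose B\<close> and \<open>c i\<close>
  by its reciprocal. Since the determinants of \<open>A\<close> and \<open>B\<close> are reciprocal,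
  the constants of the two surface areas multiply to those of the ball, and the volumes multiply to
  the square of the ball's volume.\<close>

lemma mixed_as_dilated_ellipsoids:
  fixes A B :: "real ^ 'n::finite ^ 'n" and c :: "'n \<Rightarrow> real"
  assumes AB: "A ** B = mat 1" "B ** A = mat 1" and c: "\<And>i. c i > 0"
    and \<phi>: "\<And>i. \<phi> i \<in> Conc" "\<And>i. homogeneous (r i) (\<phi> i)"
  shows "mixed_as \<phi> (\<lambda>i. centered_ellipsoid (c i *\<^sub>R A)) *
    mixed_as \<phi> (\<lambda>i. polar_body (centered_ellipsoid (c i *\<^sub>R A))) = (mixed_as \<phi> (\<lambda>_. cball 0 1))\<^sup>2"
proof -
  let ?n = "CARD('n)" let ?q = "1 / real ?n" let ?E = "centered_ellipsoid A"
  let ?X = "\<lambda>i d c. \<phi> i 1 * (d * c ^ (2 * ?n)) powr (- r i) * (d * c ^ ?n)"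
  note T = transpose_inverse[OF AB]
  have det: "det A * det B = 1" using AB(1) by (metis det_I det_mul)
  have "polar_body (centered_ellipsoid (c i *\<^sub>R A)) = centered_ellipsoid ((1 / c i) *\<^sub>R transpose B)" for i
    using c[of i] polar_ellipsoid[OF scaled_inverse[OF AB, of "c i"]] by (simp add: transpose_scalar)
  then have "mixed_as \<phi> (\<lambda>i. polar_body (centered_ellipsoid (c i *\<^sub>R A))) =
      real ?n * measure lebesgue ?E * (\<Prod>i\<in>UNIV. ?X i ((det B)\<^sup>2) (1 / c i) powr ?q)"
    using mixed_as_ellipsoids[OF T, of "\<lambda>i. 1 / c i" \<phi> r] c \<phi>
    by (simp only: polar_ellipsoid[OF AB, symmetric] bipolar[OF origin_body_ellipsoid[OF AB]] det_transpose zero_less_divide_1_iff)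
  then have "mixed_as \<phi> (\<lambda>i. centered_ellipsoid (c i *\<^sub>R A)) * mixed_as \<phi> (\<lambda>i. polar_body (centered_ellipsoid (c i *\<^sub>R A))) =
      (real ?n)\<^sup>2 * (measure lebesgue ?E * measure lebesgue (polar_body ?E)) *
      ((\<Prod>i\<in>UNIV. ?X i ((det A)\<^sup>2) (c i) powr ?q) * (\<Prod>i\<in>UNIV. ?X i ((det B)\<^sup>2) (1 / c i) powr ?q))"
    unfolding mixed_as_ellipsoids[OF AB c \<phi>] by (simp only: power2_eq_square mult_ac)
  also have "(\<Prod>i\<in>UNIV. ?X i ((det A)\<^sup>2) (c i) powr ?q) * (\<Prod>i\<in>UNIV. ?X i ((det B)\<^sup>2) (1 / c i) powr ?q) =
      (\<Prod>i\<in>UNIV. \<phi> i 1 powr ?q * \<phi> i 1 powr ?q)"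
    unfolding prod.distrib[symmetric]
  proof (rule prod.cong[OF refl])
    fix i
    let ?a = "(det A)\<^sup>2 * c i ^ (2 * ?n)" let ?b = "(det B)\<^sup>2 * (1 / c i) ^ (2 * ?n)"
    have dd: "(det A)\<^sup>2 * (det B)\<^sup>2 = 1" using det by (simp add: power_mult_distrib[symmetric])
    have cc: "c i ^ m * (1 / c i) ^ m = 1" for m using c[of i] by (simp add: power_mult_distrib[symmetric])
    have ab: "?a * ?b = 1" using dd cc[of "2 * ?n"] by (metis mult.assoc mult.left_commute mult.right_neutral)
    have ab': "((det A)\<^sup>2 * c i ^ ?n) * ((det B)\<^sup>2 * (1 / c i) ^ ?n) = 1" using dd cc[of ?n] by (metis mult.assoc mult.left_commute mult.right_neutral)
    have "?a powr (- r i) * ?b powr (- r i) = (?a * ?b) powr (- r i)"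
      by (rule powr_mult[symmetric])
    then have p: "?a powr (- r i) * ?b powr (- r i) = 1" unfolding ab by simp
    have "?X i ((det A)\<^sup>2) (c i) * ?X i ((det B)\<^sup>2) (1 / c i) = (\<phi> i 1 * \<phi> i 1) * (?a powr (- r i) * ?b powr (- r i)) *
        (((det A)\<^sup>2 * c i ^ ?n) * ((det B)\<^sup>2 * (1 / c i) ^ ?n))" by (simp only: mult_ac)
    also have "\<dots> = \<phi> i 1 * \<phi> i 1" unfolding p ab' by simp
    finally have X: "?X i ((det A)\<^sup>2) (c i) * ?X i ((det B)\<^sup>2) (1 / c i) = \<phi> i 1 * \<phi> i 1" .
    have "?X i ((det A)\<^sup>2) (c i) powr ?q * ?X i ((det B)\<^sup>2) (1 / c i) powr ?q =
        (?X i ((det A)\<^sup>2) (c i) * ?X i ((det B)\<^sup>2) (1 / c i)) powr ?q" by (rule powr_mult[symmetric])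
    also have "\<dots> = \<phi> i 1 powr ?q * \<phi> i 1 powr ?q" unfolding X by (rule powr_mult)
    finally show "?X i ((det A)\<^sup>2) (c i) powr ?q * ?X i ((det B)\<^sup>2) (1 / c i) powr ?q = \<phi> i 1 powr ?q * \<phi> i 1 powr ?q" .
  qed
  also note volume_product_ellipsoid[OF AB]
  finally show ?thesis
    unfolding mixed_as_unit_ball[of \<phi> r, OF \<phi>] prod.distrib by (simp only: power2_eq_square mult_ac)
qed

theorem theorem3p1:
  fixes K :: "'n::finite \<Rightarrow> (real ^ 'n) set"
    and \<phi> :: "'n \<Rightarrow> real \<Rightarrow> real"
    and r :: "'n \<Rightarrow> real"
  assumes "CARD('n) \<ge> 2"
    and "\<And>i. C2_plus (K i)"
    and "\<And>i. \<phi> i \<in> Conc"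
    and "\<And>i. 0 \<le> r i \<and> r i < 1"
    and "\<And>i. homogeneous (r i) (\<phi> i)"
  shows "mixed_as \<phi> K * mixed_as \<phi> (\<lambda>i. polar_body (K i))
           \<le> (real CARD('n))\<^sup>2 *
             (\<Prod>i\<in>UNIV. ((\<phi> i 1)\<^sup>2 * measure lebesgue (K i) * measure lebesgue (polar_body (K i)))
                          powr (1 / real CARD('n)))
       \<and> ((\<forall>i. centroid (K i) = 0) \<longrightarrow>
           mixed_as \<phi> K * mixed_as \<phi> (\<lambda>i. polar_body (K i)) \<le> (mixed_as \<phi> (\<lambda>_. cball 0 1))\<^sup>2
           \<and> ((\<forall>i. ellipsoid (K i) \<and> origin_symmetric (K i)) \<and> (\<forall>i j. dilates (K i) (K j)) \<longrightarrow>
               mixed_as \<phi> K * mixed_as \<phi> (\<lambda>i. polar_body (K i)) = (mixed_as \<phi> (\<lambda>_. cball 0 1))\<^sup>2))"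
proof (intro conjI impI)
  let ?q = "1 / real CARD('n)" let ?V = "measure lebesgue (cball 0 1 :: (real ^ 'n) set)"
  note reg = regular_body_C2_plus[OF assms(2)]
  have r: "0 \<le> r i" "r i < 1" for i using assms(4)[of i] by auto
  have phi: "\<phi> i 1 > 0" for i using assms(3)[of i] by (simp add: Conc_def)
  show main: "mixed_as \<phi> K * mixed_as \<phi> (\<lambda>i. polar_body (K i)) \<le> (real CARD('n))\<^sup>2 *
      (\<Prod>i\<in>UNIV. ((\<phi> i 1)\<^sup>2 * measure lebesgue (K i) * measure lebesgue (polar_body (K i))) powr ?q)"
    by (rule mixed_as_polar_product_le[OF reg assms(3,5) r])
  {
    assume cen: "\<forall>i. centroid (K i) = 0"
    have "(\<Prod>i\<in>UNIV. ((\<phi> i 1)\<^sup>2 * measure lebesgue (K i) * measure lebesgue (polar_body (K i))) powr ?q) \<le>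
        (\<Prod>i\<in>UNIV. ((\<phi> i 1)\<^sup>2 * ?V\<^sup>2) powr ?q)"
    proof (rule prod_mono, intro conjI powr_mono2)
      fix i
      show "(\<phi> i 1)\<^sup>2 * measure lebesgue (K i) * measure lebesgue (polar_body (K i)) \<le> (\<phi> i 1)\<^sup>2 * ?V\<^sup>2"
        unfolding mult.assoc using blaschke_santalo[OF regular_body_origin[OF reg[of i]]] cen by (intro mult_left_mono) auto
    qed auto
    also have "\<dots> = (\<Prod>i\<in>UNIV. (\<phi> i 1 powr ?q)\<^sup>2) * (\<Prod>i\<in>(UNIV :: 'n set). (?V powr ?q)\<^sup>2)"
      using phi by (simp add: powr_mult prod.distrib power2_eq_square less_imp_le)
    also have "\<dots> = (\<Prod>i\<in>UNIV. \<phi> i 1 powr ?q)\<^sup>2 * ?V\<^sup>2"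
    proof -
      have "(?V powr ?q) ^ CARD('n) = ?V" using measure_body(2)[OF unit_ball_body(1)] 
        by (simp add: powr_realpow[symmetric] powr_powr)
      then have "((?V powr ?q)\<^sup>2) ^ CARD('n) = ?V\<^sup>2" by (metis power_mult mult.commute)
      then show ?thesis by (simp add: prod_power_distrib)
    qed
    finally have "(real CARD('n))\<^sup>2 *
        (\<Prod>i\<in>UNIV. ((\<phi> i 1)\<^sup>2 * measure lebesgue (K i) * measure lebesgue (polar_body (K i))) powr ?q) \<le>
        (real CARD('n))\<^sup>2 * ((\<Prod>i\<in>UNIV. \<phi> i 1 powr ?q)\<^sup>2 * ?V\<^sup>2)"
      by (rule mult_left_mono) simp
    also have "\<dots> = (mixed_as \<phi> (\<lambda>_. cball 0 1))\<^sup>2"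
      unfolding mixed_as_unit_ball[of \<phi> r, OF assms(3,5)] by (simp only: power_mult_distrib mult_ac)
    finally show "mixed_as \<phi> K * mixed_as \<phi> (\<lambda>i. polar_body (K i)) \<le> (mixed_as \<phi> (\<lambda>_. cball 0 1))\<^sup>2"
      using main by simp
  }
  assume ell: "(\<forall>i. ellipsoid (K i) \<and> origin_symmetric (K i)) \<and> (\<forall>i j. dilates (K i) (K j))"
  \<comment> \<open>Any one of the bodies can serve as the reference ellipsoid, since all others are
    dilates of it.\<close>
  obtain A B :: "real ^ 'n ^ 'n" where AB: "A ** B = mat 1" "B ** A = mat 1" and KA: "K undefined = centered_ellipsoid A"
    using symmetric_ellipsoid_centered ell by meson
  have "\<forall>i. \<exists>c>0. K i = (\<lambda>x. c *\<^sub>R x) ` centered_ellipsoid A"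
    using ell unfolding dilates_def KA[symmetric] by blast
  then obtain c where c: "\<And>i. c i > 0" "\<And>i. K i = (\<lambda>x. c i *\<^sub>R x) ` centered_ellipsoid A" by metis
  have "K = (\<lambda>i. centered_ellipsoid (c i *\<^sub>R A))" using c(2) by (simp add: scaled_ellipsoid fun_eq_iff)
  then show "mixed_as \<phi> K * mixed_as \<phi> (\<lambda>i. polar_body (K i)) = (mixed_as \<phi> (\<lambda>_. cball 0 1))\<^sup>2"
    using mixed_as_dilated_ellipsoids[OF AB c(1) assms(3,5)] by simp
qed

end
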